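(* Let $\mathcal{A}$ be a unital $C^*$-algebra and let $\mathrm{rk}$ be a Sylvester matrix rank function for $\mathcal{A}$. The following hold: (1) For any $A\in M(\mathcal{A})_{\ge 0}$, the function $f: (0, +\infty)\rightarrow \mathbb{R}$ sending $\theta$ to $\mathrm{rk}(A^\theta)$ is uniformly continuous. (2) $\mathrm{rk}(A)=\mathrm{rk}(|A|)=\mathrm{rk}(A^* )$ and $\mathrm{rk}(|A|^\theta)=\mathrm{rk}(|A^*|^\theta)$ for all $A\in M(\mathcal{A})$ and $\theta>0$. (3) $\mathrm{rk}(B^\theta) \le \mathrm{rk}(A^\theta )$ for all $0<\theta\le 2$ and $B, A\in M(\mathcal{A})$ with $0\le B\le A$.
   Context: $M(\mathcal{A})$ is the set of all rectangular matrices over $\mathcal{A}$, $M(\mathcal{A})_{\ge0}$ the set of positive elements of the $C^*$-algebras $M_n(\mathcal{A})$, $n\ge1$; $|A|=(A^*A)^{1/2}$ and powers $A^\theta$ are defined by continuous functional calculus. A Sylvester matrix rank function for a unital (nonzero) ring $R$ is a function $\mathrm{rk}:M(R)\to\mathbb{R}_{\ge0}$ such that (i) $\mathrm{rk}(0)=0$ (for every zero matrix) and $\mathrm{rk}(1)=1$; (ii) $\mathrm{rk}(AB)\le\min(\mathrm{rk}(A),\mathrm{rk}(B))$ whenever $AB$ is defined; (iii) $\mathrm{rk}\left(\begin{bmatrix}A&0\\0&B\end{bmatrix}\right)=\mathrm{rk}(A)+\mathrm{rk}(B)$; (iv) $\mathrm{rk}\left(\begin{bmatrix}A&C\\0&B\end{bmatrix}\right)\ge\mathrm{rk}(A)+\mathrm{rk}(B)$.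 *)

theory Defs
  imports "HOL-Analysis.Analysis" "Jordan_Normal_Form.Matrix"
begin

text \<open>
  Nonzero unital $C^*$-algebras.  The class \<^class>\<open>real_normed_algebra_1\<close> includes
  $\|1\| = 1$, which holds automatically in a nonzero unital $C^*$-algebra; the zero algebra
  has no Sylvester matrix rank function.
\<close>

class cstar_algebra = real_normed_algebra_1 + banach +
  fixes scaleC :: "complex \<Rightarrow> 'a \<Rightarrow> 'a"
    and star :: "'a \<Rightarrow> 'a"
  assumes scaleC_add_right: "scaleC c (x + y) = scaleC c x + scaleC c y"
    and scaleC_add_left: "scaleC (c + d) x = scaleC c x + scaleC d x"
    and scaleC_scaleC: "scaleC c (scaleC d x) = scaleC (c * d) x"
    and scaleC_of_real: "scaleC (complex_of_real r) x = scaleR r x"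
    and mult_scaleC_left: "scaleC c x * y = scaleC c (x * y)"
    and mult_scaleC_right: "x * scaleC c y = scaleC c (x * y)"
    and norm_scaleC: "norm (scaleC c x) = cmod c * norm x"
    and star_star: "star (star x) = x"
    and star_add: "star (x + y) = star x + star y"
    and star_mult: "star (x * y) = star y * star x"
    and star_scaleC: "star (scaleC c x) = scaleC (cnj c) (star x)"
    and cstar_identity: "norm (star x * x) = (norm x)\<^sup>2"

instantiation complex :: cstar_algebra
begin
definition "scaleC_complex = (\<lambda>c x :: complex. c * x)"
definition "star_complex = cnj"
instance
  by standard
    (auto simp: scaleC_complex_def star_complex_def algebra_simps norm_mult scaleR_conv_of_real
      power2_eq_square)
end

text \<open>Rectangular matrices have at least one row and one column; the type \<open>'a mat\<close> also
  contains degenerate empty matrices.\<close>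

definition rect_mats :: "'a mat set" where
  "rect_mats = {A. 0 < dim_row A \<and> 0 < dim_col A}"

locale sylvester_rank_function =
  fixes rk :: "'a::ring_1 mat \<Rightarrow> real"
  assumes rk_nonneg: "A \<in> rect_mats \<Longrightarrow> 0 \<le> rk A"
    and rk_zero: "0 < m \<Longrightarrow> 0 < n \<Longrightarrow> rk (0\<^sub>m m n) = 0"
    and rk_one: "rk (1\<^sub>m 1) = 1"
    and rk_mult: "A \<in> rect_mats \<Longrightarrow> B \<in> rect_mats \<Longrightarrow> dim_col A = dim_row B \<Longrightarrow>
      rk (A * B) \<le> min (rk A) (rk B)"
    and rk_diag: "A \<in> rect_mats \<Longrightarrow> B \<in> rect_mats \<Longrightarrow>
      rk (four_block_mat A (0\<^sub>m (dim_row A) (dim_col B)) (0\<^sub>m (dim_row B) (dim_col A)) B)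
        = rk A + rk B"
    and rk_upper: "A \<in> rect_mats \<Longrightarrow> B \<in> rect_mats \<Longrightarrow> C \<in> carrier_mat (dim_row A) (dim_col B) \<Longrightarrow>
      rk (four_block_mat A C (0\<^sub>m (dim_row B) (dim_col A)) B) \<ge> rk A + rk B"

definition mat_star :: "'a::cstar_algebra mat \<Rightarrow> 'a mat" where
  "mat_star A = mat (dim_col A) (dim_row A) (\<lambda>(i, j). star (A $$ (j, i)))"

definition mat_scaleC :: "complex \<Rightarrow> 'a::cstar_algebra mat \<Rightarrow> 'a mat" where
  "mat_scaleC c A = map_mat (scaleC c) A"

definition mat_spectrum :: "'a::cstar_algebra mat \<Rightarrow> complex set" where
  "mat_spectrum A = {z. \<not> invertible_mat (mat_scaleC z (1\<^sub>m (dim_row A)) - A)}"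

definition positive_mat :: "'a::cstar_algebra mat \<Rightarrow> bool" where
  "positive_mat A \<longleftrightarrow> A \<in> rect_mats \<and> square_mat A \<and> mat_star A = A \<and>
     mat_spectrum A \<subseteq> complex_of_real ` {0..}"

definition mat_le :: "'a::cstar_algebra mat \<Rightarrow> 'a mat \<Rightarrow> bool" where
  "mat_le B A \<longleftrightarrow> dim_row A = dim_row B \<and> dim_col A = dim_col B \<and> positive_mat (A - B)"

text \<open>
  The continuous functional calculus at $A \in M_n(\mathcal{A})$: a continuous unital
  $*$-homomorphism from the continuous functions on the spectrum of $A$ to $M_n(\mathcal{A})$
  which maps the identity function to $A$.  Functions on the spectrum are represented by total
  functions, of which only the values on the spectrum matter.  Continuity is for the uniform
  norm on functions and for entrywise norm convergence of matrices; the latter is convergence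
  in the $C^*$-norm of $M_n(\mathcal{A})$, because
  $\max_{i,j} \|a_{ij}\| \le \|A\| \le \sum_{i,j} \|a_{ij}\|$.
\<close>

locale continuous_functional_calculus =
  fixes A :: "'a::cstar_algebra mat"
    and \<Phi> :: "(complex \<Rightarrow> complex) \<Rightarrow> 'a mat"
  assumes cfc_carrier: "continuous_on (mat_spectrum A) f \<Longrightarrow>
      \<Phi> f \<in> carrier_mat (dim_row A) (dim_row A)"
    and cfc_cong: "continuous_on (mat_spectrum A) f \<Longrightarrow> continuous_on (mat_spectrum A) g \<Longrightarrow>
      (\<And>z. z \<in> mat_spectrum A \<Longrightarrow> f z = g z) \<Longrightarrow> \<Phi> f = \<Phi> g"
    and cfc_one: "\<Phi> (\<lambda>z. 1) = 1\<^sub>m (dim_row A)"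
    and cfc_id: "\<Phi> (\<lambda>z. z) = A"
    and cfc_add: "continuous_on (mat_spectrum A) f \<Longrightarrow> continuous_on (mat_spectrum A) g \<Longrightarrow>
      \<Phi> (\<lambda>z. f z + g z) = \<Phi> f + \<Phi> g"
    and cfc_mult: "continuous_on (mat_spectrum A) f \<Longrightarrow> continuous_on (mat_spectrum A) g \<Longrightarrow>
      \<Phi> (\<lambda>z. f z * g z) = \<Phi> f * \<Phi> g"
    and cfc_scaleC: "continuous_on (mat_spectrum A) f \<Longrightarrow>
      \<Phi> (\<lambda>z. c * f z) = mat_scaleC c (\<Phi> f)"
    and cfc_star: "continuous_on (mat_spectrum A) f \<Longrightarrow>
      \<Phi> (\<lambda>z. cnj (f z)) = mat_star (\<Phi> f)"
    and cfc_continuous: "(\<And>k. continuous_on (mat_spectrum A) (F k)) \<Longrightarrow>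
      continuous_on (mat_spectrum A) f \<Longrightarrow> uniform_limit (mat_spectrum A) F f sequentially \<Longrightarrow>
      i < dim_row A \<Longrightarrow> j < dim_row A \<Longrightarrow>
      (\<lambda>k. \<Phi> (F k) $$ (i, j)) \<longlonglongrightarrow> \<Phi> f $$ (i, j)"

text \<open>Meaningful for a normal matrix and a function that is continuous on its spectrum: then
  all functional calculi \<open>\<Phi>\<close> have the same value at \<open>f\<close>.\<close>

definition cfc :: "'a::cstar_algebra mat \<Rightarrow> (complex \<Rightarrow> complex) \<Rightarrow> 'a mat" where
  "cfc A f = (THE B. \<exists>\<Phi>. continuous_functional_calculus A \<Phi> \<and> B = \<Phi> f)"

text \<open>Used for positive matrices and positive exponents only, so the function below is
  $t \mapsto t^\theta$ on the spectrum, with value $0$ at $0$.\<close>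

definition mat_powr :: "'a::cstar_algebra mat \<Rightarrow> real \<Rightarrow> 'a mat" where
  "mat_powr A \<theta> = cfc A (\<lambda>z. complex_of_real (Re z powr \<theta>))"

definition mat_abs :: "'a::cstar_algebra mat \<Rightarrow> 'a mat" where
  "mat_abs A = mat_powr (mat_star A * A) (1/2)"

end

theory Submission
  imports Defs "HOL-Computational_Algebra.Fundamental_Theorem_Algebra"
begin

text \<open>
  The Frobenius inequality \<open>rk(AB) + rk(BC) \<le> rk(ABC) + rk(B)\<close>, applied to powers of a positive
  matrix \<open>A\<close>, says that \<open>rk(A\<^sup>t) - rk(A\<^sup>t\<^sup>+\<^sup>s)\<close> decreases in \<open>t\<close>; as \<open>rk(A\<^sup>t)\<close> is
  decreasing and bounded, it is uniformly continuous in \<open>t\<close>. Continuity makes up for the lack of polar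
  decompositions in a $C^*$-algebra: if \<open>C\<^sup>*C \<le> X\<close>, then for every \<open>\<beta> > 0\<close> there is \<open>W\<close> with
  \<open>C = W X\<^sup>1\<^sup>/\<^sup>2\<^sup>-\<^sup>\<beta>\<close>, and the loss \<open>\<beta>\<close> disappears in the limit for ranks. With \<open>C = A\<close> and
  \<open>X = A\<^sup>*A\<close> this gives (2), where \<open>W X\<^sup>s W\<^sup>* = (AA\<^sup>*)\<^sup>s\<^sup>+\<^sup>2\<^sup>\<beta>\<close> compares the two absolute
  values. For (3), a weak form \<open>c B\<^sup>s \<le> A\<^sup>r\<close> of the Loewner--Heinz inequality (\<open>r < s \<le> 1\<close>) gives
  \<open>(c B\<^sup>s)\<^sup>1\<^sup>/\<^sup>2 = W D\<close> where \<open>D\<close> is the power \<open>1/2 - \<beta>\<close> of \<open>A\<^sup>r\<close>. Hence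
  \<open>c\<^sup>2 B\<^sup>2\<^sup>s = W (G\<^sup>*G) W\<^sup>*\<close> with \<open>G = W D\<^sup>2\<close>, and by (2) the rank of \<open>G\<^sup>*G\<close> is that of
  \<open>GG\<^sup>* = W D\<^sup>4 W\<^sup>*\<close>, which is at most \<open>rk(D\<^sup>4)\<close>.
\<close>

section \<open>Invertibility and the spectrum in a C*-algebra\<close>

text \<open>A rank function need not be continuous in its matrix argument. Limits of matrices are
  therefore taken only to obtain exact identities such as
  \<open>C = W * mat_powr X (1 / 2 - \<beta>)\<close>, and the only limits of ranks are limits in
  the exponent, which (1) permits. Since \<open>cfc\<close> is a definite description, no power can
  be computed before existence and uniqueness of the functional calculus are known. Existence is
  proved for selfadjoint elements of a type of class \<open>cstar_algebra\<close>. The matrices of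
  one size do not form such a type, because the size is a term; they become a coordinate of
  \<open>'a matfam\<close>, which is normed by its action on columns. Uniqueness comes from
  polynomial approximation on the spectrum. The bound 2 in (3) is twice the exponent range of the
  Loewner--Heinz inequality: a multiple of \<open>mat_powr B s\<close> with \<open>s \<le> 1\<close>
  is the square of \<open>C = W D\<close>, and it is squared once more before \<open>W\<close> is
  discarded.\<close>

lemma scaleC_zero_left [simp]: "scaleC 0 (x::'a::cstar_algebra) = 0"
  using scaleC_of_real[of 0 x] by simp

lemma scaleC_one [simp]: "scaleC 1 (x::'a::cstar_algebra) = x"
  using scaleC_of_real[of 1 x] by simp

lemma star_zero [simp]: "star (0::'a::cstar_algebra) = 0"
  using star_add[of 0 "0::'a"] by simp

lemma star_minus: "star (- x) = - star (x::'a::cstar_algebra)"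
  using star_add[of x "- x"] minus_unique[of "star x" "star (- x)"] by simp

lemma star_diff: "star (x - y) = star x - star (y::'a::cstar_algebra)"
  using star_add[of x "- y"] by (simp add: star_minus)

lemma star_one [simp]: "star (1::'a::cstar_algebra) = 1"
  using star_mult[of "star (1::'a)" 1] by (simp add: star_star)

lemma star_scaleR: "star (r *\<^sub>R x) = r *\<^sub>R star (x::'a::cstar_algebra)"
  using star_scaleC[of "of_real r" x] by (simp add: scaleC_of_real)

lemma star_power: "star (x ^ n) = star (x::'a::cstar_algebra) ^ n"
  by (induction n) (simp_all add: star_mult power_commutes)

lemma star_sum: "star (sum f I) = (\<Sum>i\<in>I. star (f i :: 'a::cstar_algebra))"
  by (induction I rule: infinite_finite_induct) (simp_all add: star_add)

lemma norm_star [simp]: "norm (star x) = norm (x::'a::cstar_algebra)"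
proof -
  have le: "norm y \<le> norm (star y)" for y :: 'a
  proof (cases "y = 0")
    case False
    have "norm y * norm y \<le> norm (star y) * norm y"
      using norm_mult_ineq[of "star y" y] cstar_identity[of y] by (simp add: power2_eq_square)
    then show ?thesis using False by simp
  qed simp
  show ?thesis using le[of x] le[of "star x"] by (simp add: star_star)
qed

lemma bounded_linear_star: "bounded_linear (star :: 'a::cstar_algebra \<Rightarrow> 'a)"
  by (rule bounded_linear_intro[of _ 1]) (simp_all add: star_add star_scaleR)

lemmas tendsto_star = bounded_linear.tendsto[OF bounded_linear_star]

lemma star_mult_self_eq_0: "star x * x = 0 \<longleftrightarrow> (x::'a::cstar_algebra) = 0"
  using cstar_identity[of x] by auto

text \<open>Scalars as ring elements. They are central (\<open>scal_commute\<close>), so spectra and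
  polynomials can be handled by ring identities.\<close>

definition scal :: "complex \<Rightarrow> 'a::cstar_algebra" where
  "scal c = scaleC c 1"

lemma scal_mult_left: "scal c * x = scaleC c (x::'a::cstar_algebra)"
  by (simp add: scal_def mult_scaleC_left)

lemma scal_mult_right: "x * scal c = scaleC c (x::'a::cstar_algebra)"
  by (simp add: scal_def mult_scaleC_right)

lemma scal_commute: "x * scal c = scal c * (x::'a::cstar_algebra)"
  by (simp add: scal_mult_left scal_mult_right)

lemma scal_0 [simp]: "scal 0 = 0" and scal_1 [simp]: "scal 1 = 1"
  by (simp_all add: scal_def)

lemma scal_add: "scal (c + d) = scal c + scal d"
  by (simp add: scal_def scaleC_add_left)

lemma scal_mult: "scal (c * d) = scal c * scal d"
  by (simp add: scal_mult_left) (simp add: scal_def scaleC_scaleC)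

lemma scal_minus: "scal (- c) = - scal c"
  using scal_add[of c "- c"] minus_unique[of "scal c" "scal (- c)"] by (metis add.right_inverse scal_0)

lemma scal_diff: "scal (c - d) = scal c - scal d"
  using scal_add[of c "- d"] by (simp add: scal_minus)

lemma scal_of_real: "scal (complex_of_real r) = of_real r"
  unfolding scal_def scaleC_of_real by (simp only: of_real_def)

lemma norm_scal [simp]: "norm (scal c) = cmod c"
  by (simp add: scal_def norm_scaleC)

lemma star_scal: "star (scal c) = scal (cnj c)"
  by (simp add: scal_def star_scaleC)

lemma star_of_real [simp]: "star (of_real r :: 'a::cstar_algebra) = of_real r"
  using star_scal[of "complex_of_real r", where 'a = 'a] by (simp add: scal_of_real)

lemma norm_scal_mult: "norm (scal c * x) = cmod c * norm (x::'a::cstar_algebra)"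
  by (simp add: scal_mult_left norm_scaleC)

section \<open>Invertible elements and continuity of inversion\<close>

definition inv_elt :: "'a::ring_1 \<Rightarrow> bool" where
  "inv_elt x \<longleftrightarrow> (\<exists>y. x * y = 1 \<and> y * x = 1)"

lemma inv_eltI: "x * y = 1 \<Longrightarrow> y * x = 1 \<Longrightarrow> inv_elt x"
  by (auto simp: inv_elt_def)

lemma inv_elt_mult:
  assumes "inv_elt x" "inv_elt y"
  shows "inv_elt (x * y)"
proof -
  obtain x' y' where *: "x * x' = 1" "x' * x = 1" "y * y' = 1" "y' * y = 1"
    using assms by (auto simp: inv_elt_def)
  have "(x * y) * (y' * x') = x * (y * y') * x'" "(y' * x') * (x * y) = y' * (x' * x) * y"
    by (simp_all only: mult.assoc)
  then show ?thesis
    using * by (intro inv_eltI[of _ "y' * x'"]) simp_all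
qed

lemma inv_elt_1 [simp]: "inv_elt 1"
  by (rule inv_eltI[of _ 1]) simp_all

lemma not_inv_elt_0 [simp]: "\<not> inv_elt (0::'a::ring_1)"
  by (auto simp: inv_elt_def)

lemma inv_elt_uminus [simp]: "inv_elt (- x) \<longleftrightarrow> inv_elt (x :: 'a::ring_1)"
proof -
  have "inv_elt (- y)" if "inv_elt y" for y :: 'a
    using that unfolding inv_elt_def by (metis minus_mult_minus)
  from this[of x] this[of "- x"] show ?thesis
    by auto
qed

lemma inv_elt_scal: "c \<noteq> 0 \<Longrightarrow> inv_elt (scal c :: 'a::cstar_algebra)"
  by (rule inv_eltI[of _ "scal (1 / c)"]) (simp_all flip: scal_mult)

lemma inv_elt_scal_mult:
  assumes "c \<noteq> 0"
  shows "inv_elt (scal c * x) \<longleftrightarrow> inv_elt (x :: 'a::cstar_algebra)"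
proof
  assume "inv_elt (scal c * x)"
  then have "inv_elt (scal (1 / c) * (scal c * x))"
    using assms by (simp add: inv_elt_mult[OF inv_elt_scal])
  also have "scal (1 / c) * (scal c * x) = scal (1 / c * c) * x"
    by (simp only: mult.assoc scal_mult)
  finally show "inv_elt x"
    using assms by simp
qed (use assms in \<open>simp add: inv_elt_mult inv_elt_scal\<close>)

text \<open>The inverse is the Neumann series, the sum of all \<open>x ^ n\<close>.\<close>

lemma inv_elt_one_minus:
  fixes x :: "'a::cstar_algebra"
  assumes "norm x < 1"
  shows "inv_elt (1 - x)"
proof -
  have s: "summable (\<lambda>n. x ^ n)"
    by (rule complete_algebra_summable_geometric[OF assms])
  have h: "(\<Sum>n. x ^ n) = 1 + (\<Sum>n. x ^ Suc n)"
    using suminf_split_head[OF s] by simp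
  have "(\<Sum>n. x ^ Suc n) = x * (\<Sum>n. x ^ n)" "(\<Sum>n. x ^ Suc n) = (\<Sum>n. x ^ n) * x"
    using suminf_mult[OF s, of x] suminf_mult2[OF s, of x] by (simp_all add: power_commutes)
  then show ?thesis
    using h by (intro inv_eltI[of _ "\<Sum>n. x ^ n"]) (simp_all add: algebra_simps)
qed

definition ivt :: "'a::ring_1 \<Rightarrow> 'a" where
  "ivt x = (SOME y. x * y = 1 \<and> y * x = 1)"

lemma ivt:
  assumes "inv_elt x"
  shows "x * ivt x = 1" "ivt x * x = 1"
proof -
  have "x * ivt x = 1 \<and> ivt x * x = 1"
    using assms unfolding inv_elt_def ivt_def by (rule someI_ex)
  then show "x * ivt x = 1" "ivt x * x = 1"
    by auto
qed

lemma inverse_unique_left: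
  fixes x :: "'a::ring_1"
  assumes "y * x = 1" "x * z = 1"
  shows "y = z"
  by (metis assms mult.assoc mult_1_left mult_1_right)

lemma ivt_eqI: "x * y = 1 \<Longrightarrow> y * x = 1 \<Longrightarrow> ivt x = y"
  using inverse_unique_left ivt(1) inv_eltI by metis

text \<open>Factor \<open>x + h = x * (1 + y * h)\<close> with \<open>y = ivt x\<close>. The second
  factor is within 1/2 of 1, so its inverse \<open>c\<close> has norm at most 2, and
  \<open>c = 1 - y * h * c\<close> turns the difference of the inverses into
  \<open>- (y * h * c * y)\<close>.\<close>

lemma ivt_near:
  fixes x h :: "'a::cstar_algebra"
  assumes x: "inv_elt x" and h: "norm h * norm (ivt x) \<le> 1 / 2"
  shows "inv_elt (x + h)" "norm (ivt (x + h) - ivt x) \<le> 2 * (norm (ivt x))\<^sup>2 * norm h"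
proof -
  define y where "y = ivt x"
  have xy: "x * y = 1" "y * x = 1"
    using ivt[OF x] by (auto simp: y_def)
  have yh: "norm (y * h) \<le> 1 / 2"
    using norm_mult_ineq[of y h] h by (simp add: y_def mult.commute)
  then have inv: "inv_elt (1 - (- (y * h)))"
    by (intro inv_elt_one_minus) simp
  define c where "c = ivt (1 + y * h)"
  have c: "(1 + y * h) * c = 1" "c * (1 + y * h) = 1"
    using ivt[of "1 + y * h"] inv by (auto simp: c_def)
  have fac: "x + h = x * (1 + y * h)"
    using xy by (simp add: distrib_left flip: mult.assoc)
  show i: "inv_elt (x + h)"
    unfolding fac using x inv by (intro inv_elt_mult) simp_all
  have r: "(x + h) * (c * y) = 1"
  proof -
    have "(x + h) * (c * y) = x * ((1 + y * h) * c) * y"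
      unfolding fac by (simp only: mult.assoc)
    then show ?thesis
      using c xy by simp
  qed
  have eq: "ivt (x + h) = c * y"
    using inverse_unique_left ivt(2)[OF i] r by blast
  have c1: "c = 1 - y * h * c"
    using c(1) by (simp add: algebra_simps)
  have "norm c \<le> 1 + norm (y * h * c)"
    using norm_triangle_ineq4[of 1 "y * h * c"] by (subst c1) simp
  also have "norm (y * h * c) \<le> norm (y * h) * norm c"
    by (rule norm_mult_ineq)
  also have "\<dots> \<le> 1 / 2 * norm c"
    by (intro mult_right_mono yh) simp
  finally have c2: "norm c \<le> 2"
    by simp
  have "ivt (x + h) - y = - (y * h * c * y)"
    unfolding eq by (subst c1) (simp add: algebra_simps)
  then have "norm (ivt (x + h) - y) = norm (y * h * c * y)"
    by simp
  also have "\<dots> \<le> norm y * norm h * norm c * norm y"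
    by (intro order_trans[OF norm_mult_ineq] mult_right_mono norm_ge_zero order_refl)
  also have "\<dots> = (norm y)\<^sup>2 * norm h * norm c"
    by (simp add: power2_eq_square)
  also have "\<dots> \<le> (norm y)\<^sup>2 * norm h * 2"
    using c2 by (intro mult_left_mono) auto
  finally show "norm (ivt (x + h) - ivt x) \<le> 2 * (norm (ivt x))\<^sup>2 * norm h"
    by (simp add: y_def mult_ac)
qed

lemma open_inv_elt: "open {x :: 'a::cstar_algebra. inv_elt x}"
  unfolding open_dist
proof safe
  fix x :: 'a
  assume x: "inv_elt x"
  define e where "e = 1 / (2 * (norm (ivt x) + 1))"
  have e: "e > 0"
    unfolding e_def by (simp add: add_nonneg_pos)
  have "inv_elt z" if "dist z x < e" for z
  proof -
    have "norm (z - x) * norm (ivt x) \<le> e * (norm (ivt x) + 1)"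
      using that e by (intro mult_mono) (auto simp: dist_norm)
    also have "\<dots> = 1 / 2"
      unfolding e_def by (simp add: field_simps add_nonneg_eq_0_iff)
    finally show ?thesis
      using ivt_near(1)[OF x, of "z - x"] by simp
  qed
  with e show "\<exists>e>0. \<forall>y. dist y x < e \<longrightarrow> y \<in> {x. inv_elt x}"
    by auto
qed

lemma continuous_on_ivt: "continuous_on {x :: 'a::cstar_algebra. inv_elt x} ivt"
  unfolding continuous_on_iff
proof safe
  fix x :: 'a and e :: real
  assume x: "inv_elt x" and e: "e > 0"
  define n where "n = norm (ivt x) + 1"
  have n: "n \<ge> 1" "n > norm (ivt x)"
    by (auto simp: n_def)
  define d where "d = min (1 / (2 * n)) (e / (2 * n\<^sup>2))"
  have d: "d > 0"
    using n e by (simp add: d_def)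
  have "dist (ivt z) (ivt x) < e" if "dist z x < d" for z
  proof -
    have h: "norm (z - x) < 1 / (2 * n)" "norm (z - x) < e / (2 * n\<^sup>2)"
      using that by (auto simp: dist_norm d_def)
    have "norm (z - x) * norm (ivt x) \<le> 1 / (2 * n) * n"
      using h n by (intro mult_mono) auto
    then have "norm (z - x) * norm (ivt x) \<le> 1 / 2"
      using n by simp
    from ivt_near(2)[OF x this] have "norm (ivt z - ivt x) \<le> 2 * (norm (ivt x))\<^sup>2 * norm (z - x)"
      by simp
    also have "\<dots> \<le> 2 * n\<^sup>2 * norm (z - x)"
      using n by (intro mult_right_mono mult_left_mono power_mono) auto
    also have "\<dots> < 2 * n\<^sup>2 * (e / (2 * n\<^sup>2))"
      using n h by (intro mult_strict_left_mono) auto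
    also have "\<dots> = e"
      using n by simp
    finally show ?thesis
      by (simp add: dist_norm)
  qed
  with d show "\<exists>d>0. \<forall>x'\<in>{x. inv_elt x}. dist x' x < d \<longrightarrow> dist (ivt x') (ivt x) < e"
    by blast
qed

section \<open>The spectrum and its compactness\<close>

definition spec :: "'a::cstar_algebra \<Rightarrow> complex set" where
  "spec a = {z. \<not> inv_elt (scal z - a)}"

lemma continuous_on_scal [continuous_intros]:
  assumes "continuous_on S f"
  shows "continuous_on S (\<lambda>z. scal (f z) :: 'a::cstar_algebra)"
proof -
  have "continuous_on S (\<lambda>z. of_real (Re (f z)) + of_real (Im (f z)) * scal \<i> :: 'a)"
    by (intro continuous_intros assms)
  moreover have "of_real (Re (f z)) + of_real (Im (f z)) * scal \<i> = (scal (f z) :: 'a)" for z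
  proof -
    have "scal (of_real (Re (f z)) + of_real (Im (f z)) * \<i>)
        = of_real (Re (f z)) + of_real (Im (f z)) * (scal \<i> :: 'a)"
      by (simp only: scal_add scal_mult scal_of_real)
    then show ?thesis
      by (metis complex_eq mult.commute)
  qed
  ultimately show ?thesis
    by simp
qed

text \<open>For \<open>cmod z > norm a\<close> the Neumann series inverts \<open>1 - a / z\<close>,
  hence \<open>z - a\<close>.\<close>

lemma spec_norm_le:
  assumes "z \<in> spec a"
  shows "cmod z \<le> norm (a :: 'a::cstar_algebra)"
proof (rule ccontr)
  assume *: "\<not> cmod z \<le> norm a"
  then have z: "z \<noteq> 0"
    by auto
  have "norm (scal (1 / z) * a) < 1"
    using * z by (simp add: norm_scal_mult norm_divide)
  then have "inv_elt (scal z * (1 - scal (1 / z) * a))"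
    using z by (intro inv_elt_mult inv_elt_scal inv_elt_one_minus)
  also have "scal z * (1 - scal (1 / z) * a) = scal z - a"
    using z by (simp add: right_diff_distrib flip: mult.assoc scal_mult)
  finally show False
    using assms by (simp add: spec_def)
qed

lemma closed_spec: "closed (spec (a :: 'a::cstar_algebra))"
proof -
  have "open ((\<lambda>z. scal z - a) -` {x. inv_elt x})"
    by (intro open_vimage open_inv_elt continuous_intros)
  moreover have "(\<lambda>z. scal z - a) -` {x. inv_elt x} = - spec a"
    by (auto simp: spec_def)
  ultimately show ?thesis
    by (simp add: closed_def)
qed

lemma compact_spec: "compact (spec (a :: 'a::cstar_algebra))"
  using closed_spec spec_norm_le
  by (metis bounded_iff compact_eq_bounded_closed)

lemma spec_shift: "z \<in> spec (scal c - a) \<longleftrightarrow> c - z \<in> spec (a :: 'a::cstar_algebra)"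
proof -
  have "scal z - (scal c - a) = - (scal (c - z) - a)"
    by (simp add: scal_diff)
  then show ?thesis
    unfolding spec_def by (metis (lifting) inv_elt_uminus mem_Collect_eq)
qed

lemma spec_uminus: "z \<in> spec (- a) \<longleftrightarrow> - z \<in> spec (a :: 'a::cstar_algebra)"
  using spec_shift[of z 0 a] by simp

lemma spec_plus_scal: "z \<in> spec (a + scal c) \<longleftrightarrow> z - c \<in> spec (a :: 'a::cstar_algebra)"
proof -
  have "scal z - (a + scal c) = scal (z - c) - a"
    by (simp add: scal_diff)
  then show ?thesis
    unfolding spec_def by (metis (lifting) mem_Collect_eq)
qed

section \<open>Spectral radius and spectrum of selfadjoint elements\<close>

lemma scal_power: "(scal u * y) ^ n = scal (u ^ n) * (y :: 'a::cstar_algebra) ^ n"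
  by (induction n) (simp_all add: scal_mult_left mult_scaleC_left mult_scaleC_right scaleC_scaleC mult.commute)

lemma power_two_power_Suc: "y ^ 2 ^ Suc m = y ^ 2 ^ m * (y :: 'a::monoid_mult) ^ 2 ^ m"
  by (simp add: mult_2 power_add)

lemma minus_one_root:
  assumes "n > 0"
  obtains w :: complex where "w ^ n = -1" "cmod w = 1"
proof
  show "cis (pi / real n) ^ n = -1" "cmod (cis (pi / real n)) = 1"
    using assms by (simp_all only: Complex.DeMoivre) (simp_all add: field_simps)
qed

lemma power_scal_root:
  fixes b :: "'a::cstar_algebra"
  assumes "w ^ n = -1"
  shows "(scal (w * z) * b) ^ n = - ((scal z * b) ^ n)"
proof -
  have "scal (w * z) * b = scal w * (scal z * b)"
    by (simp only: scal_mult mult.assoc)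
  then show ?thesis
    unfolding scal_power[of w] assms by (simp add: scal_power assms scal_minus)
qed

text \<open>With \<open>N = 2 ^ m\<close> and \<open>w ^ N = -1\<close>, the factorization
  \<open>1 - y ^ (2 N) = (1 - y ^ N) * (1 + y ^ N)\<close> at \<open>y = z b\<close> has
  \<open>1 - (w z b) ^ N\<close> as its second factor, to which the induction hypothesis applies
  because \<open>w z\<close> stays in the disc.\<close>

lemma one_minus_power_inv_elt:
  fixes b :: "'a::cstar_algebra"
  assumes inv: "\<And>z. cmod z \<le> 1 \<Longrightarrow> inv_elt (1 - scal z * b)" and z: "cmod z \<le> 1"
  shows "inv_elt (1 - (scal z * b) ^ 2 ^ m)"
  using z
proof (induction m arbitrary: z)
  case 0
  then show ?case using inv by simp
next
  case (Suc m)
  obtain w :: complex where w: "w ^ 2 ^ m = -1" "cmod w = 1"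
    by (rule minus_one_root[of "2 ^ m"]) auto
  note pow = power_scal_root[OF w(1), of z b]
  have "inv_elt ((1 - (scal z * b) ^ 2 ^ m) * (1 - (scal (w * z) * b) ^ 2 ^ m))"
    using Suc w by (intro inv_elt_mult Suc.IH) (simp_all add: norm_mult)
  also have "\<dots> = 1 - (scal z * b) ^ 2 ^ Suc m"
    unfolding pow power_two_power_Suc by (simp add: algebra_simps)
  finally show ?case .
qed

text \<open>The partial fraction decomposition of \<open>1 / (1 - y^2)\<close>; it is the averaging
  step in \<open>rickart\<close>.\<close>

lemma ivt_one_minus_square:
  fixes y :: "'a::cstar_algebra"
  assumes "inv_elt (1 - y)" "inv_elt (1 + y)"
  shows "ivt (1 - y * y) = (1 / 2) *\<^sub>R (ivt (1 - y) + ivt (1 + y))"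
proof (rule ivt_eqI)
  let ?p = "ivt (1 - y)" and ?q = "ivt (1 + y)"
  have p: "(1 - y) * ?p = 1" "?p * (1 - y) = 1" and q: "(1 + y) * ?q = 1" "?q * (1 + y) = 1"
    using assms by (simp_all add: ivt)
  have "(1 - y * y) * ?p = (1 + y) * ((1 - y) * ?p)" "(1 - y * y) * ?q = (1 - y) * ((1 + y) * ?q)"
    "?p * (1 - y * y) = (?p * (1 - y)) * (1 + y)" "?q * (1 - y * y) = (?q * (1 + y)) * (1 - y)"
    by (simp_all add: algebra_simps)
  then show "(1 - y * y) * ((1 / 2) *\<^sub>R (?p + ?q)) = 1" "((1 / 2) *\<^sub>R (?p + ?q)) * (1 - y * y) = 1"
    unfolding p q by (simp_all add: distrib_left distrib_right flip: scaleR_2)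
qed

text \<open>Rickart's argument that \<open>1\<close> is a lower bound for the spectral radius: by averaging over the
  roots of \<open>-1\<close>, the modulus of continuity of \<open>z \<mapsto> (1 - z b)\<^sup>-\<^sup>1\<close> on the closed disc also serves for
  \<open>z \<mapsto> (1 - (z b)\<^sup>N)\<^sup>-\<^sup>1\<close> with \<open>N = 2\<^sup>m\<close>. The latter tends to \<open>1\<close> for \<open>|z| < 1\<close>, hence also for
  \<open>z = 1\<close>, which forces \<open>b\<^sup>N\<close> to tend to \<open>0\<close>.\<close>

lemma rickart:
  fixes b :: "'a::cstar_algebra"
  assumes norm: "\<And>m. norm (b ^ 2 ^ m) = 1"
  shows "\<exists>z. cmod z \<le> 1 \<and> \<not> inv_elt (1 - scal z * b)"
proof (rule ccontr)
  assume "\<not> ?thesis"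
  then have inv: "inv_elt (1 - scal z * b)" if "cmod z \<le> 1" for z
    using that by auto
  define F where "F m z = ivt (1 - (scal z * b) ^ 2 ^ m)" for m :: nat and z
  have "continuous_on (cball 0 1) (\<lambda>z. ivt (1 - scal z * b))"
    by (rule continuous_on_compose2[OF continuous_on_ivt])
      (auto intro!: continuous_intros inv)
  then have unif: "uniformly_continuous_on (cball 0 1) (\<lambda>z. ivt (1 - scal z * b))"
    by (intro compact_uniformly_continuous) auto
  \<comment> \<open>Small enough for the final estimates: \<open>norm v < e\<close> gives
    \<open>norm (p - 1) \<le> e / (1 - e) = 1 / 7\<close>, adding \<open>e\<close> gives
    \<open>norm (q - 1) \<le> 2 / 7\<close>, and then \<open>norm u \<le> 4 / 7\<close>, against
    \<open>norm u = 1\<close>.\<close>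
  define e :: real where "e = 1 / 8"
  obtain d where d: "d > 0" and
    *: "\<forall>z\<in>cball 0 1. \<forall>w\<in>cball 0 1. dist w z < d \<longrightarrow>
      dist (ivt (1 - scal w * b)) (ivt (1 - scal z * b)) < e"
    using unif[unfolded uniformly_continuous_on_def, rule_format, of e] by (auto simp: e_def)
  have F0: "norm (F 0 z - F 0 w) \<le> e" if "cmod z \<le> 1" "cmod w \<le> 1" "dist z w < d" for z w
    using *[rule_format, of w z] that by (simp add: F_def dist_norm)
  \<comment> \<open>All \<open>z\<close> in the closed disc satisfy \<open>dist z (r z) < d\<close>,
    and \<open>r < 1\<close> lets the powers of \<open>r b\<close> tend to 0. The maximum with 0
    matters for large \<open>d\<close>.\<close>
  define r where "r = max 0 (1 - d / 2)"
  have r: "0 \<le> r" "r < 1" "1 - r < d"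
    using d by (auto simp: r_def)
  have FF: "norm (F m z - F m (of_real r * z)) \<le> e" if "cmod z \<le> 1" for m z
    using that
  proof (induction m arbitrary: z)
    case 0
    have "z - of_real r * z = of_real (1 - r) * z"
      by (simp add: left_diff_distrib)
    then have "cmod (z - of_real r * z) = (1 - r) * cmod z"
      using r by (simp only: norm_mult norm_of_real)
    also have "\<dots> \<le> 1 - r"
      using 0 r by (simp add: mult_left_le)
    finally have "dist z (of_real r * z) < d"
      using r by (simp add: dist_norm)
    moreover have "cmod (of_real r * z) \<le> 1"
      using 0 r by (simp add: norm_mult mult_le_one)
    ultimately show ?case
      using F0[OF 0] by blast
  next
    case (Suc m)
    obtain w :: complex where w: "w ^ 2 ^ m = -1" "cmod w = 1"
      by (rule minus_one_root[of "2 ^ m"]) auto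
    have step: "F (Suc m) u = (1 / 2) *\<^sub>R (F m u + F m (w * u))" if u: "cmod u \<le> 1" for u
    proof -
      note pow = power_scal_root[OF w(1), of u b]
      have "inv_elt (1 - (scal u * b) ^ 2 ^ m)" "inv_elt (1 - (scal (w * u) * b) ^ 2 ^ m)"
        using u w by (auto intro!: one_minus_power_inv_elt inv simp: norm_mult)
      then show ?thesis
        unfolding F_def pow power_two_power_Suc
        using ivt_one_minus_square[of "(scal u * b) ^ 2 ^ m"] by simp
    qed
    have ru: "cmod (of_real r * z) \<le> 1" "cmod (w * z) \<le> 1"
      using Suc r w by (simp_all add: norm_mult mult_le_one)
    have "F (Suc m) z - F (Suc m) (of_real r * z)
      = (1 / 2) *\<^sub>R ((F m z - F m (of_real r * z)) + (F m (w * z) - F m (of_real r * (w * z))))"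
      unfolding step[OF Suc.prems] step[OF ru(1)] by (simp add: algebra_simps)
    also have "norm \<dots> \<le> 1 / 2 * (e + e)"
      unfolding norm_scaleR using Suc.IH[OF Suc.prems] Suc.IH[OF ru(2)]
      by (intro mult_mono norm_triangle_le) auto
    finally show ?case
      by simp
  qed
  have "(\<lambda>m. r ^ 2 ^ m) \<longlonglongrightarrow> 0"
    using LIMSEQ_subseq_LIMSEQ[OF LIMSEQ_power_zero[of r], of "\<lambda>m. 2 ^ m"] r
    by (auto simp: o_def strict_mono_def)
  then obtain m where m: "r ^ 2 ^ m < e"
    using r by (auto simp: e_def dest!: LIMSEQ_D[of _ 0 "1 / 8"])
  define u where "u = b ^ 2 ^ m"
  define v where "v = (scal (of_real r) * b) ^ 2 ^ m"
  have v: "norm v < e"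
  proof -
    have "v = r ^ 2 ^ m *\<^sub>R u"
      using scaleC_of_real[of "r ^ 2 ^ m" "b ^ 2 ^ m"] unfolding v_def u_def scal_power
      unfolding scal_mult_left by simp
    then show ?thesis
      using m norm[of m] r by (simp add: u_def)
  qed
  have iv: "inv_elt (1 - v)" and iu: "inv_elt (1 - u)"
    using one_minus_power_inv_elt[of b "of_real r" m] one_minus_power_inv_elt[of b 1 m] inv r
    by (simp_all add: v_def u_def)
  define p where "p = ivt (1 - v)"
  define q where "q = ivt (1 - u)"
  have p1: "p = 1 + v * p"
    using ivt(1)[OF iv] by (simp add: p_def algebra_simps)
  have "norm p \<le> 1 + norm v * norm p"
    using norm_triangle_ineq[of 1 "v * p"] norm_mult_ineq[of v p] arg_cong[OF p1, of norm] by simp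
  also have "norm v * norm p \<le> e * norm p"
    using v by (intro mult_right_mono) auto
  finally have p2: "norm p \<le> 8 / 7"
    by (simp add: e_def)
  have "norm (p - 1) \<le> norm v * norm p"
    using p1 norm_mult_ineq[of v p] by (metis add_diff_cancel_left')
  also have "\<dots> \<le> e * (8 / 7)"
    using v p2 by (intro mult_mono) (auto simp: e_def)
  finally have p3: "norm (p - 1) \<le> 1 / 7"
    by (simp add: e_def)
  have "norm (q - p) \<le> e"
    using FF[of 1 m] by (simp add: F_def p_def q_def u_def v_def)
  then have q1: "norm (q - 1) \<le> 2 / 7"
    using p3 norm_triangle_ineq[of "q - p" "p - 1"] by (simp add: e_def)
  have "q - 1 = u * q"
    using ivt(1)[OF iu] by (simp add: q_def algebra_simps)
  then have "u = (q - 1) - u * (q - 1)"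
    by (simp add: algebra_simps)
  from arg_cong[OF this, of norm] have "norm u \<le> norm (q - 1) + norm u * norm (q - 1)"
    using norm_triangle_ineq4[of "q - 1" "u * (q - 1)"] norm_mult_ineq[of u "q - 1"] by linarith
  then show False
    using norm[of m] q1 by (simp add: u_def)
qed

lemma selfadjoint_norm_power:
  fixes b :: "'a::cstar_algebra"
  assumes "star b = b"
  shows "norm (b ^ 2 ^ m) = norm b ^ 2 ^ m"
proof (induction m)
  case (Suc m)
  have "b ^ 2 ^ Suc m = star (b ^ 2 ^ m) * b ^ 2 ^ m"
    unfolding power_two_power_Suc star_power assms ..
  then show ?case
    using cstar_identity[of "b ^ 2 ^ m"] Suc by (simp only: power_two_power_Suc power2_eq_square)
qed simp

text \<open>This takes the place of the spectral radius formula. After scaling to norm 1, all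
  \<open>b ^ 2 ^ m\<close> have norm 1 by the C*-identity, so \<open>rickart\<close> yields
  \<open>z\<close> in the closed disc with \<open>1 - z b\<close> singular. Then
  \<open>1 / z\<close> is a spectral value of \<open>b\<close> of modulus at least 1.\<close>

lemma spec_norm_attained:
  fixes a :: "'a::cstar_algebra"
  assumes sa: "star a = a"
  shows "\<exists>z\<in>spec a. cmod z = norm a"
proof (cases "a = 0")
  case False
  define b where "b = scal (of_real (1 / norm a)) * a"
  have sb: "star b = b"
    by (simp add: b_def star_mult star_scal sa scal_commute)
  have nb: "norm b = 1"
    using False unfolding b_def norm_scal_mult by (simp add: norm_divide)
  obtain z where z: "cmod z \<le> 1" "\<not> inv_elt (1 - scal z * b)"
    using rickart[of b] selfadjoint_norm_power[OF sb] nb by auto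
  have z0: "z \<noteq> 0"
    using z by auto
  define w where "w = of_real (norm a) / z"
  have "scal (z / of_real (norm a)) * (scal w - a) = 1 - scal z * b"
    using z0 False unfolding b_def w_def right_diff_distrib mult.assoc[symmetric] scal_mult[symmetric]
    by simp
  then have "w \<in> spec a"
    using z z0 False inv_elt_scal_mult[of "z / of_real (norm a)" "scal w - a"] by (simp add: spec_def)
  moreover have "cmod w \<ge> norm a"
    using z z0 by (simp add: w_def norm_divide field_simps mult_left_le)
  ultimately show ?thesis
    using spec_norm_le by (intro bexI[of _ w]) (auto intro: antisym)
qed (auto simp: spec_def intro!: exI[of _ 0])

text \<open>Arens' trick: compare the norms of \<open>a + i t\<close> and of its spectral values as \<open>t\<close> grows.\<close>

lemma spec_real:
  fixes a :: "'a::cstar_algebra"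
  assumes sa: "star a = a" and z: "z \<in> spec a"
  shows "Im z = 0"
proof (rule ccontr)
  assume i: "Im z \<noteq> 0"
  have le: "(Re z)\<^sup>2 + (Im z + t)\<^sup>2 \<le> (norm a)\<^sup>2 + t\<^sup>2" for t
  proof -
    let ?y = "a + scal (\<i> * of_real t)"
    have "z + \<i> * of_real t \<in> spec ?y"
      using z by (simp add: spec_plus_scal)
    then have "(cmod (z + \<i> * of_real t))\<^sup>2 \<le> (norm ?y)\<^sup>2"
      by (intro power_mono spec_norm_le) auto
    also have "\<dots> = norm (star ?y * ?y)"
      by (rule cstar_identity[symmetric])
    also have "star ?y * ?y = a * a + scal (of_real (t\<^sup>2))"
    proof -
      let ?c = "\<i> * of_real t"
      have "star ?y * ?y = (a - scal ?c) * (a + scal ?c)"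
        using sa by (simp add: star_add star_scal scal_minus)
      also have "\<dots> = a * a - scal ?c * scal ?c"
        by (simp add: distrib_left left_diff_distrib scal_commute[of a])
      also have "scal ?c * scal ?c = scal (- of_real (t\<^sup>2))"
        unfolding scal_mult[symmetric]
        by (rule arg_cong[of _ _ scal]) (simp add: complex_eq_iff power2_eq_square)
      finally show ?thesis
        by (simp only: scal_minus diff_minus_eq_add)
    qed
    also have "norm \<dots> \<le> norm a * norm a + t\<^sup>2"
      by (intro order_trans[OF norm_triangle_ineq] add_mono norm_mult_ineq) (simp add: norm_power)
    finally show ?thesis
      by (simp add: cmod_def power2_eq_square)
  qed
  \<comment> \<open>Chosen so that the term \<open>2 * Im z * t\<close>, linear in \<open>t\<close>,
    already uses up the whole of \<open>(norm a)^2\<close> in \<open>le\<close>.\<close>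
  define t where "t = (norm a)\<^sup>2 / (2 * Im z)"
  have "2 * Im z * t = (norm a)\<^sup>2"
    using i by (simp add: t_def)
  with le[of t] have "(Re z)\<^sup>2 + (Im z)\<^sup>2 \<le> 0"
    by (simp add: power2_sum)
  with i show False
    using zero_less_power2[of "Im z"] zero_le_power2[of "Re z"] by linarith
qed

section \<open>Continuous functional calculus\<close>

definition ceval :: "complex poly \<Rightarrow> 'a::cstar_algebra \<Rightarrow> 'a" where
  "ceval p a = fold_coeffs (\<lambda>c y. scal c + a * y) p 0"

lemma ceval_0 [simp]: "ceval 0 a = 0"
  by (simp add: ceval_def)

lemma ceval_pCons [simp]: "ceval (pCons c p) a = scal c + a * ceval p a"
  by (cases "c = 0 \<and> p = 0") (auto simp: ceval_def)

lemma ceval_add: "ceval (p + q) a = ceval p a + ceval q a"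
  by (induction p q rule: poly_induct2) (simp_all add: scal_add distrib_left)

lemma ceval_smult: "ceval (Polynomial.smult c p) a = scal c * ceval p a"
proof (induction p)
  case (pCons d p)
  have "a * (scal c * ceval p a) = scal c * (a * ceval p a)"
    by (simp add: scal_mult_left mult_scaleC_right)
  with pCons show ?case
    by (simp add: scal_mult distrib_left)
qed simp

lemma ceval_diff: "ceval (p - q) a = ceval p a - ceval q a"
  using ceval_add[of p "Polynomial.smult (-1) q" a] 
    ceval_smult[of "-1" q a] by (simp add: scal_minus)

lemma ceval_mult: "ceval (p * q) a = ceval p a * ceval q a"
  by (induction p) (simp_all add: ceval_add ceval_smult distrib_right mult.assoc)

lemma ceval_star:
  assumes "star a = a"
  shows "star (ceval p a) = ceval (map_poly cnj p) a"
proof (induction p)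
  case (pCons c p)
  have "a * ceval q a = ceval q a * a" for q
    using ceval_mult[of "[:0, 1:]" q a] ceval_mult[of q "[:0, 1:]" a] by (simp add: mult.commute)
  with pCons show ?case
    using assms by (simp add: map_poly_pCons star_add star_mult star_scal)
qed simp

text \<open>By the fundamental theorem of algebra \<open>q\<close> splits into linear factors, and a
  product of invertible elements is invertible. So some factor \<open>a - z\<close> is singular if
  \<open>ceval q a\<close> is.\<close>

lemma ceval_not_inv:
  assumes "q \<noteq> 0" "\<not> inv_elt (ceval q (a::'a::cstar_algebra))"
  shows "\<exists>z\<in>spec a. poly q z = 0"
  using assms
proof (induction "degree q" arbitrary: q)
  case 0
  then obtain c where "q = [:c:]"
    by (metis degree_eq_zeroE)
  with 0 show ?case
    using inv_elt_scal[of c, where 'a = 'a] by simp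
next
  case (Suc n)
  have "\<not> constant (poly q)"
    using Suc.hyps(2) by (simp add: constant_degree)
  then obtain z where z: "poly q z = 0"
    using fundamental_theorem_of_algebra by blast
  then obtain r where r: "q = [:- z, 1:] * r"
    by (metis dvdE poly_eq_0_iff_dvd)
  show ?case
  proof (cases "z \<in> spec a")
    case False
    have r0: "r \<noteq> 0"
      using r Suc.prems by auto
    have "ceval [:- z, 1:] a = - (scal z - a)"
      by (simp add: scal_minus)
    then have i: "inv_elt (ceval [:- z, 1:] a)"
      using False inv_elt_uminus[of "scal z - a"] by (simp add: spec_def)
    have "\<not> inv_elt (ceval r a)"
      using Suc.prems(2) inv_elt_mult[OF i] unfolding r ceval_mult by blast
    moreover have "n = degree r"
      using Suc.hyps(2) r0 degree_mult_eq[of "[:- z, 1:]" r] unfolding r by simp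
    ultimately obtain w where "w \<in> spec a" "poly r w = 0"
      using Suc.hyps(1) r0 by blast
    then show ?thesis
      unfolding r by auto
  qed (use z in auto)
qed

lemma spec_nonempty:
  assumes "star a = (a::'a::cstar_algebra)"
  shows "spec a \<noteq> {}"
  using spec_norm_attained[OF assms] by auto

text \<open>The inclusion of the spectral mapping theorem that bounds norms. A constant
  \<open>p = [:w:]\<close> is separate because \<open>[:w:] - p\<close> then has no factorization;
  there it is enough that the spectrum is nonempty.\<close>

lemma spec_ceval:
  assumes "star a = (a::'a::cstar_algebra)" "w \<in> spec (ceval p a)"
  shows "\<exists>z\<in>spec a. poly p z = w"
proof (cases "p = [:w:]")
  case True
  then show ?thesis
    using spec_nonempty[OF assms(1)] by auto
next
  case False
  have "ceval ([:w:] - p) a = scal w - ceval p a"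
    unfolding ceval_diff by simp
  then show ?thesis
    using ceval_not_inv[of "[:w:] - p" a] assms(2) False by (auto simp: spec_def)
qed

text \<open>The estimate that makes the calculus continuous. By the C*-identity the square of the
  norm is the norm of the selfadjoint element \<open>ceval q a\<close>, where \<open>q\<close> is
  the product of \<open>p\<close> and its conjugate. That norm is attained at a spectral value,
  which is \<open>(cmod (poly p z))^2\<close> for some real \<open>z\<close> in the spectrum of
  \<open>a\<close>.\<close>

lemma norm_ceval:
  assumes sa: "star a = (a::'a::cstar_algebra)" and C: "\<And>z. z \<in> spec a \<Longrightarrow> cmod (poly p z) \<le> C"
  shows "norm (ceval p a) \<le> C"
proof -
  define q where "q = map_poly cnj p * p"
  have q: "ceval q a = star (ceval p a) * ceval p a"
    by (simp add: q_def ceval_mult ceval_star[OF sa])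
  then have "star (ceval q a) = ceval q a"
    by (simp add: star_mult star_star)
  from spec_norm_attained[OF this] obtain w where
    w: "w \<in> spec (ceval q a)" "cmod w = norm (ceval q a)"
    by auto
  obtain z where z: "z \<in> spec a" "poly q z = w"
    using spec_ceval[OF sa w(1)] by auto
  have "cnj z = z"
    using spec_real[OF sa z(1)] by (simp add: complex_eq_iff)
  moreover have "poly (map_poly cnj p) (cnj z) = cnj (poly p z)"
    by (induction p) (simp_all add: map_poly_pCons)
  ultimately have "cmod w = (cmod (poly p z))\<^sup>2"
    using z(2) by (auto simp: q_def norm_mult power2_eq_square)
  then have "(norm (ceval p a))\<^sup>2 = (cmod (poly p z))\<^sup>2"
    using w(2) q by (simp add: cstar_identity)
  then show ?thesis
    using C[OF z(1)] by simp
qed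

lemma approx_complex_poly:
  fixes f :: "complex \<Rightarrow> complex"
  assumes S: "compact S" "\<And>z. z \<in> S \<Longrightarrow> Im z = 0" and f: "continuous_on S f" and e: "e > 0"
  shows "\<exists>p. \<forall>z\<in>S. cmod (poly p z - f z) < e"
proof -
  have T: "compact (Re ` S)"
    by (intro compact_continuous_image S continuous_intros)
  have sub: "of_real (Re z) = z" if "z \<in> S" for z
    using S(2)[OF that] by (simp add: complex_eq_iff)
  have appr: "\<exists>p. \<forall>z\<in>S. cmod (poly p z - of_real (g z)) < e / 2" if g: "continuous_on S g" for g :: "complex \<Rightarrow> real"
  proof -
    have cont: "continuous_on (Re ` S) (\<lambda>r. g (of_real r))"
      by (rule continuous_on_compose2[OF g]) (auto intro!: continuous_intros simp: sub)
    obtain h where "real_polynomial_function h" and h: "\<And>x. x \<in> Re ` S \<Longrightarrow> \<bar>g (of_real x) - h x\<bar> < e / 2"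
      using Stone_Weierstrass_real_polynomial_function[OF T cont, of "e / 2"] e by auto
    then obtain a n where an: "h = (\<lambda>x. \<Sum>i\<le>n. a i * x ^ i)"
      using real_polynomial_function_iff_sum[of h] by auto
    let ?p = "\<Sum>i\<le>n. monom (complex_of_real (a i)) i"
    have "cmod (poly ?p z - of_real (g z)) < e / 2" if z: "z \<in> S" for z
    proof -
      have "poly ?p (of_real (Re z)) = of_real (h (Re z))"
        by (simp add: an poly_sum poly_monom)
      then have "poly ?p z - of_real (g z) = of_real (h (Re z) - g (of_real (Re z)))"
        unfolding sub[OF z] by simp
      then show ?thesis
        using h[of "Re z"] z by (simp only: norm_of_real) (simp add: abs_minus_commute)
    qed
    then show ?thesis
      by blast
  qed
  obtain p where p: "\<forall>z\<in>S. cmod (poly p z - of_real (Re (f z))) < e / 2"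
    using appr[of "\<lambda>z. Re (f z)"] f by (auto intro!: continuous_intros)
  obtain q where q: "\<forall>z\<in>S. cmod (poly q z - of_real (Im (f z))) < e / 2"
    using appr[of "\<lambda>z. Im (f z)"] f by (auto intro!: continuous_intros)
  have "cmod (poly (p + Polynomial.smult \<i> q) z - f z) < e" if z: "z \<in> S" for z
  proof -
    have "poly (p + Polynomial.smult \<i> q) z - f z
        = (poly p z - of_real (Re (f z))) + \<i> * (poly q z - of_real (Im (f z)))"
      by (subst (3) complex_eq) (simp add: algebra_simps)
    also have "cmod \<dots> < e / 2 + e / 2"
      using p q z by (intro norm_triangle_lt add_strict_mono) (auto simp: norm_mult)
    finally show ?thesis
      by simp
  qed
  then show ?thesis
    by blast
qed

section \<open>Extension of the calculus from polynomials to continuous functions\<close>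

definition fapprox :: "'a::cstar_algebra \<Rightarrow> (complex \<Rightarrow> complex) \<Rightarrow> nat \<Rightarrow> complex poly" where
  "fapprox a f k = (SOME p. \<forall>z\<in>spec a. cmod (poly p z - f z) < inverse (real (Suc k)))"

definition fcalc :: "'a::cstar_algebra \<Rightarrow> (complex \<Rightarrow> complex) \<Rightarrow> 'a" where
  "fcalc a f = lim (\<lambda>k. ceval (fapprox a f k) a)"

context
  fixes a :: "'a::cstar_algebra"
  assumes sa: "star a = a"
begin

lemma fapprox:
  assumes "continuous_on (spec a) f" "z \<in> spec a"
  shows "cmod (poly (fapprox a f k) z - f z) < inverse (real (Suc k))"
proof -
  have "\<forall>z\<in>spec a. cmod (poly (fapprox a f k) z - f z) < inverse (real (Suc k))"
    unfolding fapprox_def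
    by (rule someI_ex) (auto intro!: approx_complex_poly compact_spec spec_real[OF sa] assms(1))
  with assms(2) show ?thesis
    by auto
qed

lemma fapprox_uniform:
  assumes "continuous_on (spec a) f"
  shows "uniform_limit (spec a) (\<lambda>k. poly (fapprox a f k)) f sequentially"
proof (rule uniform_limitI)
  fix e :: real
  assume "e > 0"
  then have "\<forall>\<^sub>F k in sequentially. inverse (real (Suc k)) < e"
    by (rule order_tendstoD(2)[OF LIMSEQ_inverse_real_of_nat])
  then show "\<forall>\<^sub>F k in sequentially. \<forall>z\<in>spec a. dist (poly (fapprox a f k) z) (f z) < e"
    by eventually_elim (metis fapprox[OF assms] dist_norm less_trans)
qed

text \<open>By \<open>norm_ceval\<close>, closeness on the spectrum is closeness in norm. Hence
  \<open>fcalc\<close> does not depend on the approximating polynomials picked by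
  \<open>fapprox\<close>, and sums, products and conjugates of approximants may be used
  instead.\<close>

lemma ceval_diff_tendsto:
  assumes "uniform_limit (spec a) (\<lambda>k. poly (p k)) f sequentially"
    and "uniform_limit (spec a) (\<lambda>k. poly (q k)) f sequentially"
  shows "(\<lambda>k. ceval (p k) a - ceval (q k) a) \<longlonglongrightarrow> 0"
proof (rule LIMSEQ_I)
  fix e :: real
  assume e: "e > 0"
  have "\<forall>\<^sub>F k in sequentially. \<forall>z\<in>spec a. dist (poly (p k) z) (f z) < e / 4"
    "\<forall>\<^sub>F k in sequentially. \<forall>z\<in>spec a. dist (poly (q k) z) (f z) < e / 4"
    using assms e by (auto dest!: uniform_limitD[of _ _ _ _ "e / 4"])
  then have "\<forall>\<^sub>F k in sequentially. norm (ceval (p k) a - ceval (q k) a - 0) < e"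
  proof eventually_elim
    case (elim k)
    have "norm (ceval (p k - q k) a) \<le> e / 2"
    proof (rule norm_ceval[OF sa])
      fix z
      assume "z \<in> spec a"
      with elim have "dist (poly (p k) z) (f z) < e / 4" "dist (poly (q k) z) (f z) < e / 4"
        by auto
      then have "dist (poly (p k) z) (poly (q k) z) \<le> e / 4 + e / 4"
        using dist_triangle2[of "poly (p k) z" "poly (q k) z" "f z"] by linarith
      then show "cmod (poly (p k - q k) z) \<le> e / 2"
        by (simp add: dist_norm)
    qed
    then show ?case
      using e by (simp add: ceval_diff)
  qed
  then show "\<exists>no. \<forall>n\<ge>no. norm (ceval (p n) a - ceval (q n) a - 0) < e"
    by (simp add: eventually_sequentially)
qed

lemma fapprox_tendsto:
  assumes "continuous_on (spec a) f"
  shows "(\<lambda>k. ceval (fapprox a f k) a) \<longlonglongrightarrow> fcalc a f"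
proof -
  have "Cauchy (\<lambda>k. ceval (fapprox a f k) a)"
  proof (rule metric_CauchyI)
    fix e :: real
    assume e: "e > 0"
    obtain N where N: "inverse (real (Suc N)) < e / 4"
      using reals_Archimedean[of "e / 4"] e by auto
    have "dist (ceval (fapprox a f m) a) (ceval (fapprox a f n) a) < e" if "m \<ge> N" "n \<ge> N" for m n
    proof -
      have le: "inverse (real (Suc k)) \<le> e / 4" if "k \<ge> N" for k
        using that N by (smt (verit) le_imp_inverse_le of_nat_0_less_iff of_nat_mono Suc_le_mono zero_less_Suc)
      have "norm (ceval (fapprox a f m - fapprox a f n) a) \<le> e / 2"
      proof (rule norm_ceval[OF sa])
        fix z
        assume z: "z \<in> spec a"
        have "dist (poly (fapprox a f m) z) (f z) \<le> e / 4" "dist (poly (fapprox a f n) z) (f z) \<le> e / 4"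
          using fapprox[OF assms z] le that unfolding dist_norm by (meson less_imp_le order_trans)+
        then have "dist (poly (fapprox a f m) z) (poly (fapprox a f n) z) \<le> e / 4 + e / 4"
          using dist_triangle2[of "poly (fapprox a f m) z" "poly (fapprox a f n) z" "f z"] by linarith
        then show "cmod (poly (fapprox a f m - fapprox a f n) z) \<le> e / 2"
          by (simp add: dist_norm)
      qed
      then show ?thesis
        using e by (simp add: ceval_diff dist_norm)
    qed
    then show "\<exists>M. \<forall>m\<ge>M. \<forall>n\<ge>M. dist (ceval (fapprox a f m) a) (ceval (fapprox a f n) a) < e"
      by blast
  qed
  then show ?thesis
    unfolding fcalc_def by (simp add: Cauchy_convergent_iff convergent_LIMSEQ_iff)
qed

lemma ceval_tendsto_fcalc:
  assumes "continuous_on (spec a) f" "uniform_limit (spec a) (\<lambda>k. poly (p k)) f sequentially"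
  shows "(\<lambda>k. ceval (p k) a) \<longlonglongrightarrow> fcalc a f"
  using tendsto_add[OF ceval_diff_tendsto[OF assms(2) fapprox_uniform[OF assms(1)]]
      fapprox_tendsto[OF assms(1)]] by simp

lemma fcalc_ceval: "fcalc a (poly p) = ceval p a"
  using ceval_tendsto_fcalc[of "poly p" "\<lambda>_. p"]
  by (simp add: uniform_limit_const LIMSEQ_const_iff continuous_on_poly)

lemma norm_fcalc:
  assumes f: "continuous_on (spec a) f" and C: "\<And>z. z \<in> spec a \<Longrightarrow> cmod (f z) \<le> C"
  shows "norm (fcalc a f) \<le> C"
proof -
  have "norm (ceval (fapprox a f k) a) \<le> C + inverse (real (Suc k))" for k
  proof (rule norm_ceval[OF sa])
    fix z
    assume z: "z \<in> spec a"
    have "cmod (poly (fapprox a f k) z) \<le> cmod (f z) + cmod (poly (fapprox a f k) z - f z)"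
      by (metis norm_triangle_sub)
    then show "cmod (poly (fapprox a f k) z) \<le> C + inverse (real (Suc k))"
      using C[OF z] fapprox[OF f z, of k] by linarith
  qed
  moreover have "(\<lambda>k. C + inverse (real (Suc k))) \<longlonglongrightarrow> C + 0"
    by (intro tendsto_intros LIMSEQ_inverse_real_of_nat)
  ultimately show ?thesis
    using LIMSEQ_le[OF tendsto_norm[OF fapprox_tendsto[OF f]], of _ C] by auto
qed

lemma fcalc_add:
  assumes "continuous_on (spec a) f" "continuous_on (spec a) g"
  shows "fcalc a (\<lambda>z. f z + g z) = fcalc a f + fcalc a g"
proof -
  have "uniform_limit (spec a) (\<lambda>k. poly (fapprox a f k + fapprox a g k)) (\<lambda>z. f z + g z) sequentially"
    using uniform_limit_add[OF fapprox_uniform[OF assms(1)] fapprox_uniform[OF assms(2)]]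
    by (rule uniform_limit_cong[THEN iffD1, rotated -1]) auto
  from ceval_tendsto_fcalc[OF continuous_on_add[OF assms] this]
  have "(\<lambda>k. ceval (fapprox a f k) a + ceval (fapprox a g k) a) \<longlonglongrightarrow> fcalc a (\<lambda>z. f z + g z)"
    by (simp add: ceval_add)
  then show ?thesis
    using tendsto_add[OF fapprox_tendsto[OF assms(1)] fapprox_tendsto[OF assms(2)]]
    by (metis LIMSEQ_unique)
qed

lemma fcalc_mult:
  assumes "continuous_on (spec a) f" "continuous_on (spec a) g"
  shows "fcalc a (\<lambda>z. f z * g z) = fcalc a f * fcalc a g"
proof -
  have bdd: "bounded (h ` spec a)" if "continuous_on (spec a) h" for h :: "complex \<Rightarrow> complex"
    using compact_continuous_image[OF that compact_spec] by (rule compact_imp_bounded)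
  have "uniform_limit (spec a) (\<lambda>k z. poly (fapprox a f k) z * poly (fapprox a g k) z) (\<lambda>z. f z * g z) sequentially"
    by (rule uniform_lim_mult[OF fapprox_uniform[OF assms(1)] fapprox_uniform[OF assms(2)] bdd bdd]) (fact assms)+
  then have "uniform_limit (spec a) (\<lambda>k. poly (fapprox a f k * fapprox a g k)) (\<lambda>z. f z * g z) sequentially"
    by (rule uniform_limit_cong[THEN iffD1, rotated -1]) auto
  from ceval_tendsto_fcalc[OF continuous_on_mult[OF assms] this]
  have "(\<lambda>k. ceval (fapprox a f k) a * ceval (fapprox a g k) a) \<longlonglongrightarrow> fcalc a (\<lambda>z. f z * g z)"
    by (simp add: ceval_mult)
  then show ?thesis
    using tendsto_mult[OF fapprox_tendsto[OF assms(1)] fapprox_tendsto[OF assms(2)]]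
    by (metis LIMSEQ_unique)
qed

lemma fcalc_const: "fcalc a (\<lambda>_. c) = scal c"
proof -
  have "poly [:c:] = (\<lambda>_. c)"
    by auto
  then show ?thesis
    using fcalc_ceval[of "[:c:]"] by simp
qed

lemma fcalc_id: "fcalc a (\<lambda>z. z) = a"
proof -
  have "poly [:0, 1 :: complex:] = (\<lambda>z. z)"
    by auto
  then show ?thesis
    using fcalc_ceval[of "[:0, 1:]"] by simp
qed

lemma fcalc_scal:
  assumes "continuous_on (spec a) f"
  shows "fcalc a (\<lambda>z. c * f z) = scal c * fcalc a f"
  using fcalc_mult[OF continuous_on_const assms, of c] by (simp add: fcalc_const)

lemma fcalc_diff:
  assumes "continuous_on (spec a) f" "continuous_on (spec a) g"
  shows "fcalc a (\<lambda>z. f z - g z) = fcalc a f - fcalc a g"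
  using fcalc_add[OF assms(1), of "\<lambda>z. -1 * g z"] fcalc_scal[OF assms(2), of "-1"] assms(2)
  by (simp add: continuous_on_minus scal_minus)

lemma fcalc_cnj:
  assumes f: "continuous_on (spec a) f"
  shows "fcalc a (\<lambda>z. cnj (f z)) = star (fcalc a f)"
proof -
  have cnj: "poly (map_poly cnj p) z = cnj (poly p z)" if z: "z \<in> spec a" for p z
  proof -
    have "cnj z = z"
      using spec_real[OF sa z] by (simp add: complex_eq_iff)
    moreover have "poly (map_poly cnj p) (cnj z) = cnj (poly p z)"
      by (induction p) (simp_all add: map_poly_pCons)
    ultimately show ?thesis by simp
  qed
  have "uniform_limit (spec a) (\<lambda>k. poly (map_poly cnj (fapprox a f k))) (\<lambda>z. cnj (f z)) sequentially"
  proof (rule uniform_limitI)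
    fix e :: real
    assume "e > 0"
    from uniform_limitD[OF fapprox_uniform[OF f] this]
    show "\<forall>\<^sub>F k in sequentially. \<forall>z\<in>spec a. dist (poly (map_poly cnj (fapprox a f k)) z) (cnj (f z)) < e"
      by (rule eventually_mono) (metis cnj dist_norm complex_cnj_diff complex_mod_cnj)
  qed
  from ceval_tendsto_fcalc[OF _ this]
  have "(\<lambda>k. star (ceval (fapprox a f k) a)) \<longlonglongrightarrow> fcalc a (\<lambda>z. cnj (f z))"
    using f by (simp add: continuous_on_cnj ceval_star[OF sa])
  then show ?thesis
    using tendsto_star[OF fapprox_tendsto[OF f]] by (metis LIMSEQ_unique)
qed

text \<open>\<open>fapprox\<close> sees a function only through its values on the spectrum, so both
  sides are limits of the very same sequence.\<close>

lemma fcalc_cong: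
  assumes "\<And>z. z \<in> spec a \<Longrightarrow> f z = g z"
  shows "fcalc a f = fcalc a g"
  using assms by (simp add: fcalc_def fapprox_def)

lemma fcalc_real_selfadjoint:
  assumes "continuous_on (spec a) f" "\<And>z. z \<in> spec a \<Longrightarrow> Im (f z) = 0"
  shows "star (fcalc a f) = fcalc a f"
  unfolding fcalc_cnj[OF assms(1), symmetric]
  using assms(2) by (intro fcalc_cong) (simp add: complex_eq_iff)

end

section \<open>Positive elements\<close>

text \<open>The spectrum of a selfadjoint element is real by \<open>spec_real\<close>, so only the
  sign of the real part has to be demanded.\<close>

definition cpos :: "'a::cstar_algebra \<Rightarrow> bool" where
  "cpos a \<longleftrightarrow> star a = a \<and> (\<forall>z\<in>spec a. 0 \<le> Re z)"

text \<open>The spectrum lies in the disc of radius \<open>t\<close> about \<open>t\<close>.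
  Together with the converse \<open>cpos_norm\<close> this norm test turns sums and limits of
  positive elements into norm estimates.\<close>

lemma cposI_norm:
  assumes "star a = a" "norm (of_real t - a) \<le> t"
  shows "cpos a"
  unfolding cpos_def
proof safe
  fix z
  assume "z \<in> spec a"
  then have "of_real t - z \<in> spec (scal (of_real t) - a)"
    by (simp add: spec_shift)
  then have "cmod (of_real t - z) \<le> t"
    using spec_norm_le assms(2) by (force simp: scal_of_real)
  then show "0 \<le> Re z"
    using complex_Re_le_cmod[of "of_real t - z"] by simp
qed (use assms in auto)

lemma cpos_norm:
  assumes a: "cpos a" and t: "norm a \<le> t"
  shows "norm (of_real t - a) \<le> t"
proof -
  have sa: "star a = a"
    using a by (simp add: cpos_def)
  let ?y = "scal (of_real t) - a"
  have sy: "star ?y = ?y"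
    using sa by (simp add: star_diff star_scal)
  obtain w where w: "w \<in> spec ?y" "cmod w = norm ?y"
    using spec_norm_attained[OF sy] by auto
  then have z: "of_real t - w \<in> spec a"
    by (simp add: spec_shift)
  have "Im w = 0"
    using spec_real[OF sy w(1)] .
  moreover have "0 \<le> Re (of_real t - w)" "Re (of_real t - w) \<le> t"
    using a z spec_norm_le[OF z] complex_Re_le_cmod[of "of_real t - w"] t by (auto simp: cpos_def)
  ultimately have "cmod w \<le> t"
    by (simp add: cmod_def)
  with w show ?thesis
    by (simp add: scal_of_real)
qed

lemma cpos_add:
  assumes "cpos a" "cpos b"
  shows "cpos (a + b)"
proof (rule cposI_norm[of _ "norm a + norm b"])
  show "star (a + b) = a + b"
    using assms by (simp add: cpos_def star_add)
  have "of_real (norm a + norm b) - (a + b) = (of_real (norm a) - a) + (of_real (norm b) - b)"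
    by simp
  also have "norm \<dots> \<le> norm a + norm b"
    using cpos_norm[OF assms(1) order_refl] cpos_norm[OF assms(2) order_refl]
    by (rule norm_triangle_le[OF add_mono])
  finally show "norm (of_real (norm a + norm b) - (a + b)) \<le> norm a + norm b" .
qed

lemma cpos_0 [simp]: "cpos 0"
  by (rule cposI_norm[of _ 0]) simp_all

lemma cpos_sum: "(\<And>i. i \<in> I \<Longrightarrow> cpos (f i)) \<Longrightarrow> cpos (sum f I)"
  by (induction I rule: infinite_finite_induct) (auto intro: cpos_add)

lemma cpos_square:
  assumes "star g = g"
  shows "cpos (g * g)"
  unfolding cpos_def
proof safe
  fix w
  assume "w \<in> spec (g * g)"
  then have "w \<in> spec (ceval [:0, 0, 1:] g)"
    by simp
  from spec_ceval[OF assms this] obtain z where "z \<in> spec g" "w = z * z"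
    by auto
  with spec_real[OF assms, of z] show "0 \<le> Re w"
    by simp
qed (simp add: assms star_mult)

lemma fcalc_nonneg_square:
  assumes sa: "star a = a" and f: "continuous_on (spec a) f"
    and pos: "\<And>z. z \<in> spec a \<Longrightarrow> Im (f z) = 0 \<and> 0 \<le> Re (f z)"
  defines "g \<equiv> fcalc a (\<lambda>z. of_real (sqrt (Re (f z))))"
  shows "star g = g" "fcalc a f = g * g"
proof -
  have c: "continuous_on (spec a) (\<lambda>z. complex_of_real (sqrt (Re (f z))))"
    using f by (intro continuous_intros)
  show "star g = g"
    unfolding g_def by (rule fcalc_real_selfadjoint[OF sa c]) simp
  show "fcalc a f = g * g"
    unfolding g_def fcalc_mult[OF sa c c, symmetric]
    by (rule fcalc_cong[OF sa]) (use pos in \<open>simp add: complex_eq_iff flip: of_real_mult\<close>)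
qed

lemma cpos_fcalc:
  assumes "star a = a" "continuous_on (spec a) f"
    and "\<And>z. z \<in> spec a \<Longrightarrow> Im (f z) = 0 \<and> 0 \<le> Re (f z)"
  shows "cpos (fcalc a f)"
  using fcalc_nonneg_square[OF assms] cpos_square by metis

lemma cpos_root:
  assumes "cpos a"
  shows "\<exists>g. star g = g \<and> a = g * g"
proof -
  have sa: "star a = a"
    using assms by (simp add: cpos_def)
  have p: "Im z = 0 \<and> 0 \<le> Re z" if "z \<in> spec a" for z
    using that assms spec_real[OF sa] by (auto simp: cpos_def)
  show ?thesis
    using fcalc_nonneg_square[OF sa continuous_on_id p] fcalc_id[OF sa] by metis
qed

lemma cpos_minus_eq_0:
  assumes "cpos a" "cpos (- a)"
  shows "a = 0"
proof -
  have sa: "star a = a"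
    using assms by (simp add: cpos_def)
  obtain z where z: "z \<in> spec a" "cmod z = norm a"
    using spec_norm_attained[OF sa] by auto
  have "- z \<in> spec (- a)"
    using z by (simp add: spec_uminus)
  then have "Re z = 0" "Im z = 0"
    using z assms spec_real[OF sa z(1)] by (auto simp: cpos_def intro!: antisym)
  then show ?thesis
    using z by (simp add: cmod_def)
qed

text \<open>If \<open>c\<close> inverts \<open>1 - x * y\<close>, then \<open>1 + y * c * x\<close>
  inverts \<open>1 - y * x\<close>, as the formal geometric series suggests. So \<open>x * y\<close>
  and \<open>y * x\<close> have the same nonzero spectrum.\<close>

lemma inv_elt_one_minus_mult_commute:
  assumes "inv_elt (1 - x * y)"
  shows "inv_elt (1 - y * (x :: 'a::ring_1))"
proof -
  obtain c where c: "(1 - x * y) * c = 1" "c * (1 - x * y) = 1"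
    using assms by (auto simp: inv_elt_def)
  have "(1 - y * x) * (1 + y * c * x) = 1 - y * x + y * ((1 - x * y) * c) * x"
    "(1 + y * c * x) * (1 - y * x) = 1 - y * x + y * (c * (1 - x * y)) * x"
    by (simp_all add: algebra_simps)
  then show ?thesis
    unfolding c by (intro inv_eltI[of _ "1 + y * c * x"]) simp_all
qed

lemma spec_mult_commute:
  fixes x y :: "'a::cstar_algebra"
  assumes "z \<in> spec (x * y)" "z \<noteq> 0"
  shows "z \<in> spec (y * x)"
proof -
  have fac: "scal z - u * v = scal z * (1 - (scal (1 / z) * u) * v)" for u v :: 'a
    using assms(2) unfolding right_diff_distrib mult.assoc[symmetric] scal_mult[symmetric] by simp
  have fac2: "scal z - u * v = scal z * (1 - u * (scal (1 / z) * v))" for u v :: 'a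
    using fac[of u v] by (simp add: scal_commute[of u] flip: mult.assoc)
  show ?thesis
    using assms inv_elt_one_minus_mult_commute[of y "scal (1 / z) * x"]
    unfolding spec_def mem_Collect_eq fac[of x y] fac2[of y x] inv_elt_scal_mult[OF assms(2)] by blast
qed

text \<open>Let \<open>w\<close> be the negative part of \<open>b = star x * x\<close> and
  \<open>y = x * w\<close>. Then \<open>star y * y = - w^3\<close> is negative, and
  \<open>y * star y\<close> is negative too, since it has the same nonzero spectrum. But twice the
  sum of the two is \<open>p * p + q * q\<close> with \<open>p\<close>, \<open>q\<close>
  selfadjoint, hence positive. So \<open>star y * y\<close> is both positive and negative, which
  forces \<open>w = 0\<close>.\<close>

lemma cpos_star_mult: "cpos (star x * (x::'a::cstar_algebra))"
proof -
  define b where "b = star x * x"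
  have sb: "star b = b"
    by (simp add: b_def star_mult star_star)
  define h where "h = (\<lambda>z. complex_of_real (max 0 (- Re z)))"
  have ch: "continuous_on (spec b) h"
    unfolding h_def by (intro continuous_intros)
  define w where "w = fcalc b h"
  have sw: "star w = w"
    unfolding w_def by (rule fcalc_real_selfadjoint[OF sb ch]) (simp add: h_def)
  have real: "z = of_real (Re z)" if "z \<in> spec b" for z
    using spec_real[OF sb that] by (simp add: complex_eq_iff)
  have hh: "continuous_on (spec b) (\<lambda>z. h z * h z)"
    by (intro continuous_intros ch)
  have "b * w + w * w = fcalc b (\<lambda>z. z * h z + h z * h z)"
    unfolding w_def using fcalc_add[OF sb, of "\<lambda>z. z * h z" "\<lambda>z. h z * h z"]
      fcalc_mult[OF sb continuous_on_id ch] fcalc_mult[OF sb ch ch] fcalc_id[OF sb]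
      continuous_on_mult[OF continuous_on_id ch] hh by simp
  also have "\<dots> = fcalc b (\<lambda>z. 0)"
  proof (rule fcalc_cong[OF sb])
    fix z
    assume "z \<in> spec b"
    then show "z * h z + h z * h z = 0"
      using real[of z] by (auto simp: h_def complex_eq_iff max_def)
  qed
  finally have bw: "b * w = - (w * w)"
    unfolding fcalc_const[OF sb] scal_0 by (rule eq_neg_iff_add_eq_0[THEN iffD2])
  define y where "y = x * w"
  have yy: "star y * y = - (w * w * w)"
    using bw sw by (simp add: y_def star_mult b_def mult.assoc)
  have "w * w * w = fcalc b (\<lambda>z. h z * h z * h z)"
    unfolding w_def using fcalc_mult[OF sb hh ch] fcalc_mult[OF sb ch ch] by simp
  moreover have "cpos (fcalc b (\<lambda>z. h z * h z * h z))"
    by (intro cpos_fcalc sb continuous_intros ch) (auto simp: h_def)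
  ultimately have neg: "cpos (- (star y * y))"
    using yy by simp
  have neg': "cpos (- (y * star y))"
    unfolding cpos_def
  proof safe
    fix z
    assume z: "z \<in> spec (- (y * star y))"
    show "0 \<le> Re z"
    proof (cases "z = 0")
      case False
      then have "- z \<in> spec (star y * y)"
        using z spec_mult_commute[of "- z" y "star y"] by (simp add: spec_uminus)
      then show ?thesis
        using neg by (simp add: cpos_def spec_uminus)
    qed simp
  qed (simp add: star_mult star_star star_minus)
  define p where "p = y + star y"
  define q where "q = scal \<i> * (y - star y)"
  have "star p = p"
    by (simp add: p_def star_add star_star add.commute)
  moreover have "star q = q"
    by (simp add: q_def star_mult star_scal star_diff star_star scal_minus
        scal_commute[of y] scal_commute[of "star y"] left_diff_distrib right_diff_distrib)
  ultimately have "cpos (p * p + q * q + (- (y * star y)) + (- (y * star y)))"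
    by (intro cpos_add cpos_square neg')
  also have "q * q = - ((y - star y) * (y - star y))"
    unfolding q_def using scal_mult_left[of "-1" "(y - star y) * (y - star y)"]
    by (simp add: scal_mult_left mult_scaleC_left mult_scaleC_right scaleC_scaleC scal_minus)
  also have "p * p + - ((y - star y) * (y - star y)) + (- (y * star y)) + (- (y * star y))
     = star y * y + star y * y"
    by (simp add: p_def algebra_simps)
  finally have "star y * y + star y * y = 0"
    using cpos_add[OF neg neg] by (intro cpos_minus_eq_0) simp_all
  then have "(2::real) *\<^sub>R (star y * y) = 0"
    by (simp add: scaleR_2)
  then have "w * w * w = 0"
    using yy by simp
  \<comment> \<open>\<open>w^4 = 0\<close>, and the C*-identity takes a square root twice.\<close>
  then have "(star (w * w)) * (w * w) = 0"
    using sw by (simp add: star_mult mult.assoc)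
  then have "star w * w = 0"
    using sw by (simp only: star_mult_self_eq_0)
  then have "w = 0"
    by (simp only: star_mult_self_eq_0)
  then have "b = b + w"
    by simp
  also have "\<dots> = fcalc b (\<lambda>z. z + h z)"
    using fcalc_add[OF sb continuous_on_id ch] fcalc_id[OF sb] by (simp add: w_def)
  also have "cpos \<dots>"
    by (intro cpos_fcalc sb continuous_intros ch) (auto simp: h_def dest: spec_real[OF sb])
  finally show ?thesis
    by (simp add: b_def)
qed

lemma cpos_conj:
  assumes "cpos a"
  shows "cpos (star c * a * c)"
proof -
  obtain g where g: "star g = g" "a = g * g"
    using cpos_root[OF assms] by auto
  have "star c * a * c = star (g * c) * (g * c)"
    using g by (simp add: star_mult mult.assoc)
  then show ?thesis
    by (simp add: cpos_star_mult)
qed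

lemma cpos_norm_minus:
  assumes "star a = a" "norm a \<le> t"
  shows "cpos (of_real t - a)"
  by (rule cposI_norm[of _ t]) (use assms in \<open>simp_all add: star_diff\<close>)

text \<open>From \<open>a \<le> b \<le> norm b\<close> every spectral value of \<open>a\<close> is
  at most \<open>norm b\<close>, and \<open>norm a\<close> is one of them in modulus.\<close>

lemma norm_mono_cpos:
  assumes "cpos a" "cpos (b - a)"
  shows "norm a \<le> norm b"
proof -
  have sa: "star a = a" and sb: "star b = b"
    using assms by (auto simp: cpos_def star_diff)
  obtain z where z: "z \<in> spec a" "cmod z = norm a"
    using spec_norm_attained[OF sa] by auto
  have "cpos ((of_real (norm b) - b) + (b - a))"
    by (intro cpos_add assms cpos_norm_minus sb order_refl)
  then have p: "cpos (scal (of_real (norm b)) - a)"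
    by (simp add: scal_of_real)
  have "of_real (norm b) - z \<in> spec (scal (of_real (norm b)) - a)"
    using z by (simp add: spec_shift)
  then have "Re z \<le> norm b"
    using p by (auto simp: cpos_def)
  moreover have "cmod z = Re z"
    using assms(1) z spec_real[OF sa z(1)] by (simp add: cpos_def cmod_def)
  ultimately show ?thesis
    using z by simp
qed

text \<open>A convergent sequence is bounded, so one \<open>t\<close> serves in the norm test for
  all its terms, and the test is a closed condition.\<close>

lemma cpos_tendsto:
  assumes a: "\<And>k. cpos (a k)" and lim: "a \<longlonglongrightarrow> l"
  shows "cpos l"
proof -
  have "bounded (range a)"
    using lim by (rule convergent_imp_bounded)
  then obtain t where t: "\<And>k. norm (a k) \<le> t"
    by (auto simp: bounded_iff)
  show ?thesis
  proof (rule cposI_norm[of _ t])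
    have "(\<lambda>k. star (a k)) \<longlonglongrightarrow> star l"
      by (rule tendsto_star[OF lim])
    moreover have "(\<lambda>k. star (a k)) = a"
      using a by (auto simp: cpos_def)
    ultimately show "star l = l"
      by (metis LIMSEQ_unique lim)
    show "norm (of_real t - l) \<le> t"
      by (rule LIMSEQ_le_const2[OF tendsto_norm[OF tendsto_diff[OF tendsto_const lim]]])
        (use cpos_norm[OF a t] in auto)
  qed
qed

lemma cpos_scaleR:
  assumes "cpos a" "0 \<le> r"
  shows "cpos (r *\<^sub>R a)"
proof -
  have "star (of_real (sqrt r)) * a * of_real (sqrt r) = r *\<^sub>R a"
    unfolding star_of_real unfolding of_real_def using assms(2) by simp
  then show ?thesis
    using cpos_conj[OF assms(1), of "of_real (sqrt r)"] by simp
qed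

section \<open>The Hilbert module of columns\<close>

lemma index_mult_mat_sum:
  assumes "A \<in> carrier_mat n m" "B \<in> carrier_mat m k" "i < n" "j < k"
  shows "(A * B) $$ (i, j) = (\<Sum>l<m. A $$ (i, l) * B $$ (l, j))"
  using assms by (simp add: scalar_prod_def lessThan_atLeast0)

lemma mat_star_carrier [simp]: "A \<in> carrier_mat n m \<Longrightarrow> mat_star A \<in> carrier_mat m n"
  by (auto simp: mat_star_def)

lemma mat_star_dim [simp]: "dim_row (mat_star A) = dim_col A" "dim_col (mat_star A) = dim_row A"
  by (simp_all add: mat_star_def)

lemma mat_star_index [simp]:
  "i < dim_col A \<Longrightarrow> j < dim_row A \<Longrightarrow> mat_star A $$ (i, j) = star (A $$ (j, i))"
  by (simp add: mat_star_def)

lemma mat_star_star [simp]: "mat_star (mat_star A) = A"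
  by (rule eq_matI) (auto simp: star_star)

lemma mat_star_add:
  "A \<in> carrier_mat n m \<Longrightarrow> B \<in> carrier_mat n m \<Longrightarrow> mat_star (A + B) = mat_star A + mat_star B"
  by (rule eq_matI) (auto simp: star_add)

lemma mat_star_mult:
  assumes "A \<in> carrier_mat n m" "B \<in> carrier_mat m k"
  shows "mat_star (A * B) = mat_star B * mat_star A"
proof (rule eq_matI)
  fix i j
  assume "i < dim_row (mat_star B * mat_star A)" "j < dim_col (mat_star B * mat_star A)"
  then have ij: "i < k" "j < n"
    using assms by auto
  have "mat_star (A * B) $$ (i, j) = star ((A * B) $$ (j, i))"
    using assms ij by simp
  also have "\<dots> = (\<Sum>l<m. star (B $$ (l, i)) * star (A $$ (j, l)))"
    by (simp add: index_mult_mat_sum[OF assms ij(2,1)] star_sum star_mult)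
  also have "\<dots> = (mat_star B * mat_star A) $$ (i, j)"
    using assms ij by (subst index_mult_mat_sum[of _ k m _ n]) auto
  finally show "mat_star (A * B) $$ (i, j) = (mat_star B * mat_star A) $$ (i, j)" .
qed (use assms in auto)

lemma mat_star_one [simp]: "mat_star (1\<^sub>m n) = 1\<^sub>m n"
  by (rule eq_matI) auto

lemma mat_star_zero [simp]: "mat_star (0\<^sub>m n m) = 0\<^sub>m m n"
  by (rule eq_matI) auto

lemma mat_scaleC_carrier [simp]: "A \<in> carrier_mat n m \<Longrightarrow> mat_scaleC c A \<in> carrier_mat n m"
  by (simp add: mat_scaleC_def)

lemma mat_scaleC_dim [simp]: "dim_row (mat_scaleC c A) = dim_row A" "dim_col (mat_scaleC c A) = dim_col A"
  by (simp_all add: mat_scaleC_def)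

lemma mat_scaleC_index [simp]:
  "i < dim_row A \<Longrightarrow> j < dim_col A \<Longrightarrow> mat_scaleC c A $$ (i, j) = scaleC c (A $$ (i, j))"
  by (simp add: mat_scaleC_def)

text \<open>A column of length \<open>n\<close> is a function of which only the values below
  \<open>n\<close> count. So \<open>cnorm n\<close> is a seminorm on functions, and identities
  between columns hold only below \<open>n\<close>, which is why \<open>cinner_cong\<close> and
  \<open>cnorm_cong\<close> appear throughout.\<close>

definition cinner :: "nat \<Rightarrow> (nat \<Rightarrow> 'a::cstar_algebra) \<Rightarrow> (nat \<Rightarrow> 'a) \<Rightarrow> 'a" where
  "cinner n y z = (\<Sum>i<n. star (y i) * z i)"

definition cnorm :: "nat \<Rightarrow> (nat \<Rightarrow> 'a::cstar_algebra) \<Rightarrow> real" where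
  "cnorm n y = sqrt (norm (cinner n y y))"

definition act :: "nat \<Rightarrow> 'a::cstar_algebra mat \<Rightarrow> (nat \<Rightarrow> 'a) \<Rightarrow> nat \<Rightarrow> 'a" where
  "act m X y = (\<lambda>i. \<Sum>j<m. X $$ (i, j) * y j)"

lemma cinner_star: "star (cinner n y z) = cinner n z y"
  by (simp add: cinner_def star_sum star_mult star_star)

lemma cinner_add_right: "cinner n y (\<lambda>i. z i + w i) = cinner n y z + cinner n y w"
  and cinner_add_left: "cinner n (\<lambda>i. z i + w i) y = cinner n z y + cinner n w y"
  and cinner_diff_right: "cinner n y (\<lambda>i. z i - w i) = cinner n y z - cinner n y w"
  and cinner_diff_left: "cinner n (\<lambda>i. z i - w i) y = cinner n z y - cinner n w y"
  by (simp_all add: cinner_def star_add star_diff distrib_left distrib_right left_diff_distrib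
      right_diff_distrib sum.distrib sum_subtractf)

lemma cinner_mult_right: "cinner n y (\<lambda>i. z i * a) = cinner n y z * a"
  by (simp add: cinner_def sum_distrib_right mult.assoc)

lemma cinner_mult_left: "cinner n (\<lambda>i. z i * a) y = star a * cinner n z y"
  by (simp add: cinner_def sum_distrib_left mult.assoc star_mult)

lemma cinner_cong:
  "(\<And>i. i < n \<Longrightarrow> y i = y' i) \<Longrightarrow> (\<And>i. i < n \<Longrightarrow> z i = z' i) \<Longrightarrow> cinner n y z = cinner n y' z'"
  by (simp add: cinner_def)

lemma cpos_cinner: "cpos (cinner n y y)"
  by (simp add: cinner_def cpos_sum cpos_star_mult)

lemma cnorm_nonneg [simp]: "0 \<le> cnorm n y"
  by (simp add: cnorm_def)

lemma cnorm_sq: "(cnorm n y)\<^sup>2 = norm (cinner n y y)"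
  by (simp add: cnorm_def)

text \<open>For \<open>s > \<parallel>\<langle>y, y\<rangle>\<parallel>\<close> and \<open>a = \<langle>y, z\<rangle>\<close>, expand \<open>\<langle>y a / s - z, y a / s - z\<rangle> \<ge> 0\<close>.\<close>

lemma cauchy_schwarz: "norm (cinner n y z) \<le> cnorm n y * cnorm n (z :: nat \<Rightarrow> 'a::cstar_algebra)"
proof -
  define a where "a = cinner n y z"
  define Y where "Y = norm (cinner n y y)"
  define Z where "Z = norm (cinner n z z)"
  have YZ: "0 \<le> Y" "0 \<le> Z"
    by (simp_all add: Y_def Z_def)
  \<comment> \<open>Taking \<open>s > Y\<close> avoids division by \<open>Y\<close>, which may be 0.
    The positive element \<open>star b * (of_real s - cinner n y y) * b\<close> replaces
    \<open>cinner n y y\<close> by \<open>s\<close>, and the terms collapse to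
    \<open>cinner n z z - star a * a / s\<close>. Afterwards \<open>s\<close> tends to
    \<open>Y\<close>.\<close>
  have main: "(norm a)\<^sup>2 \<le> s * Z" if s: "Y < s" for s
  proof -
    have s0: "0 < s"
      using s YZ by linarith
    define b where "b = (1 / s) *\<^sub>R a"
    define u where "u = (\<lambda>i. y i * b - z i)"
    have u: "cinner n u u = star b * cinner n y y * b - star b * a - star a * b + cinner n z z"
      unfolding u_def cinner_diff_right cinner_diff_left cinner_mult_right cinner_mult_left
      by (simp add: a_def cinner_star mult.assoc algebra_simps)
    have "cpos (star b * (of_real s - cinner n y y) * b)"
      using s by (intro cpos_conj cpos_norm_minus) (simp_all add: Y_def cinner_star)
    also have "star b * (of_real s - cinner n y y) * b = s *\<^sub>R (star b * b) - star b * cinner n y y * b"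
      by (simp add: left_diff_distrib right_diff_distrib of_real_def)
    finally have "cpos (cinner n u u + (s *\<^sub>R (star b * b) - star b * cinner n y y * b))"
      by (intro cpos_add cpos_cinner)
    also have "cinner n u u + (s *\<^sub>R (star b * b) - star b * cinner n y y * b)
        = cinner n z z - (1 / s) *\<^sub>R (star a * a)"
      using s0 unfolding u by (simp add: b_def star_scaleR scaleR_2[symmetric] power2_eq_square)
    finally have "norm ((1 / s) *\<^sub>R (star a * a)) \<le> Z"
      unfolding Z_def using s0 by (intro norm_mono_cpos cpos_scaleR cpos_star_mult) auto
    then show ?thesis
      using s0 by (simp add: cstar_identity field_simps)
  qed
  have "(norm a)\<^sup>2 \<le> Y * Z"
  proof (rule field_le_epsilon)
    fix e :: real
    assume e: "e > 0"
    have "(norm a)\<^sup>2 \<le> (Y + e / (Z + 1)) * Z"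
      using e YZ by (intro main) (simp add: add_nonneg_pos)
    also have "\<dots> = Y * Z + e * (Z / (Z + 1))"
      by (simp add: distrib_right)
    also have "\<dots> \<le> Y * Z + e * 1"
      using e YZ by (intro add_left_mono mult_left_mono) auto
    finally show "(norm a)\<^sup>2 \<le> Y * Z + e"
      by simp
  qed
  then have "norm a \<le> sqrt (Y * Z)"
    by (rule real_le_rsqrt)
  then show ?thesis
    by (simp add: a_def Y_def Z_def cnorm_def real_sqrt_mult)
qed

lemma cnorm_triangle: "cnorm n (\<lambda>i. y i + z i) \<le> cnorm n y + cnorm n z"
proof (rule power2_le_imp_le)
  have "(cnorm n (\<lambda>i. y i + z i))\<^sup>2
      = norm ((cinner n y y + cinner n z y) + (cinner n y z + cinner n z z))"
    by (simp add: cnorm_sq cinner_add_left cinner_add_right add_ac)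
  also have "\<dots> \<le> (norm (cinner n y y) + norm (cinner n z y)) + (norm (cinner n y z) + norm (cinner n z z))"
    by (intro norm_triangle_le add_mono norm_triangle_ineq)
  also have "\<dots> \<le> ((cnorm n y)\<^sup>2 + cnorm n z * cnorm n y) + (cnorm n y * cnorm n z + (cnorm n z)\<^sup>2)"
    by (intro add_mono cauchy_schwarz) (simp_all add: cnorm_sq)
  also have "\<dots> = (cnorm n y + cnorm n z)\<^sup>2"
    by (simp add: power2_eq_square algebra_simps)
  finally show "(cnorm n (\<lambda>i. y i + z i))\<^sup>2 \<le> (cnorm n y + cnorm n z)\<^sup>2" .
qed simp

lemma cnorm_scaleC: "cnorm n (\<lambda>i. scaleC c (y i)) = cmod c * cnorm n y"
proof -
  have "cinner n (\<lambda>i. scaleC c (y i)) (\<lambda>i. scaleC c (y i)) = scal (cnj c * c) * cinner n y y"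
    by (simp add: cinner_def star_scaleC mult_scaleC_left mult_scaleC_right scaleC_scaleC
        sum_distrib_left scal_mult_left mult.commute)
  then show ?thesis
    by (simp only: cnorm_def norm_scal_mult) (simp add: norm_mult real_sqrt_mult)
qed

lemma cnorm_minus: "cnorm n (\<lambda>i. - y i) = cnorm n y"
  by (simp add: cnorm_def cinner_def star_minus)

text \<open>Removing one summand from \<open>cinner n y y\<close> leaves a sum of positive elements,
  so \<open>norm_mono_cpos\<close> applies.\<close>

lemma cnorm_component:
  assumes "i < n"
  shows "norm (y i) \<le> cnorm n y"
proof -
  have "cinner n y y - star (y i) * y i = (\<Sum>j\<in>{..<n} - {i}. star (y j) * y j)"
    using assms by (simp add: cinner_def sum.remove)
  then have "norm (star (y i) * y i) \<le> norm (cinner n y y)"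
    by (intro norm_mono_cpos cpos_star_mult) (simp add: cpos_sum cpos_star_mult)
  then show ?thesis
    unfolding cnorm_def by (intro real_le_rsqrt) (simp add: cstar_identity)
qed

lemma cnorm_le_sum: "cnorm n y \<le> (\<Sum>i<n. norm (y i))"
proof -
  have "norm (cinner n y y) \<le> (\<Sum>i<n. norm (y i) * norm (y i))"
    unfolding cinner_def by (intro sum_norm_le) (simp add: order_trans[OF norm_mult_ineq])
  also have "\<dots> \<le> (\<Sum>i<n. norm (y i) * (\<Sum>j<n. norm (y j)))"
    by (intro sum_mono mult_left_mono member_le_sum) auto
  also have "\<dots> = (\<Sum>i<n. norm (y i))\<^sup>2"
    by (simp add: power2_eq_square sum_distrib_right)
  finally show ?thesis
    unfolding cnorm_def by (intro real_le_lsqrt) (simp_all add: sum_nonneg)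
qed

lemma cnorm_eq_0: "cnorm n y = 0 \<Longrightarrow> i < n \<Longrightarrow> y i = 0"
  using cnorm_component[of i n y] by simp

lemma cnorm_cong: "(\<And>i. i < n \<Longrightarrow> y i = z i) \<Longrightarrow> cnorm n y = cnorm n z"
  by (simp add: cnorm_def cinner_def)

lemma tendsto_cnorm:
  assumes "\<And>i. i < n \<Longrightarrow> (\<lambda>k. y k i) \<longlonglongrightarrow> z i"
  shows "(\<lambda>k. cnorm n (y k)) \<longlonglongrightarrow> cnorm n z"
  unfolding cnorm_def cinner_def by (intro tendsto_intros tendsto_star assms) auto

lemma act_adjoint:
  assumes "X \<in> carrier_mat n m"
  shows "cinner n (act m X y) z = cinner m y (act n (mat_star X) z)"
proof -
  have "cinner n (act m X y) z = (\<Sum>i<n. \<Sum>j<m. star (y j) * star (X $$ (i, j)) * z i)"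
    by (simp add: cinner_def act_def star_sum star_mult sum_distrib_right)
  also have "\<dots> = (\<Sum>j<m. \<Sum>i<n. star (y j) * star (X $$ (i, j)) * z i)"
    by (rule sum.swap)
  also have "\<dots> = cinner m y (act n (mat_star X) z)"
    using assms by (simp add: cinner_def act_def sum_distrib_left mult.assoc)
  finally show ?thesis .
qed

lemma act_mult:
  assumes "X \<in> carrier_mat n m" "Y \<in> carrier_mat m k" "i < n"
  shows "act k (X * Y) y i = act m X (act k Y y) i"
proof -
  have "act k (X * Y) y i = (\<Sum>j<k. \<Sum>l<m. X $$ (i, l) * Y $$ (l, j) * y j)"
    using assms by (simp add: act_def index_mult_mat_sum[OF assms(1,2)] sum_distrib_right
        del: index_mult_mat)
  also have "\<dots> = (\<Sum>l<m. \<Sum>j<k. X $$ (i, l) * Y $$ (l, j) * y j)"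
    by (rule sum.swap)
  also have "\<dots> = act m X (act k Y y) i"
    by (simp add: act_def sum_distrib_left mult.assoc)
  finally show ?thesis .
qed

lemma act_add:
  assumes "X \<in> carrier_mat n m" "Y \<in> carrier_mat n m" "i < n"
  shows "act m (X + Y) y i = act m X y i + act m Y y i"
  using assms by (simp add: act_def distrib_right sum.distrib)

lemma act_diff:
  assumes "X \<in> carrier_mat n m" "Y \<in> carrier_mat n m" "i < n"
  shows "act m (X - Y) y i = act m X y i - act m Y y i"
  using assms by (simp add: act_def left_diff_distrib sum_subtractf)

lemma act_uminus:
  assumes "X \<in> carrier_mat n m" "i < n"
  shows "act m (- X) y i = - act m X y i"
  using assms by (simp add: act_def sum_negf)

lemma scaleC_sum: "scaleC c (sum f I) = (\<Sum>i\<in>I. scaleC c (f i :: 'a::cstar_algebra))"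
  by (simp add: sum_distrib_left flip: scal_mult_left)

lemma act_scaleC:
  assumes "X \<in> carrier_mat n m" "i < n"
  shows "act m (mat_scaleC c X) y i = scaleC c (act m X y i)"
  using assms by (simp add: act_def mult_scaleC_left scaleC_sum)

lemma act_one: "i < n \<Longrightarrow> act n (1\<^sub>m n) y i = y i"
  by (simp add: act_def if_distrib[of "\<lambda>x. x * _"] cong: if_cong)

definition unit_col :: "nat \<Rightarrow> nat \<Rightarrow> 'a::cstar_algebra" where
  "unit_col j = (\<lambda>i. if i = j then 1 else 0)"

lemma act_unit_col: "j < m \<Longrightarrow> act m X (unit_col j) i = X $$ (i, j)"
  by (simp add: act_def unit_col_def if_distrib[of "\<lambda>x. _ * x"] cong: if_cong)

lemma cnorm_unit_col: "j < n \<Longrightarrow> cnorm n (unit_col j :: nat \<Rightarrow> 'a::cstar_algebra) = 1"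
proof -
  assume j: "j < n"
  have "cinner n (unit_col j) (unit_col j :: nat \<Rightarrow> 'a) = (\<Sum>i<n. if i = j then 1 else 0)"
    unfolding cinner_def unit_col_def by (intro sum.cong) auto
  then show ?thesis
    using j by (simp add: cnorm_def)
qed

lemma act_bound:
  fixes X :: "'a::cstar_algebra mat"
  shows "cnorm n (act m X y) \<le> (\<Sum>i<n. \<Sum>j<m. norm (X $$ (i, j))) * cnorm m y"
proof -
  have "cnorm n (act m X y) \<le> (\<Sum>i<n. norm (act m X y i))"
    by (rule cnorm_le_sum)
  also have "\<dots> \<le> (\<Sum>i<n. \<Sum>j<m. norm (X $$ (i, j)) * cnorm m y)"
    unfolding act_def
    by (intro sum_mono sum_norm_le order_trans[OF norm_mult_ineq] mult_left_mono cnorm_component) auto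
  finally show ?thesis
    by (simp add: sum_distrib_right)
qed

text \<open>For \<open>w = act n (mat_star X) z\<close> the square of \<open>cnorm m w\<close> is
  the norm of \<open>cinner n z (act m X w)\<close>, which Cauchy--Schwarz bounds by
  \<open>cnorm n z * C * cnorm m w\<close>; one factor cancels.\<close>

lemma act_star_bound:
  assumes X: "X \<in> carrier_mat n m" and C: "0 \<le> C" "\<And>y. cnorm n (act m X y) \<le> C * cnorm m y"
  shows "cnorm m (act n (mat_star X) z) \<le> C * cnorm n z"
proof -
  let ?w = "act n (mat_star X) z"
  have "(cnorm m ?w)\<^sup>2 = norm (cinner n z (act m X ?w))"
    using act_adjoint[of "mat_star X" m n z ?w] X by (simp add: cnorm_sq)
  also have "\<dots> \<le> cnorm n z * (C * cnorm m ?w)"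
    by (intro order_trans[OF cauchy_schwarz] mult_left_mono C) simp
  finally have "cnorm m ?w * cnorm m ?w \<le> (C * cnorm n z) * cnorm m ?w"
    by (simp add: power2_eq_square mult_ac)
  then show ?thesis
    using C(1) by (cases "cnorm m ?w = 0") (auto simp: mult_le_cancel_right less_le)
qed

text \<open>The nontrivial half of the C*-identity for the norm of \<open>'a matfam\<close>.\<close>

lemma act_cstar_bound:
  assumes X: "X \<in> carrier_mat n m" and C: "0 \<le> C"
    "\<And>y. cnorm m (act m (mat_star X * X) y) \<le> C * cnorm m y"
  shows "cnorm n (act m X y) \<le> sqrt C * cnorm m y"
proof -
  have e: "act m (mat_star X * X) y i = act n (mat_star X) (act m X y) i" if "i < m" for i
    using act_mult[OF mat_star_carrier[OF X] X that] .
  have "cinner m y (act n (mat_star X) (act m X y)) = cinner m y (act m (mat_star X * X) y)"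
    by (rule cinner_cong) (simp_all only: e)
  then have "(cnorm n (act m X y))\<^sup>2 = norm (cinner m y (act m (mat_star X * X) y))"
    by (simp only: cnorm_sq act_adjoint[OF X])
  also have "\<dots> \<le> cnorm m y * (C * cnorm m y)"
    by (intro order_trans[OF cauchy_schwarz] mult_left_mono C) simp
  also have "\<dots> = (sqrt C * cnorm m y)\<^sup>2"
    using C(1) by (simp add: power_mult_distrib power2_eq_square[of "cnorm m y"])
  finally show ?thesis
    by (rule power2_le_imp_le) (use C(1) in simp)
qed

section \<open>The product of all matrix algebras\<close>

text \<open>The \<open>\<ell>\<^sup>\<infinity>\<close>-product of the algebras of \<open>n \<times> n\<close> matrices, \<open>n \<ge> 1\<close>, which act on the Hilbert
  modules of columns. It serves to transfer results on types of class \<^class>\<open>cstar_algebra\<close> to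
  matrices whose size is not fixed by their type.\<close>

definition fam_bound :: "(nat \<Rightarrow> 'a::cstar_algebra mat) \<Rightarrow> real \<Rightarrow> bool" where
  "fam_bound X C \<longleftrightarrow> 0 \<le> C \<and> (\<forall>k y. cnorm (Suc k) (act (Suc k) (X k) y) \<le> C * cnorm (Suc k) y)"

text \<open>Coordinate \<open>k\<close> has size \<open>Suc k\<close>, so exactly the nonempty
  square sizes occur. The common bound of all coordinates is what makes the least bound a finite
  norm.\<close>

typedef (overloaded) 'a matfam =
  "{X :: nat \<Rightarrow> 'a::cstar_algebra mat.
     (\<forall>k. X k \<in> carrier_mat (Suc k) (Suc k)) \<and> (\<exists>C. fam_bound X C)}"
  morphisms coord Abs_matfam
proof
  show "(\<lambda>k. 0\<^sub>m (Suc k) (Suc k)) \<in> {X :: nat \<Rightarrow> 'a mat.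
     (\<forall>k. X k \<in> carrier_mat (Suc k) (Suc k)) \<and> (\<exists>C. fam_bound X C)}"
    by (auto simp: fam_bound_def act_def cnorm_def cinner_def intro!: exI[of _ 0])
qed

setup_lifting type_definition_matfam

lemma coord_carrier [simp]: "coord x k \<in> carrier_mat (Suc k) (Suc k)"
  using coord[of x] by auto

lemma coord_dim [simp]: "dim_row (coord x k) = Suc k" "dim_col (coord x k) = Suc k"
  using coord_carrier[of x k] by (auto simp del: coord_carrier)

lemma fam_bound_nonneg: "fam_bound X C \<Longrightarrow> 0 \<le> C"
  by (simp add: fam_bound_def)

lemma fam_boundD: "fam_bound X C \<Longrightarrow> cnorm (Suc k) (act (Suc k) (X k) y) \<le> C * cnorm (Suc k) y"
  by (simp add: fam_bound_def)

lemma fam_bound_add: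
  assumes "\<And>k. X k \<in> carrier_mat (Suc k) (Suc k)" "\<And>k. Y k \<in> carrier_mat (Suc k) (Suc k)"
    and "fam_bound X C" "fam_bound Y D"
  shows "fam_bound (\<lambda>k. X k + Y k) (C + D)"
  unfolding fam_bound_def
proof safe
  fix k y
  have "cnorm (Suc k) (act (Suc k) (X k + Y k) y)
      = cnorm (Suc k) (\<lambda>i. act (Suc k) (X k) y i + act (Suc k) (Y k) y i)"
    by (intro cnorm_cong act_add[of _ "Suc k" "Suc k"]) (simp_all add: assms)
  also have "\<dots> \<le> C * cnorm (Suc k) y + D * cnorm (Suc k) y"
    by (intro order_trans[OF cnorm_triangle] add_mono fam_boundD assms)
  finally show "cnorm (Suc k) (act (Suc k) (X k + Y k) y) \<le> (C + D) * cnorm (Suc k) y"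
    by (simp add: distrib_right)
qed (use assms in \<open>simp add: fam_bound_def\<close>)

lemma fam_bound_uminus:
  assumes "\<And>k. X k \<in> carrier_mat (Suc k) (Suc k)" "fam_bound X C"
  shows "fam_bound (\<lambda>k. - X k) C"
  unfolding fam_bound_def
proof safe
  fix k y
  have "cnorm (Suc k) (act (Suc k) (- X k) y) = cnorm (Suc k) (\<lambda>i. - act (Suc k) (X k) y i)"
    by (intro cnorm_cong act_uminus[of _ "Suc k" "Suc k"]) (simp_all add: assms)
  then show "cnorm (Suc k) (act (Suc k) (- X k) y) \<le> C * cnorm (Suc k) y"
    using assms(2) by (simp add: cnorm_minus fam_bound_def)
qed (use assms in \<open>simp add: fam_bound_def\<close>)

lemma fam_bound_mult:
  assumes "\<And>k. X k \<in> carrier_mat (Suc k) (Suc k)" "\<And>k. Y k \<in> carrier_mat (Suc k) (Suc k)"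
    and "fam_bound X C" "fam_bound Y D"
  shows "fam_bound (\<lambda>k. X k * Y k) (C * D)"
  unfolding fam_bound_def
proof safe
  fix k y
  have "cnorm (Suc k) (act (Suc k) (X k * Y k) y)
      = cnorm (Suc k) (act (Suc k) (X k) (act (Suc k) (Y k) y))"
    by (intro cnorm_cong act_mult[OF assms(1,2)])
  also have "\<dots> \<le> C * (D * cnorm (Suc k) y)"
    by (intro order_trans[OF fam_boundD[OF assms(3)]] mult_left_mono fam_boundD assms(4)
        fam_bound_nonneg[OF assms(3)])
  finally show "cnorm (Suc k) (act (Suc k) (X k * Y k) y) \<le> C * D * cnorm (Suc k) y"
    by (simp add: mult.assoc)
qed (use assms in \<open>simp add: fam_bound_def\<close>)

lemma fam_bound_scaleC:
  assumes "\<And>k. X k \<in> carrier_mat (Suc k) (Suc k)" "fam_bound X C"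
  shows "fam_bound (\<lambda>k. mat_scaleC c (X k)) (cmod c * C)"
  unfolding fam_bound_def
proof safe
  fix k y
  have "cnorm (Suc k) (act (Suc k) (mat_scaleC c (X k)) y)
      = cnorm (Suc k) (\<lambda>i. scaleC c (act (Suc k) (X k) y i))"
    by (intro cnorm_cong act_scaleC[of _ "Suc k" "Suc k"]) (simp_all add: assms)
  also have "\<dots> = cmod c * cnorm (Suc k) (act (Suc k) (X k) y)"
    by (rule cnorm_scaleC)
  also have "\<dots> \<le> cmod c * (C * cnorm (Suc k) y)"
    by (intro mult_left_mono fam_boundD assms) simp
  finally show "cnorm (Suc k) (act (Suc k) (mat_scaleC c (X k)) y) \<le> cmod c * C * cnorm (Suc k) y"
    by (simp add: mult.assoc)
qed (use assms in \<open>simp add: fam_bound_def\<close>)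

lemma fam_bound_star:
  assumes "\<And>k. X k \<in> carrier_mat (Suc k) (Suc k)" "fam_bound X C"
  shows "fam_bound (\<lambda>k. mat_star (X k)) C"
  using act_star_bound[OF assms(1)] assms(2) by (simp add: fam_bound_def)

lemma fam_bound_one: "fam_bound (\<lambda>k. 1\<^sub>m (Suc k)) 1"
  unfolding fam_bound_def by (auto intro!: eq_refl cnorm_cong act_one)

lemma fam_bound_zero: "fam_bound (\<lambda>k. 0\<^sub>m (Suc k) (Suc k)) 0"
  by (simp add: fam_bound_def act_def cnorm_def cinner_def)

lemma fam_bound_diff:
  assumes "\<And>k. X k \<in> carrier_mat (Suc k) (Suc k)" "\<And>k. Y k \<in> carrier_mat (Suc k) (Suc k)"
    and "fam_bound X C" "fam_bound Y D"
  shows "fam_bound (\<lambda>k. X k - Y k) (C + D)"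
proof -
  have "(\<lambda>k. X k - Y k) = (\<lambda>k. X k + - Y k)"
    using minus_add_uminus_mat assms(1,2) by blast
  then show ?thesis
    using fam_bound_add[OF assms(1) _ assms(3) fam_bound_uminus[OF assms(2,4)]] assms(2) by simp
qed

instantiation matfam :: (cstar_algebra) real_normed_algebra_1
begin

lift_definition zero_matfam :: "'a matfam" is "\<lambda>k. 0\<^sub>m (Suc k) (Suc k)"
  using fam_bound_zero by auto

lift_definition one_matfam :: "'a matfam" is "\<lambda>k. 1\<^sub>m (Suc k)"
  using fam_bound_one by auto

lift_definition plus_matfam :: "'a matfam \<Rightarrow> 'a matfam \<Rightarrow> 'a matfam" is "\<lambda>X Y k. X k + Y k"
  by (safe, simp_all, rule exI, rule fam_bound_add, simp_all)

lift_definition minus_matfam :: "'a matfam \<Rightarrow> 'a matfam \<Rightarrow> 'a matfam" is "\<lambda>X Y k. X k - Y k"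
  by (safe, simp add: minus_carrier_mat, rule exI, rule fam_bound_diff, simp_all)

lift_definition uminus_matfam :: "'a matfam \<Rightarrow> 'a matfam" is "\<lambda>X k. - X k"
  by (safe, simp_all, rule exI, rule fam_bound_uminus, simp_all)

lift_definition times_matfam :: "'a matfam \<Rightarrow> 'a matfam \<Rightarrow> 'a matfam" is "\<lambda>X Y k. X k * Y k"
  by (safe, rule mult_carrier_mat, erule spec, erule spec, rule exI, rule fam_bound_mult, simp_all)

lift_definition scaleR_matfam :: "real \<Rightarrow> 'a matfam \<Rightarrow> 'a matfam" is
  "\<lambda>r X k. mat_scaleC (of_real r) (X k)"
  by (safe, simp_all, rule exI, rule fam_bound_scaleC, simp_all)

text \<open>The operator norm on columns, uniformly over all sizes. Norms read off from the entries,
  such as their maximum or sum, would not satisfy the C*-identity.\<close>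

definition norm_matfam :: "'a matfam \<Rightarrow> real" where
  "norm_matfam x = Inf {C. fam_bound (coord x) C}"

definition dist_matfam :: "'a matfam \<Rightarrow> 'a matfam \<Rightarrow> real" where
  "dist_matfam x y = norm (x - y)"

definition sgn_matfam :: "'a matfam \<Rightarrow> 'a matfam" where
  "sgn_matfam x = scaleR (inverse (norm x)) x"

definition uniformity_matfam :: "('a matfam \<times> 'a matfam) filter" where
  "uniformity_matfam = (INF e\<in>{0 <..}. principal {(x, y). dist x y < e})"

definition open_matfam :: "'a matfam set \<Rightarrow> bool" where
  "open_matfam U = (\<forall>x\<in>U. eventually (\<lambda>(x', y). x' = x \<longrightarrow> y \<in> U) uniformity)"

lemma norm_matfam_least: "fam_bound (coord (x :: 'a matfam)) C \<Longrightarrow> norm x \<le> C"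
  unfolding norm_matfam_def
  by (rule cInf_lower) (auto intro!: bdd_belowI[of _ 0] dest: fam_bound_nonneg)

lemma ex_fam_bound: "\<exists>C. fam_bound (coord (x :: 'a matfam)) C"
  using coord[of x] by auto

lemma norm_matfam_bound: "fam_bound (coord (x :: 'a matfam)) (norm x)"
  unfolding fam_bound_def
proof safe
  show nn: "0 \<le> norm x"
    unfolding norm_matfam_def using ex_fam_bound[of x] by (intro cInf_greatest) (auto dest: fam_bound_nonneg)
  fix k y
  show "cnorm (Suc k) (act (Suc k) (coord x k) y) \<le> norm x * cnorm (Suc k) y"
  proof (cases "cnorm (Suc k) y = 0")
    case True
    then show ?thesis
      using ex_fam_bound[of x] fam_boundD[of "coord x" _ k y] by auto
  next
    case False
    then have pos: "cnorm (Suc k) y > 0"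
      using cnorm_nonneg[of "Suc k" y] by linarith
    have "cnorm (Suc k) (act (Suc k) (coord x k) y) / cnorm (Suc k) y \<le> norm x"
      unfolding norm_matfam_def
      using ex_fam_bound[of x] fam_boundD[of "coord x" _ k y] pos
      by (intro cInf_greatest) (auto simp: field_simps)
    then show ?thesis
      using pos by (simp add: field_simps)
  qed
qed

text \<open>Entries depend continuously on the element of the product; this carries norm convergence
  there over to entrywise convergence of matrices.\<close>

lemma entry_norm_le:
  assumes "i < Suc k" "j < Suc k"
  shows "norm (coord (x :: 'a matfam) k $$ (i, j)) \<le> norm x"
proof -
  have "norm (coord x k $$ (i, j)) \<le> cnorm (Suc k) (act (Suc k) (coord x k) (unit_col j))"
    using cnorm_component[OF assms(1), of "act (Suc k) (coord x k) (unit_col j)"] assms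
    by (simp add: act_unit_col)
  also have "\<dots> \<le> norm x * cnorm (Suc k) (unit_col j :: nat \<Rightarrow> 'a)"
    by (rule fam_boundD[OF norm_matfam_bound])
  finally show ?thesis
    using assms by (simp add: cnorm_unit_col)
qed

lemma matfam_eqI:
  assumes "\<And>k i j. i < Suc k \<Longrightarrow> j < Suc k \<Longrightarrow> coord x k $$ (i, j) = coord y k $$ (i, j)"
  shows "x = (y :: 'a matfam)"
proof -
  have "coord x k = coord y k" for k
    by (rule eq_matI) (use assms in auto)
  then show ?thesis
    by (simp add: coord_inject[symmetric] fun_eq_iff)
qed

instance
proof
  fix x y z :: "'a matfam" and r s :: real
  note coord_simps = plus_matfam.rep_eq minus_matfam.rep_eq uminus_matfam.rep_eq zero_matfam.rep_eq
    one_matfam.rep_eq times_matfam.rep_eq scaleR_matfam.rep_eq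
  have eqI: "x = y" if "\<And>k. coord x k = coord y k" for x y :: "'a matfam"
    using that by (simp add: coord_inject[symmetric] fun_eq_iff)
  note cc = coord_carrier
  show "x + y + z = x + (y + z)" "x + y = y + x" "0 + x = x" "- x + x = 0" "x - y = x + - y"
    by (auto intro!: matfam_eqI simp: coord_simps)
  show "x * y * z = x * (y * z)" "(x + y) * z = x * z + y * z" "x * (y + z) = x * y + x * z"
    "1 * x = x" "x * 1 = x"
    by (auto intro!: eqI simp: coord_simps assoc_mult_mat[OF cc cc cc]
        add_mult_distrib_mat[OF cc cc cc] mult_add_distrib_mat[OF cc cc cc])
  show "scaleR r (x + y) = scaleR r x + scaleR r y" "scaleR (r + s) x = scaleR r x + scaleR s x"
    "scaleR r (scaleR s x) = scaleR (r * s) x" "scaleR 1 x = x"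
    by (auto intro!: matfam_eqI simp: coord_simps scaleC_add_right scaleC_add_left scaleC_scaleC)
  show "scaleR r x * y = scaleR r (x * y)" "x * scaleR r y = scaleR r (x * y)"
    by (auto intro!: matfam_eqI simp: coord_simps index_mult_mat_sum[OF cc cc]
        index_mult_mat_sum[OF mat_scaleC_carrier[OF cc] cc] index_mult_mat_sum[OF cc mat_scaleC_carrier[OF cc]]
        scaleC_sum scaleC_add_right mult_scaleC_left mult_scaleC_right simp del: index_mult_mat(1))
  have "coord (0 :: 'a matfam) 0 $$ (0, 0) \<noteq> coord 1 0 $$ (0, 0)"
    by (simp add: coord_simps)
  then show "(0 :: 'a matfam) \<noteq> 1"
    by auto
  show "dist x y = norm (x - y)"
    by (rule dist_matfam_def)
  show "sgn x = scaleR (inverse (norm x)) x"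
    by (rule sgn_matfam_def)
  show "uniformity = (INF e\<in>{0 <..}. principal {(x :: 'a matfam, y). dist x y < e})"
    by (rule uniformity_matfam_def)
  show "open U \<longleftrightarrow> (\<forall>x\<in>U. \<forall>\<^sub>F (x', y) in uniformity. x' = x \<longrightarrow> y \<in> U)" for U :: "'a matfam set"
    by (rule open_matfam_def)
  have nonneg: "0 \<le> norm x" for x :: "'a matfam"
    using fam_bound_nonneg[OF norm_matfam_bound] .
  show "norm x = 0 \<longleftrightarrow> x = 0"
  proof
    assume 0: "norm x = 0"
    show "x = 0"
    proof (rule matfam_eqI)
      fix k i j
      assume "i < Suc k" "j < Suc k"
      with entry_norm_le[OF this, of x] 0 show "coord x k $$ (i, j) = coord 0 k $$ (i, j)"
        by (simp add: coord_simps)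
    qed
  next
    assume "x = 0"
    then have "fam_bound (coord x) 0"
      using fam_bound_zero by (simp add: zero_matfam.rep_eq)
    then show "norm x = 0"
      using norm_matfam_least nonneg antisym by metis
  qed
  show "norm (x + y) \<le> norm x + norm y"
    by (intro norm_matfam_least)
      (simp add: plus_matfam.rep_eq fam_bound_add[OF cc cc norm_matfam_bound norm_matfam_bound])
  show "norm (x * y) \<le> norm x * norm y"
    by (intro norm_matfam_least)
      (simp add: times_matfam.rep_eq fam_bound_mult[OF cc cc norm_matfam_bound norm_matfam_bound])
  have scaleR_le: "norm (scaleR r x) \<le> \<bar>r\<bar> * norm x" for r and x :: "'a matfam"
    using fam_bound_scaleC[OF cc norm_matfam_bound, where c = "of_real r"]
    by (intro norm_matfam_least) (simp add: scaleR_matfam.rep_eq)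
  show "norm (scaleR r x) = \<bar>r\<bar> * norm x"
  proof (cases "r = 0")
    case True
    then show ?thesis
      using scaleR_le[of r x] nonneg[of "scaleR r x"] by simp
  next
    case False
    have "scaleR (1 / r) (scaleR r x) = x"
      using False by (auto intro!: matfam_eqI simp: coord_simps scaleC_scaleC)
    then have "norm x \<le> \<bar>1 / r\<bar> * norm (scaleR r x)"
      using scaleR_le[of "1 / r" "scaleR r x"] by simp
    then have "\<bar>r\<bar> * norm x \<le> norm (scaleR r x)"
      using False by (simp add: abs_divide field_simps)
    then show ?thesis
      using scaleR_le[of r x] by simp
  qed
  have "norm (1 :: 'a matfam) \<le> 1"
    by (rule norm_matfam_least) (simp add: one_matfam.rep_eq fam_bound_one)
  moreover have "norm (coord (1 :: 'a matfam) 0 $$ (0, 0)) \<le> norm (1 :: 'a matfam)"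
    by (rule entry_norm_le) simp_all
  ultimately show "norm (1 :: 'a matfam) = 1"
    by (simp add: coord_simps)
qed

end

instance matfam :: (cstar_algebra) banach
proof
  fix X :: "nat \<Rightarrow> 'a matfam"
  assume X: "Cauchy X"
  have diff: "coord (x - y) k = coord x k - coord y k" for x y :: "'a matfam" and k
    by (simp add: minus_matfam.rep_eq)
  have entry: "Cauchy (\<lambda>n. coord (X n) k $$ (i, j))" if "i < Suc k" "j < Suc k" for k i j
  proof (rule metric_CauchyI)
    fix e :: real
    assume "e > 0"
    then obtain M where M: "\<And>m n. m \<ge> M \<Longrightarrow> n \<ge> M \<Longrightarrow> norm (X m - X n) < e"
      using CauchyD[OF X] by blast
    have "dist (coord (X m) k $$ (i, j)) (coord (X n) k $$ (i, j)) < e" if "m \<ge> M" "n \<ge> M" for m n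
      using entry_norm_le[of i k j "X m - X n"] M[OF that] \<open>i < Suc k\<close> \<open>j < Suc k\<close>
      by (simp add: dist_norm diff)
    then show "\<exists>M. \<forall>m\<ge>M. \<forall>n\<ge>M. dist (coord (X m) k $$ (i, j)) (coord (X n) k $$ (i, j)) < e"
      by blast
  qed
  define L where "L k = mat (Suc k) (Suc k) (\<lambda>(i, j). lim (\<lambda>n. coord (X n) k $$ (i, j)))" for k
  have L: "L k \<in> carrier_mat (Suc k) (Suc k)" for k
    by (simp add: L_def)
  have lim: "(\<lambda>n. coord (X n) k $$ (i, j)) \<longlonglongrightarrow> L k $$ (i, j)" if "i < Suc k" "j < Suc k" for k i j
    using entry[OF that] that by (simp add: L_def Cauchy_convergent_iff convergent_LIMSEQ_iff)
  have act_lim: "(\<lambda>n. act (Suc k) (coord (X n) k) y i) \<longlonglongrightarrow> act (Suc k) (L k) y i"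
    if "i < Suc k" for k y i
    unfolding act_def using that by (intro tendsto_intros lim) auto
  \<comment> \<open>The limit \<open>L\<close> is known only entry by entry and is not yet an
    element of the type. So the operator bound for \<open>X n - X m\<close> is tested on a single
    column \<open>y\<close>, and \<open>m\<close> goes to infinity there.\<close>
  have bound: "fam_bound (\<lambda>k. coord (X n) k - L k) e"
    if e: "e > 0" "\<And>m. m \<ge> N \<Longrightarrow> norm (X n - X m) \<le> e" for n N e
    unfolding fam_bound_def
  proof safe
    fix k y
    have "cnorm (Suc k) (\<lambda>i. act (Suc k) (coord (X n) k) y i - act (Suc k) (coord (X m) k) y i)
        \<le> e * cnorm (Suc k) y" if "m \<ge> N" for m
    proof -
      have "cnorm (Suc k) (\<lambda>i. act (Suc k) (coord (X n) k) y i - act (Suc k) (coord (X m) k) y i)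
          = cnorm (Suc k) (act (Suc k) (coord (X n - X m) k) y)"
        unfolding diff by (intro cnorm_cong act_diff[symmetric]) simp_all
      also have "\<dots> \<le> norm (X n - X m) * cnorm (Suc k) y"
        by (rule fam_boundD[OF norm_matfam_bound])
      also have "\<dots> \<le> e * cnorm (Suc k) y"
        using e(2)[OF that] by (intro mult_right_mono) auto
      finally show ?thesis .
    qed
    moreover have "(\<lambda>m. cnorm (Suc k) (\<lambda>i. act (Suc k) (coord (X n) k) y i - act (Suc k) (coord (X m) k) y i))
      \<longlonglongrightarrow> cnorm (Suc k) (\<lambda>i. act (Suc k) (coord (X n) k) y i - act (Suc k) (L k) y i)"
      by (intro tendsto_cnorm tendsto_intros act_lim)
    ultimately have "cnorm (Suc k) (\<lambda>i. act (Suc k) (coord (X n) k) y i - act (Suc k) (L k) y i)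
        \<le> e * cnorm (Suc k) y"
      using LIMSEQ_le_const2 by blast
    also have "cnorm (Suc k) (\<lambda>i. act (Suc k) (coord (X n) k) y i - act (Suc k) (L k) y i)
        = cnorm (Suc k) (act (Suc k) (coord (X n) k - L k) y)"
      by (intro cnorm_cong act_diff[symmetric]) (simp_all add: L)
    finally show "cnorm (Suc k) (act (Suc k) (coord (X n) k - L k) y) \<le> e * cnorm (Suc k) y" .
  qed (use e in simp)
  obtain N where N: "\<And>m. m \<ge> N \<Longrightarrow> norm (X N - X m) \<le> 1"
    using CauchyD[OF X, of 1] by (force intro: less_imp_le)
  \<comment> \<open>\<open>L\<close> is written as a difference of two bounded families, which shows
    that it is bounded itself.\<close>
  have "fam_bound (\<lambda>k. coord (X N) k - (coord (X N) k - L k)) (norm (X N) + 1)"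
    by (intro fam_bound_diff norm_matfam_bound bound[of 1 N N] N) (simp_all add: L minus_carrier_mat)
  also have "(\<lambda>k. coord (X N) k - (coord (X N) k - L k)) = L"
  proof
    fix k
    show "coord (X N) k - (coord (X N) k - L k) = L k"
      using L[of k] by (intro eq_matI) auto
  qed
  finally have cl: "coord (Abs_matfam L) = L"
    using L by (intro Abs_matfam_inverse) auto
  have "X \<longlonglongrightarrow> Abs_matfam L"
  proof (rule LIMSEQ_I)
    fix e :: real
    assume e: "e > 0"
    then obtain M where M: "\<And>m n. m \<ge> M \<Longrightarrow> n \<ge> M \<Longrightarrow> norm (X m - X n) < e / 2"
      using CauchyD[OF X, of "e / 2"] by auto
    have "norm (X n - Abs_matfam L) < e" if "n \<ge> M" for n
    proof -
      have "norm (X n - Abs_matfam L) \<le> e / 2"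
        using bound[of "e / 2" M n] M[OF that] e less_imp_le
        by (intro norm_matfam_least) (auto simp: minus_matfam.rep_eq cl)
      with e show ?thesis
        by simp
    qed
    then show "\<exists>no. \<forall>n\<ge>no. norm (X n - Abs_matfam L) < e"
      by blast
  qed
  then show "convergent X"
    by (rule convergentI)
qed

instantiation matfam :: (cstar_algebra) cstar_algebra
begin

lift_definition scaleC_matfam :: "complex \<Rightarrow> 'a matfam \<Rightarrow> 'a matfam" is "\<lambda>c X k. mat_scaleC c (X k)"
  by (safe, simp_all, rule exI, rule fam_bound_scaleC, simp_all)

lift_definition star_matfam :: "'a matfam \<Rightarrow> 'a matfam" is "\<lambda>X k. mat_star (X k)"
  by (safe, simp_all, rule exI, rule fam_bound_star, simp_all)

instance
proof
  fix x y z :: "'a matfam" and c d :: complex and r s :: real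
  note coord_simps = plus_matfam.rep_eq times_matfam.rep_eq scaleC_matfam.rep_eq star_matfam.rep_eq
    scaleR_matfam.rep_eq
  have eqI: "x = y" if "\<And>k. coord x k = coord y k" for x y :: "'a matfam"
    using that by (simp add: coord_inject[symmetric] fun_eq_iff)
  note cc = coord_carrier
  show "scaleC c (x + y) = scaleC c x + scaleC c y" "scaleC (c + d) x = scaleC c x + scaleC d x"
    "scaleC c (scaleC d x) = scaleC (c * d) x" "scaleC (complex_of_real r) x = scaleR r x"
    "star (star x) = x" "star (x + y) = star x + star y" "star (scaleC c x) = scaleC (cnj c) (star x)"
    by (auto intro!: matfam_eqI simp: coord_simps scaleC_add_right scaleC_add_left scaleC_scaleC
        star_star star_add star_scaleC)
  show "scaleC c x * y = scaleC c (x * y)" "x * scaleC c y = scaleC c (x * y)"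
    by (auto intro!: matfam_eqI simp: coord_simps index_mult_mat_sum[OF cc cc]
        index_mult_mat_sum[OF mat_scaleC_carrier[OF cc] cc] index_mult_mat_sum[OF cc mat_scaleC_carrier[OF cc]]
        scaleC_sum scaleC_add_right mult_scaleC_left mult_scaleC_right simp del: index_mult_mat(1))
  show "star (x * y) = star y * star x"
    by (auto intro!: eqI simp: coord_simps mat_star_mult[OF cc cc])
  have scaleC_le: "norm (scaleC c x) \<le> cmod c * norm x" for c and x :: "'a matfam"
    by (intro norm_matfam_least)
      (simp add: scaleC_matfam.rep_eq fam_bound_scaleC[OF cc norm_matfam_bound])
  show "norm (scaleC c x) = cmod c * norm x"
  proof (cases "c = 0")
    case True
    then show ?thesis
      using scaleC_le[of c x] by simp
  next
    case False
    have "scaleC (1 / c) (scaleC c x) = x"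
      using False by (auto intro!: matfam_eqI simp: coord_simps scaleC_scaleC)
    then have "norm x \<le> cmod (1 / c) * norm (scaleC c x)"
      using scaleC_le[of "1 / c" "scaleC c x"] by simp
    then have "cmod c * norm x \<le> norm (scaleC c x)"
      using False by (simp add: norm_divide field_simps)
    then show ?thesis
      using scaleC_le[of c x] by simp
  qed
  have star_le: "norm (star x) \<le> norm x"
    by (intro norm_matfam_least) (simp add: star_matfam.rep_eq fam_bound_star[OF cc norm_matfam_bound])
  show "norm (star x * x) = (norm x)\<^sup>2"
  proof (rule antisym)
    show "norm (star x * x) \<le> (norm x)\<^sup>2"
      unfolding power2_eq_square
      by (intro order_trans[OF norm_mult_ineq] mult_right_mono star_le norm_ge_zero)
    have "fam_bound (\<lambda>k. mat_star (coord x k) * coord x k) (norm (star x * x))"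
      using norm_matfam_bound[of "star x * x"] by (simp add: times_matfam.rep_eq star_matfam.rep_eq)
    then have "fam_bound (coord x) (sqrt (norm (star x * x)))"
      unfolding fam_bound_def using act_cstar_bound[OF cc[of x]] by auto
    then have "norm x \<le> sqrt (norm (star x * x))"
      by (rule norm_matfam_least)
    then show "(norm x)\<^sup>2 \<le> norm (star x * x)"
      by (metis norm_ge_zero power_mono real_sqrt_pow2)
  qed
qed

end

section \<open>Functional calculus for matrices\<close>

text \<open>Since \<open>spec (fam_single k M c) = insert c (mat_spectrum M)\<close>, a point \<open>c\<close> of the spectrum of \<open>M\<close>
  gives an element of the product with the same spectrum as \<open>M\<close>.\<close>

definition fam_single :: "nat \<Rightarrow> 'a::cstar_algebra mat \<Rightarrow> complex \<Rightarrow> 'a matfam" where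
  "fam_single k M c = Abs_matfam (\<lambda>l. if l = k then M else mat_scaleC c (1\<^sub>m (Suc l)))"

lemma coord_fam_single:
  assumes "M \<in> carrier_mat (Suc k) (Suc k)"
  shows "coord (fam_single k M c) = (\<lambda>l. if l = k then M else mat_scaleC c (1\<^sub>m (Suc l)))"
  unfolding fam_single_def
proof (intro Abs_matfam_inverse CollectI conjI allI exI)
  define C where "C = (\<Sum>i<Suc k. \<Sum>j<Suc k. norm (M $$ (i, j)))"
  have C: "0 \<le> C"
    unfolding C_def by (intro sum_nonneg) simp
  show "fam_bound (\<lambda>l. if l = k then M else mat_scaleC c (1\<^sub>m (Suc l))) (C + cmod c)"
    unfolding fam_bound_def
  proof safe
    fix l y
    show "cnorm (Suc l) (act (Suc l) (if l = k then M else mat_scaleC c (1\<^sub>m (Suc l))) y)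
        \<le> (C + cmod c) * cnorm (Suc l) y"
    proof (cases "l = k")
      case True
      have "cnorm (Suc k) (act (Suc k) M y) \<le> C * cnorm (Suc k) y"
        unfolding C_def by (rule act_bound)
      also have "\<dots> \<le> (C + cmod c) * cnorm (Suc k) y"
        by (intro mult_right_mono) auto
      finally show ?thesis
        using True by simp
    next
      case False
      have "cnorm (Suc l) (act (Suc l) (mat_scaleC c (1\<^sub>m (Suc l))) y) = cnorm (Suc l) (\<lambda>i. scaleC c (y i))"
        by (rule cnorm_cong) (simp add: act_scaleC[of _ "Suc l" "Suc l"] act_one)
      also have "\<dots> \<le> (C + cmod c) * cnorm (Suc l) y"
        unfolding cnorm_scaleC using C by (intro mult_right_mono) auto
      finally show ?thesis
        using False by simp
    qed
  qed (use C in simp)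
qed (use assms in auto)

lemma coord_scal: "coord (scal z) k = mat_scaleC z (1\<^sub>m (Suc k))"
  by (simp add: scal_def scaleC_matfam.rep_eq one_matfam.rep_eq)

lemma matfam_eq_iff: "x = y \<longleftrightarrow> (\<forall>k. coord x k = coord y k)"
  by (simp add: coord_inject[symmetric] fun_eq_iff)

lemma invertible_matI:
  assumes "A \<in> carrier_mat n n" "B \<in> carrier_mat n n" "A * B = 1\<^sub>m n" "B * A = 1\<^sub>m n"
  shows "invertible_mat A"
  using assms unfolding invertible_mat_def inverts_mat_def by auto

lemma invertible_matE:
  assumes "invertible_mat A" "A \<in> carrier_mat n n"
  obtains B where "B \<in> carrier_mat n n" "A * B = 1\<^sub>m n" "B * A = 1\<^sub>m n"
proof -
  obtain B where B: "A * B = 1\<^sub>m (dim_row A)" "B * A = 1\<^sub>m (dim_row B)"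
    using assms(1) by (auto simp: invertible_mat_def inverts_mat_def)
  have "dim_col B = n"
    using arg_cong[OF B(1), of dim_col] assms(2) by simp
  moreover have "dim_row B = n"
    using arg_cong[OF B(2), of dim_col] assms(2) by simp
  ultimately show ?thesis
    using that[of B] B assms(2) by auto
qed

lemma mat_scaleC_one_mult:
  "mat_scaleC c (1\<^sub>m n) * mat_scaleC d (1\<^sub>m n) = mat_scaleC (c * d) (1\<^sub>m n :: 'a::cstar_algebra mat)"
proof (rule eq_matI)
  fix i j
  assume "i < dim_row (mat_scaleC (c * d) (1\<^sub>m n :: 'a mat))" "j < dim_col (mat_scaleC (c * d) (1\<^sub>m n :: 'a mat))"
  then have ij: "i < n" "j < n"
    by auto
  have "(mat_scaleC c (1\<^sub>m n) * mat_scaleC d (1\<^sub>m n :: 'a mat)) $$ (i, j)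
      = act n (mat_scaleC c (1\<^sub>m n)) (\<lambda>l. mat_scaleC d (1\<^sub>m n) $$ (l, j)) i"
    using ij by (subst index_mult_mat_sum[of _ n n _ n]) (auto simp: act_def)
  also have "\<dots> = mat_scaleC (c * d) (1\<^sub>m n) $$ (i, j)"
    using ij by (subst act_scaleC[of _ n n]) (auto simp: act_one scaleC_scaleC)
  finally show "(mat_scaleC c (1\<^sub>m n) * mat_scaleC d (1\<^sub>m n :: 'a mat)) $$ (i, j)
      = mat_scaleC (c * d) (1\<^sub>m n) $$ (i, j)" .
qed auto

lemma mat_scaleC_one [simp]: "mat_scaleC 1 A = A"
  by (rule eq_matI) auto

lemma mat_scaleC_diff:
  "mat_scaleC c (1\<^sub>m n) - mat_scaleC d (1\<^sub>m n) = mat_scaleC (c - d) (1\<^sub>m n :: 'a::cstar_algebra mat)"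
  by (rule eq_matI) (auto simp: scal_diff simp flip: scal_mult_left)

lemma spec_fam_single:
  fixes M :: "'a::cstar_algebra mat"
  assumes M: "M \<in> carrier_mat (Suc k) (Suc k)"
  shows "spec (fam_single k M c) = insert c (mat_spectrum M)"
proof -
  let ?x = "fam_single k M c"
  note cx = coord_fam_single[OF M, of c]
  have ck: "coord (scal z - ?x) k = mat_scaleC z (1\<^sub>m (Suc k)) - M" for z
    by (simp add: minus_matfam.rep_eq coord_scal cx)
  have cl: "coord (scal z - ?x) l = mat_scaleC (z - c) (1\<^sub>m (Suc l))" if "l \<noteq> k" for z l
    using that by (simp add: minus_matfam.rep_eq coord_scal cx mat_scaleC_diff)
  have "inv_elt (scal z - ?x) \<longleftrightarrow> z \<noteq> c \<and> invertible_mat (mat_scaleC z (1\<^sub>m (Suc k)) - M)" for z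
  proof (intro iffI conjI notI)
    assume "inv_elt (scal z - ?x)"
    then obtain y where y: "(scal z - ?x) * y = 1" "y * (scal z - ?x) = 1"
      by (auto simp: inv_elt_def)
    have c: "coord (scal z - ?x) l * coord y l = 1\<^sub>m (Suc l)" "coord y l * coord (scal z - ?x) l = 1\<^sub>m (Suc l)" for l
      using y by (simp_all add: matfam_eq_iff times_matfam.rep_eq one_matfam.rep_eq)
    show "invertible_mat (mat_scaleC z (1\<^sub>m (Suc k)) - M)"
      using c[of k] M unfolding ck by (intro invertible_matI[of _ "Suc k" "coord y k"]) auto
    assume "z = c"
    \<comment> \<open>\<open>Suc k\<close> is just some coordinate other than \<open>k\<close>.
      There \<open>scal z - ?x\<close> is the scalar \<open>z - c\<close>, which is 0 in this
      case.\<close>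
    then have "mat_scaleC 0 (1\<^sub>m (Suc (Suc k))) * coord y (Suc k) = 1\<^sub>m (Suc (Suc k))"
      using c(1)[of "Suc k"] cl[of "Suc k" z] by simp
    moreover have "mat_scaleC 0 (1\<^sub>m (Suc (Suc k))) = (0\<^sub>m (Suc (Suc k)) (Suc (Suc k)) :: 'a mat)"
      by (rule eq_matI) auto
    ultimately have "0\<^sub>m (Suc (Suc k)) (Suc (Suc k)) = (1\<^sub>m (Suc (Suc k)) :: 'a mat)"
      by simp
    from arg_cong[OF this, of "\<lambda>A. A $$ (0, 0)"] show False
      by simp
  next
    assume "z \<noteq> c \<and> invertible_mat (mat_scaleC z (1\<^sub>m (Suc k)) - M)"
    then have "z \<noteq> c" "invertible_mat (mat_scaleC z (1\<^sub>m (Suc k)) - M)"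
      by auto
    moreover have carr: "mat_scaleC z (1\<^sub>m (Suc k)) - M \<in> carrier_mat (Suc k) (Suc k)"
      using M by auto
    ultimately obtain B where B: "B \<in> carrier_mat (Suc k) (Suc k)"
      "(mat_scaleC z (1\<^sub>m (Suc k)) - M) * B = 1\<^sub>m (Suc k)" "B * (mat_scaleC z (1\<^sub>m (Suc k)) - M) = 1\<^sub>m (Suc k)"
      using invertible_matE by metis
    \<comment> \<open>The inverse has the same shape, so membership in the product needs no further
      bound.\<close>
    let ?y = "fam_single k B (1 / (z - c))"
    have "coord ((scal z - ?x) * ?y) l = coord 1 l" "coord (?y * (scal z - ?x)) l = coord 1 l" for l
      using B \<open>z \<noteq> c\<close>
      by (cases "l = k"; simp add: times_matfam.rep_eq one_matfam.rep_eq coord_fam_single[OF B(1)] ck cl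
          mat_scaleC_one_mult)+
    then show "inv_elt (scal z - ?x)"
      by (intro inv_eltI[of _ ?y]) (auto simp: matfam_eq_iff)
  qed
  then show ?thesis
    using M by (auto simp: spec_def mat_spectrum_def)
qed

lemma star_fam_single:
  assumes "M \<in> carrier_mat (Suc k) (Suc k)" "mat_star M = M"
  shows "star (fam_single k M (of_real r)) = fam_single k M (of_real r)"
proof -
  have "mat_star (mat_scaleC (of_real r) (1\<^sub>m n)) = mat_scaleC (of_real r) (1\<^sub>m n :: 'a mat)" for n
    by (rule eq_matI) (auto simp: star_scaleC)
  then show ?thesis
    using assms by (auto simp: matfam_eq_iff star_matfam.rep_eq coord_fam_single)
qed

locale selfadjoint_mat =
  fixes M :: "'a::cstar_algebra mat" and n :: nat
  assumes carrier: "M \<in> carrier_mat n n" and n_pos: "0 < n" and selfadjoint: "mat_star M = M"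
begin

lemma spectrum_real:
  assumes "z \<in> mat_spectrum M"
  shows "Im z = 0"
proof -
  obtain k where k: "n = Suc k"
    using n_pos by (cases n) auto
  note M = carrier[unfolded k]
  show ?thesis
    using spec_real[OF star_fam_single[OF M selfadjoint, of 0], of z] assms spec_fam_single[OF M, of 0]
    by simp
qed

text \<open>The scalar \<open>c\<close> in the other coordinates must be a spectral value of
  \<open>M\<close>, so the spectrum has to be nonempty. Otherwise \<open>fam_single k M 0\<close>
  would have spectrum \<open>{0}\<close>, hence norm 0, and \<open>M\<close> would be the zero
  matrix, whose spectrum contains 0. As \<open>c\<close> is real, the element is
  selfadjoint.\<close>

lemma ex_matfam:
  "\<exists>k x. n = Suc k \<and> star x = x \<and> coord x k = M \<and> spec x = mat_spectrum M"
proof -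
  obtain k where k: "n = Suc k"
    using n_pos by (cases n) auto
  note M = carrier[unfolded k]
  have "mat_spectrum M \<noteq> {}"
  proof
    assume e: "mat_spectrum M = {}"
    let ?x = "fam_single k M 0"
    have "star ?x = ?x"
      using star_fam_single[OF M selfadjoint, of 0] by simp
    then have "norm ?x = 0"
      using spec_norm_attained[of ?x] spec_fam_single[OF M, of 0] e by auto
    then have "M = 0\<^sub>m (Suc k) (Suc k)"
      using coord_fam_single[OF M, of 0] by (simp add: zero_matfam.rep_eq fun_eq_iff)
    then have "\<not> invertible_mat (mat_scaleC 0 (1\<^sub>m (Suc k)) - M)"
    proof -
      assume M0: "M = 0\<^sub>m (Suc k) (Suc k)"
      have z: "mat_scaleC 0 (1\<^sub>m (Suc k)) - M = 0\<^sub>m (Suc k) (Suc k)"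
        unfolding M0 by (rule eq_matI) auto
      show ?thesis
      proof
        assume i: "invertible_mat (mat_scaleC 0 (1\<^sub>m (Suc k)) - M)"
        obtain B :: "'a mat" where "B \<in> carrier_mat (Suc k) (Suc k)" "0\<^sub>m (Suc k) (Suc k) * B = 1\<^sub>m (Suc k)"
          using invertible_matE[OF i[unfolded z], of "Suc k"] by (metis zero_carrier_mat)
        then have "0\<^sub>m (Suc k) (Suc k) = (1\<^sub>m (Suc k) :: 'a mat)"
          by simp
        from arg_cong[OF this, of "\<lambda>A. A $$ (0, 0)"] show False
          by simp
      qed
    qed
    then show False
      using e M by (auto simp: mat_spectrum_def)
  qed
  then obtain c where c: "c \<in> mat_spectrum M"
    by auto
  then have r: "c = of_real (Re c)"
    using spectrum_real by (simp add: complex_eq_iff)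
  let ?x = "fam_single k M c"
  have "star ?x = ?x"
    by (subst (1 2) r) (rule star_fam_single[OF M selfadjoint])
  moreover have "coord ?x k = M"
    by (simp add: coord_fam_single[OF M])
  moreover have "spec ?x = mat_spectrum M"
    using spec_fam_single[OF M, of c] c by auto
  ultimately show ?thesis
    using k by blast
qed

lemma compact_spectrum: "compact (mat_spectrum M)"
  using ex_matfam compact_spec by metis

text \<open>The coordinate map is a unital *-homomorphism and continuous by
  \<open>entry_norm_le\<close>, so it carries the calculus of \<open>x\<close> to one for
  \<open>M\<close>. Equality of the two spectra lets \<open>f\<close> be continuous on the spectrum
  of \<open>M\<close> alone.\<close>

lemma ex_functional_calculus: "\<exists>\<Phi>. continuous_functional_calculus M \<Phi>"
proof -
  obtain k and x :: "'a matfam" where k: "n = Suc k" and x: "star x = x" "coord x k = M"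
    and spec: "spec x = mat_spectrum M"
    using ex_matfam by blast
  have dim: "dim_row M = Suc k"
    using carrier k by simp
  have "continuous_functional_calculus M (\<lambda>f. coord (fcalc x f) k)"
  proof (standard, unfold spec[symmetric] dim)
    fix f g :: "complex \<Rightarrow> complex" and c
    assume f: "continuous_on (spec x) f"
    show "coord (fcalc x f) k \<in> carrier_mat (Suc k) (Suc k)"
      by simp
    show "coord (fcalc x (\<lambda>z. c * f z)) k = mat_scaleC c (coord (fcalc x f) k)"
      using fcalc_scal[OF x(1) f] by (simp add: scal_mult_left scaleC_matfam.rep_eq)
    show "coord (fcalc x (\<lambda>z. cnj (f z))) k = mat_star (coord (fcalc x f) k)"
      using fcalc_cnj[OF x(1) f] by (simp add: star_matfam.rep_eq)
    assume g: "continuous_on (spec x) g"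
    show "coord (fcalc x (\<lambda>z. f z + g z)) k = coord (fcalc x f) k + coord (fcalc x g) k"
      using fcalc_add[OF x(1) f g] by (simp add: plus_matfam.rep_eq)
    show "coord (fcalc x (\<lambda>z. f z * g z)) k = coord (fcalc x f) k * coord (fcalc x g) k"
      using fcalc_mult[OF x(1) f g] by (simp add: times_matfam.rep_eq)
    assume "\<And>z. z \<in> spec x \<Longrightarrow> f z = g z"
    then show "coord (fcalc x f) k = coord (fcalc x g) k"
      using fcalc_cong[OF x(1)] by metis
  next
    show "coord (fcalc x (\<lambda>z. 1)) k = 1\<^sub>m (Suc k)"
      using fcalc_const[OF x(1), of 1] by (simp add: one_matfam.rep_eq)
    show "coord (fcalc x (\<lambda>z. z)) k = M"
      using fcalc_id[OF x(1)] x(2) by simp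
  next
    fix F :: "nat \<Rightarrow> complex \<Rightarrow> complex" and f and i j
    assume F: "\<And>m. continuous_on (spec x) (F m)" and f: "continuous_on (spec x) f"
      and lim: "uniform_limit (spec x) F f sequentially" and ij: "i < Suc k" "j < Suc k"
    show "(\<lambda>m. coord (fcalc x (F m)) k $$ (i, j)) \<longlonglongrightarrow> coord (fcalc x f) k $$ (i, j)"
    proof (rule LIMSEQ_I)
      fix e :: real
      assume e: "e > 0"
      have "\<forall>\<^sub>F m in sequentially. \<forall>z\<in>spec x. dist (F m z) (f z) < e / 2"
        using lim e by (auto dest!: uniform_limitD[of _ _ _ _ "e / 2"])
      then have "\<forall>\<^sub>F m in sequentially. norm (coord (fcalc x (F m)) k $$ (i, j) - coord (fcalc x f) k $$ (i, j)) < e"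
      proof eventually_elim
        case (elim m)
        have "norm (fcalc x (\<lambda>z. F m z - f z)) \<le> e / 2"
          using elim by (intro norm_fcalc[OF x(1)] continuous_intros F f) (auto simp: dist_norm less_imp_le)
        moreover have "coord (fcalc x (\<lambda>z. F m z - f z)) k $$ (i, j)
            = coord (fcalc x (F m)) k $$ (i, j) - coord (fcalc x f) k $$ (i, j)"
          using ij by (simp add: fcalc_diff[OF x(1) F f] minus_matfam.rep_eq)
        ultimately show ?case
          using entry_norm_le[OF ij, of "fcalc x (\<lambda>z. F m z - f z)"] e by simp
      qed
      then show "\<exists>no. \<forall>m\<ge>no. norm (coord (fcalc x (F m)) k $$ (i, j) - coord (fcalc x f) k $$ (i, j)) < e"
        by (simp add: eventually_sequentially)
    qed
  qed
  then show ?thesis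
    by blast
qed

end

section \<open>Entrywise limits and uniqueness of the functional calculus\<close>

definition mat_tendsto :: "nat \<Rightarrow> nat \<Rightarrow> (nat \<Rightarrow> 'a::cstar_algebra mat) \<Rightarrow> 'a mat \<Rightarrow> bool" where
  "mat_tendsto n m A L \<longleftrightarrow> (\<forall>i<n. \<forall>j<m. (\<lambda>k. A k $$ (i, j)) \<longlonglongrightarrow> L $$ (i, j))"

lemma mat_tendsto_unique:
  assumes "mat_tendsto n m A L" "mat_tendsto n m A L'" "L \<in> carrier_mat n m" "L' \<in> carrier_mat n m"
  shows "L = L'"
proof (rule eq_matI)
  fix i j
  assume "i < dim_row L'" "j < dim_col L'"
  then show "L $$ (i, j) = L' $$ (i, j)"
    using assms(4) by (intro LIMSEQ_unique[OF assms(1,2)[unfolded mat_tendsto_def, rule_format]]) auto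
qed (use assms in auto)

lemma mat_tendsto_const: "mat_tendsto n m (\<lambda>_. L) L"
  by (simp add: mat_tendsto_def)

lemma mat_tendsto_mult:
  assumes "mat_tendsto n m A L" "mat_tendsto m p B K"
    and "\<And>k. A k \<in> carrier_mat n m" "\<And>k. B k \<in> carrier_mat m p"
    and "L \<in> carrier_mat n m" "K \<in> carrier_mat m p"
  shows "mat_tendsto n p (\<lambda>k. A k * B k) (L * K)"
  unfolding mat_tendsto_def
proof (intro allI impI)
  fix i j
  assume ij: "i < n" "j < p"
  show "(\<lambda>k. (A k * B k) $$ (i, j)) \<longlonglongrightarrow> (L * K) $$ (i, j)"
    unfolding index_mult_mat_sum[OF assms(3,4) ij] index_mult_mat_sum[OF assms(5,6) ij]
    using assms(1,2) ij by (intro tendsto_sum tendsto_mult) (auto simp: mat_tendsto_def)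
qed

lemma mat_tendsto_star:
  assumes "mat_tendsto n m A L" "\<And>k. A k \<in> carrier_mat n m" "L \<in> carrier_mat n m"
  shows "mat_tendsto m n (\<lambda>k. mat_star (A k)) (mat_star L)"
  unfolding mat_tendsto_def
proof (intro allI impI)
  fix i j
  assume "i < m" "j < n"
  then show "(\<lambda>k. mat_star (A k) $$ (i, j)) \<longlonglongrightarrow> mat_star L $$ (i, j)"
    using assms(1) carrier_matD[OF assms(2)] carrier_matD[OF assms(3)]
    by (simp add: mat_tendsto_def tendsto_star)
qed

lemma (in continuous_functional_calculus) cfc_tendsto:
  assumes "\<And>k. continuous_on (mat_spectrum A) (F k)" "continuous_on (mat_spectrum A) f"
    "uniform_limit (mat_spectrum A) F f sequentially"
  shows "mat_tendsto (dim_row A) (dim_row A) (\<lambda>k. \<Phi> (F k)) (\<Phi> f)"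
  using cfc_continuous[OF assms] by (simp add: mat_tendsto_def)

lemma (in continuous_functional_calculus) cfc_const:
  "\<Phi> (\<lambda>_. c) = mat_scaleC c (1\<^sub>m (dim_row A))"
  using cfc_scaleC[OF continuous_on_const, of c 1] cfc_one by simp

lemma mat_scaleC_one_mult_left:
  "A \<in> carrier_mat n m \<Longrightarrow> mat_scaleC c (1\<^sub>m n) * A = mat_scaleC c A"
  and mat_scaleC_one_mult_right:
  "A \<in> carrier_mat n m \<Longrightarrow> A * mat_scaleC c (1\<^sub>m m) = mat_scaleC c (A :: 'a::cstar_algebra mat)"
proof -
  assume A: "A \<in> carrier_mat n m"
  show "mat_scaleC c (1\<^sub>m n) * A = mat_scaleC c A"
  proof (rule eq_matI)
    fix i j
    assume "i < dim_row (mat_scaleC c A)" "j < dim_col (mat_scaleC c A)"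
    then have ij: "i < n" "j < m"
      using A by auto
    have "(\<Sum>l<n. mat_scaleC c (1\<^sub>m n) $$ (i, l) * A $$ (l, j)) = (\<Sum>l<n. if l = i then scaleC c (A $$ (l, j)) else 0)"
      using ij by (intro sum.cong) (auto simp: mult_scaleC_left simp flip: scal_mult_left)
    then show "(mat_scaleC c (1\<^sub>m n) * A) $$ (i, j) = mat_scaleC c A $$ (i, j)"
      using A ij by (subst index_mult_mat_sum[of _ n n _ m]) auto
  qed (use A in auto)
  show "A * mat_scaleC c (1\<^sub>m m) = mat_scaleC c A"
  proof (rule eq_matI)
    fix i j
    assume "i < dim_row (mat_scaleC c A)" "j < dim_col (mat_scaleC c A)"
    then have ij: "i < n" "j < m"
      using A by auto
    have "(\<Sum>l<m. A $$ (i, l) * mat_scaleC c (1\<^sub>m m) $$ (l, j)) = (\<Sum>l<m. if l = j then scaleC c (A $$ (i, l)) else 0)"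
      using ij by (intro sum.cong) (auto simp: mult_scaleC_right scal_commute[of "A $$ (i, j)"] simp flip: scal_mult_left)
    then show "(A * mat_scaleC c (1\<^sub>m m)) $$ (i, j) = mat_scaleC c A $$ (i, j)"
      using A ij by (subst index_mult_mat_sum[of _ n m _ m]) auto
  qed (use A in auto)
qed

text \<open>\<open>C * X = Y * C\<close> passes to polynomials by induction, and to \<open>f\<close>
  by polynomials approximating it on both spectra at once. With \<open>C\<close> the unit matrix
  this is uniqueness of the calculus; with \<open>C = A\<close> it moves functions of
  \<open>mat_star A * A\<close> across \<open>A\<close>.\<close>

lemma functional_calculus_intertwine:
  fixes X Y C :: "'a::cstar_algebra mat"
  assumes X: "selfadjoint_mat X n" "continuous_functional_calculus X \<Phi>"
    and Y: "selfadjoint_mat Y m" "continuous_functional_calculus Y \<Psi>"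
    and C: "C \<in> carrier_mat m n" "C * X = Y * C"
    and f: "continuous_on (mat_spectrum X \<union> mat_spectrum Y) f"
  shows "C * \<Phi> f = \<Psi> f * C"
proof -
  interpret X: selfadjoint_mat X n by (fact X)
  interpret Y: selfadjoint_mat Y m by (fact Y)
  interpret FX: continuous_functional_calculus X \<Phi> by (fact X)
  interpret FY: continuous_functional_calculus Y \<Psi> by (fact Y)
  have dX: "dim_row X = n" and dY: "dim_row Y = m"
    using X.carrier Y.carrier by auto
  note cX = FX.cfc_carrier[unfolded dX] and cY = FY.cfc_carrier[unfolded dY]
  let ?S = "mat_spectrum X \<union> mat_spectrum Y"
  have poly: "C * \<Phi> (poly p) = \<Psi> (poly p) * C" for p
  proof (induction p)
    case 0
    have "poly 0 = (\<lambda>_ :: complex. 0)"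
      by auto
    then show ?case
      using C by (simp add: FX.cfc_const FY.cfc_const dX dY mat_scaleC_one_mult_left mat_scaleC_one_mult_right)
  next
    case (pCons c p)
    have e: "poly (pCons c p) = (\<lambda>z. c + z * poly p z)"
      by auto
    have y: "\<Psi> (poly (pCons c p)) = mat_scaleC c (1\<^sub>m m) + \<Psi> (poly p) * Y"
      unfolding e using FY.cfc_add[of "\<lambda>_. c" "\<lambda>z. poly p z * z"] FY.cfc_mult[of "poly p" "\<lambda>z. z"]
      by (simp add: continuous_intros FY.cfc_const FY.cfc_id dY mult.commute[of _ "poly p _"])
    have cp: "\<Phi> (poly p) \<in> carrier_mat n n" "\<Psi> (poly p) \<in> carrier_mat m m"
      by (auto intro!: cX cY continuous_intros)
    have x: "\<Phi> (poly (pCons c p)) = mat_scaleC c (1\<^sub>m n) + \<Phi> (poly p) * X"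
      unfolding e using FX.cfc_add[of "\<lambda>_. c" "\<lambda>z. poly p z * z"] FX.cfc_mult[of "poly p" "\<lambda>z. z"]
      by (simp add: continuous_intros FX.cfc_const FX.cfc_id dX mult.commute[of _ "poly p _"])
    have "C * \<Phi> (poly (pCons c p)) = C * mat_scaleC c (1\<^sub>m n) + C * (\<Phi> (poly p) * X)"
      unfolding x by (rule mult_add_distrib_mat[of _ m n _ n]) (use C cp X.carrier in auto)
    also have "C * (\<Phi> (poly p) * X) = (C * \<Phi> (poly p)) * X"
      by (rule assoc_mult_mat[symmetric]) (use C cp X.carrier in auto)
    also have "\<dots> = (\<Psi> (poly p) * C) * X"
      unfolding pCons.IH ..
    also have "\<dots> = \<Psi> (poly p) * (C * X)"
      by (rule assoc_mult_mat) (use C cp X.carrier in auto)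
    also have "\<dots> = \<Psi> (poly p) * Y * C"
      unfolding C(2) by (rule assoc_mult_mat[symmetric]) (use C cp Y.carrier in auto)
    also have "C * mat_scaleC c (1\<^sub>m n) = mat_scaleC c (1\<^sub>m m) * C"
      using C by (simp add: mat_scaleC_one_mult_left mat_scaleC_one_mult_right)
    also have "mat_scaleC c (1\<^sub>m m) * C + \<Psi> (poly p) * Y * C = \<Psi> (poly (pCons c p)) * C"
      unfolding y by (rule add_mult_distrib_mat[symmetric]) (use C cp Y.carrier in auto)
    finally show ?case .
  qed
  have S: "compact ?S" "\<And>z. z \<in> ?S \<Longrightarrow> Im z = 0"
    using X.compact_spectrum Y.compact_spectrum X.spectrum_real Y.spectrum_real by auto
  have "\<exists>p. \<forall>z\<in>?S. cmod (poly p z - f z) < inverse (real (Suc k))" for k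
  proof -
    have "0 < inverse (real (Suc k))"
      by simp
    from approx_complex_poly[OF S f this] show ?thesis
      by simp
  qed
  then obtain p where p: "\<And>k z. z \<in> ?S \<Longrightarrow> cmod (poly (p k) z - f z) < inverse (real (Suc k))"
    by metis
  have lim: "uniform_limit ?S (\<lambda>k. poly (p k)) f sequentially"
  proof (rule uniform_limitI)
    fix e :: real
    assume "e > 0"
    then have "\<forall>\<^sub>F k in sequentially. inverse (real (Suc k)) < e"
      by (rule order_tendstoD(2)[OF LIMSEQ_inverse_real_of_nat])
    then show "\<forall>\<^sub>F k in sequentially. \<forall>z\<in>?S. dist (poly (p k) z) (f z) < e"
      by eventually_elim (metis p dist_norm less_trans)
  qed
  have fX: "continuous_on (mat_spectrum X) f" and fY: "continuous_on (mat_spectrum Y) f"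
    using f by (auto intro: continuous_on_subset)
  have pX: "\<Phi> (poly q) \<in> carrier_mat n n" and pY: "\<Psi> (poly q) \<in> carrier_mat m m" for q
    by (auto intro!: cX cY continuous_intros)
  have "mat_tendsto n n (\<lambda>k. \<Phi> (poly (p k))) (\<Phi> f)"
    using FX.cfc_tendsto[OF _ fX uniform_limit_on_subset[OF lim]] by (simp add: dX continuous_intros)
  then have "mat_tendsto m n (\<lambda>k. C * \<Phi> (poly (p k))) (C * \<Phi> f)"
    by (rule mat_tendsto_mult[OF mat_tendsto_const]) (use C pX cX fX in simp_all)
  moreover have "mat_tendsto m m (\<lambda>k. \<Psi> (poly (p k))) (\<Psi> f)"
    using FY.cfc_tendsto[OF _ fY uniform_limit_on_subset[OF lim]] by (simp add: dY continuous_intros)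
  then have "mat_tendsto m n (\<lambda>k. \<Psi> (poly (p k)) * C) (\<Psi> f * C)"
    by (rule mat_tendsto_mult[OF _ mat_tendsto_const]) (use C pY cY fY in simp_all)
  ultimately show ?thesis
    unfolding poly using C(1) cX[OF fX] cY[OF fY]
    by (intro mat_tendsto_unique[of m n]) auto
qed

context selfadjoint_mat
begin

lemma cfc_eqI:
  assumes \<Phi>: "continuous_functional_calculus M \<Phi>" and f: "continuous_on (mat_spectrum M) f"
  shows "cfc M f = \<Phi> f"
  unfolding cfc_def
proof (rule the_equality)
  fix B
  assume "\<exists>\<Psi>. continuous_functional_calculus M \<Psi> \<and> B = \<Psi> f"
  then obtain \<Psi> where \<Psi>: "continuous_functional_calculus M \<Psi>" and B: "B = \<Psi> f"
    by auto
  have s: "selfadjoint_mat M n"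
    by unfold_locales
  have c: "\<Phi> f \<in> carrier_mat n n" "\<Psi> f \<in> carrier_mat n n"
    using continuous_functional_calculus.cfc_carrier[OF \<Phi> f]
      continuous_functional_calculus.cfc_carrier[OF \<Psi> f] carrier by auto
  have "1\<^sub>m n * \<Phi> f = \<Psi> f * 1\<^sub>m n"
    by (rule functional_calculus_intertwine[OF s \<Phi> s \<Psi>]) (use f carrier in auto)
  then show "B = \<Phi> f"
    using B c by simp
qed (use \<Phi> in auto)

lemma functional_calculus_cfc: "\<exists>\<Phi>. continuous_functional_calculus M \<Phi> \<and>
    (\<forall>f. continuous_on (mat_spectrum M) f \<longrightarrow> cfc M f = \<Phi> f)"
  using ex_functional_calculus cfc_eqI by blast

end

section \<open>Positive matrices\<close>

lemma cinner_unit_col: "j < m \<Longrightarrow> cinner m (unit_col j) v = v j"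
proof -
  assume j: "j < m"
  have "cinner m (unit_col j) v = (\<Sum>i<m. if i = j then v i else 0)"
    unfolding cinner_def unit_col_def by (intro sum.cong) auto
  then show ?thesis
    using j by simp
qed

lemma cinner_act_mult:
  assumes "X \<in> carrier_mat n m" "Z \<in> carrier_mat m p"
  shows "cinner n y (act p (X * Z) w) = cinner n y (act m X (act p Z w))"
  by (rule cinner_cong) (simp_all add: act_mult[OF assms])

lemma cinner_gram:
  assumes "C \<in> carrier_mat n m"
  shows "cinner m y (act m (mat_star C * C) y) = cinner n (act m C y) (act m C y)"
  unfolding act_adjoint[OF assms] by (rule cinner_act_mult) (use assms in auto)

lemma mat_eq_zeroI:
  assumes "X \<in> carrier_mat n m" "\<And>y i. i < n \<Longrightarrow> act m X y i = 0"
  shows "X = 0\<^sub>m n m"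
proof (rule eq_matI)
  fix i j
  assume "i < dim_row (0\<^sub>m n m :: 'a mat)" "j < dim_col (0\<^sub>m n m :: 'a mat)"
  then show "X $$ (i, j) = 0\<^sub>m n m $$ (i, j)"
    using assms(2)[of i "unit_col j"] by (simp add: act_unit_col)
qed (use assms in auto)

text \<open>The bridge from operator inequalities to entrywise limits: an upper bound for
  \<open>mat_star C * C\<close> can be read off on its diagonal and yields norm estimates for the
  entries of \<open>C\<close>.\<close>

lemma entry_norm_gram:
  assumes C: "C \<in> carrier_mat n m" and ij: "i < n" "j < m"
  shows "(norm (C $$ (i, j)))\<^sup>2 \<le> norm ((mat_star C * C) $$ (j, j))"
proof -
  have "norm (C $$ (i, j)) \<le> cnorm n (act m C (unit_col j))"
    using cnorm_component[OF ij(1), of "act m C (unit_col j)"] ij by (simp add: act_unit_col)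
  then have "(norm (C $$ (i, j)))\<^sup>2 \<le> (cnorm n (act m C (unit_col j)))\<^sup>2"
    by (intro power_mono) auto
  also have "\<dots> = norm ((mat_star C * C) $$ (j, j))"
    unfolding cnorm_sq cinner_gram[OF C, symmetric] cinner_unit_col[OF ij(2)] act_unit_col[OF ij(2)] ..
  finally show ?thesis .
qed

lemma gram_eq_zero:
  assumes "C \<in> carrier_mat n m" "mat_star C * C = 0\<^sub>m m m"
  shows "C = 0\<^sub>m n m"
proof (rule eq_matI)
  fix i j
  assume "i < dim_row (0\<^sub>m n m :: 'a mat)" "j < dim_col (0\<^sub>m n m :: 'a mat)"
  then show "C $$ (i, j) = 0\<^sub>m n m $$ (i, j)"
    using entry_norm_gram[OF assms(1), of i j] assms(2) by simp
qed (use assms in auto)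

text \<open>Equivalent to spectral positivity for \<open>0 < n\<close>
  (\<open>pos_mat_form_pos\<close>, \<open>form_pos_imp_pos_mat\<close>), but visibly stable under
  sums, limits and conjugation by rectangular matrices.\<close>

definition form_pos :: "nat \<Rightarrow> 'a::cstar_algebra mat \<Rightarrow> bool" where
  "form_pos n M \<longleftrightarrow> M \<in> carrier_mat n n \<and> mat_star M = M \<and> (\<forall>y. cpos (cinner n y (act n M y)))"

lemma form_pos_carrier: "form_pos n M \<Longrightarrow> M \<in> carrier_mat n n"
  by (simp add: form_pos_def)

lemma form_pos_selfadjoint: "form_pos n M \<Longrightarrow> mat_star M = M"
  by (simp add: form_pos_def)

lemma form_pos_gram:
  assumes "C \<in> carrier_mat n m"
  shows "form_pos m (mat_star C * C)"
  unfolding form_pos_def using assms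
  by (auto simp: mat_star_mult[of _ m n _ m] cinner_gram cpos_cinner)

lemma form_pos_conj:
  assumes M: "form_pos n M" and C: "C \<in> carrier_mat n m"
  shows "form_pos m (mat_star C * (M * C))"
  unfolding form_pos_def
proof (intro conjI allI)
  note Mc = form_pos_carrier[OF M]
  show "mat_star C * (M * C) \<in> carrier_mat m m"
    using Mc C by auto
  show "mat_star (mat_star C * (M * C)) = mat_star C * (M * C)"
    using Mc C form_pos_selfadjoint[OF M]
    by (simp add: mat_star_mult[of _ m n _ m] mat_star_mult[OF Mc C]
        assoc_mult_mat[of _ m n _ n _ m])
  fix y
  have "cinner m y (act m (mat_star C * (M * C)) y) = cinner m y (act n (mat_star C) (act m (M * C) y))"
    using Mc C by (intro cinner_act_mult) auto
  also have "\<dots> = cinner n (act m C y) (act m (M * C) y)"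
    by (rule act_adjoint[OF C, symmetric])
  also have "\<dots> = cinner n (act m C y) (act n M (act m C y))"
    by (rule cinner_act_mult[OF Mc C])
  finally show "cpos (cinner m y (act m (mat_star C * (M * C)) y))"
    using M by (simp add: form_pos_def)
qed

lemma form_pos_add:
  assumes "form_pos n M" "form_pos n N"
  shows "form_pos n (M + N)"
proof -
  have "cinner n y (act n (M + N) y) = cinner n y (act n M y) + cinner n y (act n N y)" for y
    unfolding cinner_add_right[symmetric]
    by (rule cinner_cong) (simp_all add: act_add[OF form_pos_carrier[OF assms(1)] form_pos_carrier[OF assms(2)]])
  then show ?thesis
    using assms by (auto simp: form_pos_def mat_star_add cpos_add)
qed

lemma form_pos_scale:
  assumes "form_pos n M" "0 \<le> r"
  shows "form_pos n (mat_scaleC (of_real r) M)"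
proof -
  note Mc = form_pos_carrier[OF assms(1)]
  have "cinner n y (act n (mat_scaleC (of_real r) M) y) = r *\<^sub>R cinner n y (act n M y)" for y
  proof -
    have "cinner n y (act n (mat_scaleC (of_real r) M) y) = cinner n y (\<lambda>i. r *\<^sub>R act n M y i)"
      by (rule cinner_cong) (simp_all add: act_scaleC[OF Mc] scaleC_of_real)
    then show ?thesis
      by (simp add: cinner_def scaleR_sum_right)
  qed
  moreover have "mat_star (mat_scaleC (of_real r) M) = mat_scaleC (of_real r) (mat_star M)"
    by (rule eq_matI) (auto simp: star_scaleC)
  ultimately show ?thesis
    using assms by (auto simp: form_pos_def cpos_scaleR)
qed

lemma form_pos_tendsto:
  assumes "mat_tendsto n n A L" "\<And>k. form_pos n (A k)" "L \<in> carrier_mat n n"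
  shows "form_pos n L"
  unfolding form_pos_def
proof (intro conjI allI)
  have A: "A k \<in> carrier_mat n n" "mat_star (A k) = A k" for k
    using assms(2)[of k] by (simp_all add: form_pos_def)
  show "mat_star L = L"
    using mat_tendsto_star[OF assms(1) A(1) assms(3)] assms A
    by (intro mat_tendsto_unique[of n n A]) auto
  fix y
  have "(\<lambda>k. cinner n y (act n (A k) y)) \<longlonglongrightarrow> cinner n y (act n L y)"
    unfolding cinner_def act_def using assms(1) by (intro tendsto_intros) (auto simp: mat_tendsto_def)
  then show "cpos (cinner n y (act n L y))"
    by (rule cpos_tendsto[rotated]) (use assms(2) in \<open>simp add: form_pos_def\<close>)
qed (fact assms)

lemma form_pos_diag: "form_pos n M \<Longrightarrow> j < n \<Longrightarrow> cpos (M $$ (j, j))"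
  using cinner_unit_col[of j n "act n M (unit_col j)"] act_unit_col[of j n M j]
  by (metis form_pos_def)

section \<open>Real functions of a positive matrix\<close>

definition pos_mat :: "nat \<Rightarrow> 'a::cstar_algebra mat \<Rightarrow> bool" where
  "pos_mat n X \<longleftrightarrow> X \<in> carrier_mat n n \<and> positive_mat X"

lemma pos_mat_selfadjoint:
  assumes "pos_mat n X"
  shows "selfadjoint_mat X n"
  by standard (use assms in \<open>auto simp: pos_mat_def positive_mat_def rect_mats_def\<close>)

lemma pos_mat_spectrum:
  assumes "pos_mat n X" "z \<in> mat_spectrum X"
  shows "0 \<le> Re z" "z = of_real (Re z)"
  using assms by (auto simp: pos_mat_def positive_mat_def)

text \<open>All spectra in question lie in \<open>{0..}\<close>. Asking for continuity of
  \<open>h\<close> there allows one function to be applied to several positive matrices without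
  mention of their spectra.\<close>

definition hcalc :: "'a::cstar_algebra mat \<Rightarrow> (real \<Rightarrow> real) \<Rightarrow> 'a mat" where
  "hcalc X h = cfc X (\<lambda>z. complex_of_real (h (Re z)))"

lemma mat_powr_eq_hcalc: "mat_powr X \<theta> = hcalc X (\<lambda>t. t powr \<theta>)"
  by (simp add: mat_powr_def hcalc_def)

context
  fixes X :: "'a::cstar_algebra mat" and n :: nat
  assumes pos: "pos_mat n X"
begin

lemma hcalc_continuous_on_spectrum:
  assumes "continuous_on {0..} h"
  shows "continuous_on (mat_spectrum X) (\<lambda>z. complex_of_real (h (Re z)))"
  using pos_mat_spectrum[OF pos]
  by (intro continuous_intros continuous_on_compose2[OF assms]) auto

lemma ex_hcalc: "\<exists>\<Phi>. continuous_functional_calculus X \<Phi> \<and>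
    (\<forall>h. continuous_on {0..} h \<longrightarrow> hcalc X h = \<Phi> (\<lambda>z. complex_of_real (h (Re z))))"
  using selfadjoint_mat.functional_calculus_cfc[OF pos_mat_selfadjoint[OF pos]]
    hcalc_continuous_on_spectrum unfolding hcalc_def by blast

lemma pos_mat_dim: "dim_row X = n" "dim_col X = n" "0 < n"
  using pos selfadjoint_mat.n_pos[OF pos_mat_selfadjoint[OF pos]] by (auto simp: pos_mat_def)

lemma hcalc_carrier [simp]:
  assumes "continuous_on {0..} h"
  shows "hcalc X h \<in> carrier_mat n n"
proof -
  obtain \<Phi> where \<Phi>: "continuous_functional_calculus X \<Phi>"
    and e: "\<And>h. continuous_on {0..} h \<Longrightarrow> hcalc X h = \<Phi> (\<lambda>z. complex_of_real (h (Re z)))"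
    using ex_hcalc by blast
  show ?thesis
    using continuous_functional_calculus.cfc_carrier[OF \<Phi> hcalc_continuous_on_spectrum[OF assms]]
    by (simp add: e assms pos_mat_dim)
qed

lemma hcalc_star:
  assumes "continuous_on {0..} h"
  shows "mat_star (hcalc X h) = hcalc X h"
proof -
  obtain \<Phi> where \<Phi>: "continuous_functional_calculus X \<Phi>"
    and e: "\<And>h. continuous_on {0..} h \<Longrightarrow> hcalc X h = \<Phi> (\<lambda>z. complex_of_real (h (Re z)))"
    using ex_hcalc by blast
  show ?thesis
    using continuous_functional_calculus.cfc_star[OF \<Phi> hcalc_continuous_on_spectrum[OF assms]]
    by (simp add: e assms)
qed

lemma hcalc_add:
  assumes "continuous_on {0..} h" "continuous_on {0..} g"
  shows "hcalc X (\<lambda>t. h t + g t) = hcalc X h + hcalc X g"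
proof -
  obtain \<Phi> where \<Phi>: "continuous_functional_calculus X \<Phi>"
    and e: "\<And>h. continuous_on {0..} h \<Longrightarrow> hcalc X h = \<Phi> (\<lambda>z. complex_of_real (h (Re z)))"
    using ex_hcalc by blast
  show ?thesis
    using continuous_functional_calculus.cfc_add[OF \<Phi> assms[THEN hcalc_continuous_on_spectrum]]
    by (simp add: e assms continuous_on_add)
qed

lemma hcalc_mult:
  assumes "continuous_on {0..} h" "continuous_on {0..} g"
  shows "hcalc X (\<lambda>t. h t * g t) = hcalc X h * hcalc X g"
proof -
  obtain \<Phi> where \<Phi>: "continuous_functional_calculus X \<Phi>"
    and e: "\<And>h. continuous_on {0..} h \<Longrightarrow> hcalc X h = \<Phi> (\<lambda>z. complex_of_real (h (Re z)))"
    using ex_hcalc by blast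
  show ?thesis
    using continuous_functional_calculus.cfc_mult[OF \<Phi> assms[THEN hcalc_continuous_on_spectrum]]
    by (simp add: e assms continuous_on_mult)
qed

lemma hcalc_scale:
  assumes "continuous_on {0..} h"
  shows "hcalc X (\<lambda>t. r * h t) = mat_scaleC (of_real r) (hcalc X h)"
proof -
  obtain \<Phi> where \<Phi>: "continuous_functional_calculus X \<Phi>"
    and e: "\<And>h. continuous_on {0..} h \<Longrightarrow> hcalc X h = \<Phi> (\<lambda>z. complex_of_real (h (Re z)))"
    using ex_hcalc by blast
  show ?thesis
    using continuous_functional_calculus.cfc_scaleC[OF \<Phi> hcalc_continuous_on_spectrum[OF assms], of "of_real r"]
    by (simp add: e assms continuous_on_mult)
qed

lemma hcalc_const: "hcalc X (\<lambda>_. r) = mat_scaleC (of_real r) (1\<^sub>m n)"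
proof -
  obtain \<Phi> where \<Phi>: "continuous_functional_calculus X \<Phi>"
    and e: "\<And>h. continuous_on {0..} h \<Longrightarrow> hcalc X h = \<Phi> (\<lambda>z. complex_of_real (h (Re z)))"
    using ex_hcalc by blast
  show ?thesis
    using continuous_functional_calculus.cfc_const[OF \<Phi>, of "of_real r"] by (simp add: e pos_mat_dim)
qed

lemma hcalc_cong:
  assumes "continuous_on {0..} h" "continuous_on {0..} g"
    "\<And>t. 0 \<le> t \<Longrightarrow> of_real t \<in> mat_spectrum X \<Longrightarrow> h t = g t"
  shows "hcalc X h = hcalc X g"
proof -
  obtain \<Phi> where \<Phi>: "continuous_functional_calculus X \<Phi>"
    and e: "\<And>h. continuous_on {0..} h \<Longrightarrow> hcalc X h = \<Phi> (\<lambda>z. complex_of_real (h (Re z)))"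
    using ex_hcalc by blast
  show ?thesis
    unfolding e[OF assms(1)] e[OF assms(2)]
    by (rule continuous_functional_calculus.cfc_cong[OF \<Phi> assms(1,2)[THEN hcalc_continuous_on_spectrum]])
      (metis assms(3) pos_mat_spectrum[OF pos])
qed

lemma hcalc_id: "hcalc X (\<lambda>t. t) = X"
proof -
  obtain \<Phi> where \<Phi>: "continuous_functional_calculus X \<Phi>"
    and e: "\<And>h. continuous_on {0..} h \<Longrightarrow> hcalc X h = \<Phi> (\<lambda>z. complex_of_real (h (Re z)))"
    using ex_hcalc by blast
  have "\<Phi> (\<lambda>z. complex_of_real (Re z)) = \<Phi> (\<lambda>z. z)"
    by (rule continuous_functional_calculus.cfc_cong[OF \<Phi>])
      (auto intro!: continuous_intros simp: pos_mat_spectrum(2)[OF pos, symmetric])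
  then show ?thesis
    by (simp add: e continuous_functional_calculus.cfc_id[OF \<Phi>])
qed

lemma spectrum_bounded: "\<exists>M\<ge>1. \<forall>z\<in>mat_spectrum X. Re z \<le> M"
proof -
  have "bounded (mat_spectrum X)"
    using selfadjoint_mat.compact_spectrum[OF pos_mat_selfadjoint[OF pos]] by (rule compact_imp_bounded)
  then obtain B where B: "\<And>z. z \<in> mat_spectrum X \<Longrightarrow> cmod z \<le> B"
    by (auto simp: bounded_iff)
  have "Re z \<le> max 1 B" if "z \<in> mat_spectrum X" for z
    using complex_Re_le_cmod[of z] B[OF that] by linarith
  then show ?thesis
    by (intro exI[of _ "max 1 B"]) auto
qed

lemma hcalc_tendsto:
  assumes H: "\<And>k. continuous_on {0..} (H k)" and h: "continuous_on {0..} h"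
    and lim: "\<And>M. uniform_limit {0..M} H h sequentially"
  shows "mat_tendsto n n (\<lambda>k. hcalc X (H k)) (hcalc X h)"
proof -
  obtain \<Phi> where \<Phi>: "continuous_functional_calculus X \<Phi>"
    and e: "\<And>h. continuous_on {0..} h \<Longrightarrow> hcalc X h = \<Phi> (\<lambda>z. complex_of_real (h (Re z)))"
    using ex_hcalc by blast
  obtain M where M: "\<And>z. z \<in> mat_spectrum X \<Longrightarrow> Re z \<le> M"
    using spectrum_bounded by blast
  have "uniform_limit (mat_spectrum X) (\<lambda>k z. complex_of_real (H k (Re z))) (\<lambda>z. complex_of_real (h (Re z))) sequentially"
  proof (rule uniform_limitI)
    fix e :: real
    assume "e > 0"
    from uniform_limitD[OF lim[of M] this]
    show "\<forall>\<^sub>F k in sequentially. \<forall>z\<in>mat_spectrum X.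
        dist (complex_of_real (H k (Re z))) (complex_of_real (h (Re z))) < e"
      by (rule eventually_mono) (use M pos_mat_spectrum(1)[OF pos] in \<open>auto simp: dist_of_real\<close>)
  qed
  from continuous_functional_calculus.cfc_tendsto[OF \<Phi> hcalc_continuous_on_spectrum[OF H]
      hcalc_continuous_on_spectrum[OF h] this]
  show ?thesis
    by (simp add: e H h pos_mat_dim)
qed

text \<open>On the spectrum \<open>h\<close> is the square of a real continuous function, so its
  value at \<open>X\<close> is a Gram matrix.\<close>

lemma form_pos_hcalc:
  assumes h: "continuous_on {0..} h" and nn: "\<And>t. 0 \<le> t \<Longrightarrow> of_real t \<in> mat_spectrum X \<Longrightarrow> 0 \<le> h t"
  shows "form_pos n (hcalc X h)"
proof -
  let ?s = "\<lambda>t. sqrt \<bar>h t\<bar>"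
  have s: "continuous_on {0..} ?s"
    by (rule continuous_on_real_sqrt[OF continuous_on_rabs[OF h]])
  have "hcalc X h = hcalc X (\<lambda>t. ?s t * ?s t)"
    by (rule hcalc_cong[OF h continuous_on_mult[OF s s]]) (simp add: nn)
  also have "\<dots> = mat_star (hcalc X ?s) * hcalc X ?s"
    unfolding hcalc_mult[OF s s] hcalc_star[OF s] ..
  finally show ?thesis
    using form_pos_gram[OF hcalc_carrier[OF s]] by simp
qed

end

lemma pos_mat_form_pos: "pos_mat n X \<Longrightarrow> form_pos n X"
  using form_pos_hcalc[of n X "\<lambda>t. t"] hcalc_id[of n X] by (simp add: continuous_on_id)

lemma hcalc_intertwine:
  assumes X: "pos_mat n X" and Y: "pos_mat m Y"
    and C: "C \<in> carrier_mat m n" "C * X = Y * C" and h: "continuous_on {0..} h"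
  shows "C * hcalc X h = hcalc Y h * C"
proof -
  obtain \<Phi> where \<Phi>: "continuous_functional_calculus X \<Phi>"
    and eX: "hcalc X h = \<Phi> (\<lambda>z. complex_of_real (h (Re z)))"
    using ex_hcalc[OF X] h by blast
  obtain \<Psi> where \<Psi>: "continuous_functional_calculus Y \<Psi>"
    and eY: "hcalc Y h = \<Psi> (\<lambda>z. complex_of_real (h (Re z)))"
    using ex_hcalc[OF Y] h by blast
  have "continuous_on (mat_spectrum X \<union> mat_spectrum Y) (\<lambda>z. complex_of_real (h (Re z)))"
    using pos_mat_spectrum(1)[OF X] pos_mat_spectrum(1)[OF Y]
    by (intro continuous_intros continuous_on_compose2[OF h]) auto
  then show ?thesis
    unfolding eX eY
    by (rule functional_calculus_intertwine[OF pos_mat_selfadjoint[OF X] \<Phi> pos_mat_selfadjoint[OF Y] \<Psi> C])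
qed

text \<open>Let \<open>H\<close> be the negative part of \<open>M\<close>. The form of
  \<open>H M H = - H^3\<close> is nonnegative by hypothesis and nonpositive as well, so
  \<open>H = 0\<close> and \<open>M\<close> is its own positive part \<open>\<Phi> g\<close>. For
  \<open>Re z < 0\<close> the function \<open>z - g\<close> has no zero, and its reciprocal provides
  an inverse of \<open>z - M\<close>.\<close>

lemma form_pos_imp_pos_mat:
  assumes form: "form_pos n M" and n: "0 < n"
  shows "pos_mat n M"
proof -
  interpret selfadjoint_mat M n
    by standard (use form n in \<open>auto simp: form_pos_def\<close>)
  obtain \<Phi> where "continuous_functional_calculus M \<Phi>"
    using ex_functional_calculus by blast
  then interpret continuous_functional_calculus M \<Phi> .
  have dim: "dim_row M = n"
    using carrier by simp
  define h where "h = (\<lambda>z. complex_of_real (max 0 (- Re z)))"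
  define s where "s = (\<lambda>z. complex_of_real (sqrt (max 0 (- Re z))))"
  have ch: "continuous_on S h" and cs: "continuous_on S s" for S
    unfolding h_def s_def by (intro continuous_intros)+
  have ss: "s z * s z = h z" for z
    by (simp add: s_def h_def flip: of_real_mult)
  have c3: "continuous_on S (\<lambda>z. h z * s z)" for S
    by (intro continuous_intros ch cs)
  \<comment> \<open>The power 3/2 of \<open>H\<close>. It exhibits \<open>H^3\<close> as the Gram
    matrix \<open>mat_star R * R\<close>, whose form is positive without any appeal to the
    spectrum.\<close>
  define R where "R = \<Phi> (\<lambda>z. h z * s z)"
  define H where "H = \<Phi> h"
  have car: "R \<in> carrier_mat n n" "H \<in> carrier_mat n n"
    unfolding R_def H_def dim[symmetric] by (intro cfc_carrier c3 ch)+
  have sR: "mat_star R = R" and sH: "mat_star H = H"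
    unfolding R_def H_def using cfc_star[OF c3] cfc_star[OF ch] by (simp_all add: h_def s_def)
  have M: "\<Phi> (\<lambda>z. z) = M" and ci: "continuous_on S (\<lambda>z :: complex. z)" for S
    by (simp_all add: cfc_id continuous_on_id)
  have "mat_star H * (M * H) + mat_star R * R = \<Phi> (\<lambda>z. h z * (z * h z) + (h z * s z) * (h z * s z))"
    unfolding sH sR unfolding H_def R_def M[symmetric]
    by (simp add: cfc_mult[OF c3 c3] cfc_mult[OF ch continuous_on_mult[OF ci ch]] cfc_mult[OF ci ch]
        cfc_add[OF continuous_on_mult[OF ch continuous_on_mult[OF ci ch]] continuous_on_mult[OF c3 c3]])
  also have "\<dots> = \<Phi> (\<lambda>z. 0)"
  proof (rule cfc_cong)
    fix z
    assume "z \<in> mat_spectrum M"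
    then have z: "z = of_real (Re z)"
      using spectrum_real by (simp add: complex_eq_iff)
    have "(h z * s z) * (h z * s z) = h z * h z * (s z * s z)"
      by simp
    also have "\<dots> = h z * h z * h z"
      unfolding ss ..
    finally show "h z * (z * h z) + (h z * s z) * (h z * s z) = 0"
      using z by (cases "Re z \<ge> 0") (auto simp: h_def complex_eq_iff)
  qed (intro continuous_intros ch cs)+
  also have "\<dots> = 0\<^sub>m n n"
    unfolding cfc_const dim by (rule eq_matI) auto
  finally have sum0: "mat_star H * (M * H) + mat_star R * R = 0\<^sub>m n n" .
  have "act n R y i = 0" if "i < n" for y i
  proof -
    let ?a = "cinner n y (act n (mat_star H * (M * H)) y)" and ?b = "cinner n y (act n (mat_star R * R) y)"
    have c: "mat_star H * (M * H) \<in> carrier_mat n n" "mat_star R * R \<in> carrier_mat n n"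
      using car carrier by auto
    have "?a + ?b = cinner n y (act n (mat_star H * (M * H) + mat_star R * R) y)"
      unfolding cinner_add_right[symmetric] by (rule cinner_cong) (simp_all add: act_add[OF c])
    also have "\<dots> = 0"
      unfolding sum0 by (simp add: cinner_def act_def)
    finally have "- ?b = ?a"
      by (simp add: add_eq_0_iff2)
    moreover have "cpos ?a"
      using form_pos_conj[OF form car(2)] by (simp add: form_pos_def)
    moreover have "cpos ?b"
      using form_pos_gram[OF car(1)] by (simp add: form_pos_def)
    ultimately have "?b = 0"
      using cpos_minus_eq_0[of ?b] by simp
    then have "cnorm n (act n R y) = 0"
      unfolding cinner_gram[OF car(1)] by (simp add: cnorm_def)
    then show ?thesis
      using that by (rule cnorm_eq_0)
  qed
  then have R0: "R = 0\<^sub>m n n"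
    using mat_eq_zeroI[OF car(1)] by blast
  have "mat_star H * H = \<Phi> (\<lambda>z. h z * h z)"
    unfolding sH unfolding H_def by (simp add: cfc_mult[OF ch ch])
  also have "(\<lambda>z. h z * h z) = (\<lambda>z. (h z * s z) * s z)"
    by (simp add: ss mult.assoc)
  also have "\<Phi> \<dots> = R * \<Phi> s"
    unfolding R_def by (rule cfc_mult[OF c3 cs])
  also have "\<dots> = 0\<^sub>m n n"
    unfolding R0 using cfc_carrier[OF cs] dim by simp
  finally have H0: "H = 0\<^sub>m n n"
    by (rule gram_eq_zero[OF car(2)])
  define g where "g = (\<lambda>z. complex_of_real (max 0 (Re z)))"
  have cg: "continuous_on S g" for S
    unfolding g_def by (intro continuous_intros)
  have "\<Phi> g = \<Phi> (\<lambda>z. z + h z)"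
  proof (rule cfc_cong)
    fix z
    assume "z \<in> mat_spectrum M"
    then have "Im z = 0"
      by (rule spectrum_real)
    then show "g z = z + h z"
      by (cases "Re z \<ge> 0") (auto simp: g_def h_def complex_eq_iff)
  qed (intro continuous_intros ch cg)+
  also have "\<dots> = M"
    using cfc_add[OF ci ch] carrier H0 by (simp add: cfc_id H_def)
  finally have Mg: "\<Phi> g = M" .
  have "z \<in> complex_of_real ` {0..}" if z: "z \<in> mat_spectrum M" for z
  proof -
    have "0 \<le> Re z"
    proof (rule ccontr)
      assume neg: "\<not> 0 \<le> Re z"
      have nz: "z + - 1 * g w \<noteq> 0" for w
        using neg by (auto simp: g_def complex_eq_iff)
      have ca: "continuous_on S (\<lambda>w. z + - 1 * g w)" for S
        by (intro continuous_intros cg)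
      have cb: "continuous_on S (\<lambda>w. 1 / (z + - 1 * g w))" for S
        using nz by (intro continuous_on_divide continuous_on_const ca) blast
      have "\<Phi> (\<lambda>w. z + - 1 * g w) = mat_scaleC z (1\<^sub>m n) + mat_scaleC (- 1) M"
        using cfc_add[OF continuous_on_const continuous_on_mult[OF continuous_on_const cg], of z "- 1"]
          cfc_scaleC[OF cg, of "- 1"] by (simp add: cfc_const dim Mg)
      also have "\<dots> = mat_scaleC z (1\<^sub>m n) - M"
        by (rule eq_matI) (use carrier in \<open>auto simp: scal_minus simp flip: scal_mult_left\<close>)
      finally have e: "\<Phi> (\<lambda>w. z + - 1 * g w) = mat_scaleC z (1\<^sub>m n) - M" .
      have "\<Phi> (\<lambda>w. z + - 1 * g w) * \<Phi> (\<lambda>w. 1 / (z + - 1 * g w)) = 1\<^sub>m n"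
        "\<Phi> (\<lambda>w. 1 / (z + - 1 * g w)) * \<Phi> (\<lambda>w. z + - 1 * g w) = 1\<^sub>m n"
        unfolding cfc_mult[OF ca cb, symmetric] cfc_mult[OF cb ca, symmetric]
        using nz cfc_one dim by simp_all
      then have "invertible_mat (\<Phi> (\<lambda>w. z + - 1 * g w))"
        using cfc_carrier[OF ca] cfc_carrier[OF cb] unfolding dim by (intro invertible_matI)
      then show False
        using z unfolding e by (simp add: mat_spectrum_def dim)
    qed
    then show ?thesis
      using spectrum_real[OF z] by (intro image_eqI[of _ _ "Re z"]) (auto simp: complex_eq_iff)
  qed
  then show ?thesis
    using carrier n_pos selfadjoint by (auto simp: pos_mat_def positive_mat_def rect_mats_def)
qed

section \<open>Powers of positive matrices\<close>

text \<open>\<open>p k\<close> is within \<open>1 / (k + 1)\<close> of \<open>f\<close> on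
  \<open>[0, k]\<close>, so a single sequence serves every bounded interval.\<close>

lemma real_poly_approx_halfline:
  fixes f :: "real \<Rightarrow> real"
  assumes f: "continuous_on {0..} f"
  shows "\<exists>p. \<forall>M. uniform_limit {0..M} (\<lambda>k. poly (p k)) f sequentially"
proof -
  have "\<exists>p. \<forall>t\<in>{0..real k}. \<bar>f t - poly p t\<bar> < inverse (real (Suc k))" for k
  proof -
    obtain h where "real_polynomial_function h"
      and h: "\<And>t. t \<in> {0..real k} \<Longrightarrow> \<bar>f t - h t\<bar> < inverse (real (Suc k))"
      by (rule Stone_Weierstrass_real_polynomial_function[of "{0..real k}" f "inverse (real (Suc k))"])
        (use continuous_on_subset[OF f, of "{0..real k}"] in auto)
    then obtain a n where an: "h = (\<lambda>x. \<Sum>i\<le>n. a i * x ^ i)"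
      using real_polynomial_function_iff_sum[of h] by auto
    have "poly (\<Sum>i\<le>n. monom (a i) i) = h"
      by (simp add: an poly_sum poly_monom fun_eq_iff)
    then show ?thesis
      using h by metis
  qed
  then obtain p where p: "\<And>k t. t \<in> {0..real k} \<Longrightarrow> \<bar>f t - poly (p k) t\<bar> < inverse (real (Suc k))"
    by metis
  have "uniform_limit {0..M} (\<lambda>k. poly (p k)) f sequentially" for M
  proof (rule uniform_limitI)
    fix e :: real
    assume "e > 0"
    then have "\<forall>\<^sub>F k in sequentially. inverse (real (Suc k)) < e"
      by (rule order_tendstoD(2)[OF LIMSEQ_inverse_real_of_nat])
    moreover have "\<forall>\<^sub>F k in sequentially. M \<le> real k"
      by (rule eventually_sequentiallyI[of "nat \<lceil>M\<rceil>"]) linarith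
    ultimately show "\<forall>\<^sub>F k in sequentially. \<forall>t\<in>{0..M}. dist (poly (p k) t) (f t) < e"
    proof eventually_elim
      case (elim k)
      show ?case
      proof
        fix t
        assume "t \<in> {0..M}"
        then show "dist (poly (p k) t) (f t) < e"
          using p[of t k] elim by (simp add: dist_real_def abs_minus_commute)
      qed
    qed
  qed
  then show ?thesis
    by blast
qed

lemma hcalc_pos_mat:
  assumes "pos_mat n X" "continuous_on {0..} g" "\<And>t. 0 \<le> t \<Longrightarrow> 0 \<le> g t"
  shows "pos_mat n (hcalc X g)"
  using form_pos_imp_pos_mat[OF form_pos_hcalc[OF assms(1,2)]] assms(3) pos_mat_dim(3)[OF assms(1)] by auto

text \<open>Both sides are limits along the same polynomials approximating \<open>f\<close>: since
  \<open>g\<close> maps \<open>[0, M]\<close> into some \<open>[0, B]\<close>, uniform convergence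
  on \<open>[0, B]\<close> gives uniform convergence of the composites on
  \<open>[0, M]\<close>.\<close>

lemma hcalc_compose:
  assumes X: "pos_mat n X" and g: "continuous_on {0..} g" "\<And>t. 0 \<le> t \<Longrightarrow> 0 \<le> g t"
    and f: "continuous_on {0..} f"
  shows "hcalc (hcalc X g) f = hcalc X (\<lambda>t. f (g t))"
proof -
  let ?H = "hcalc X g"
  have H: "pos_mat n ?H"
    by (rule hcalc_pos_mat[OF X g])
  have cp: "continuous_on S (poly p)" for S and p :: "real poly"
    by (intro continuous_intros)
  have cpg: "continuous_on {0..} (\<lambda>t. poly p (g t))" for p
    by (intro continuous_intros g)
  have cfg: "continuous_on {0..} (\<lambda>t. f (g t))"
    by (rule continuous_on_compose2[OF f g(1)]) (use g(2) in auto)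
  have poly: "hcalc ?H (poly p) = hcalc X (\<lambda>t. poly p (g t))" for p
  proof (induction p)
    case 0
    have "poly 0 = (\<lambda>_ :: real. 0)"
      by auto
    then show ?case
      by (simp add: hcalc_const[OF H] hcalc_const[OF X])
  next
    case (pCons c p)
    have e: "poly (pCons c p) = (\<lambda>t. c + t * poly p t)"
      by auto
    have "hcalc ?H (poly (pCons c p)) = hcalc ?H (\<lambda>_. c) + hcalc ?H (\<lambda>t. t * poly p t)"
      unfolding e by (rule hcalc_add[OF H]) (intro continuous_intros)+
    also have "hcalc ?H (\<lambda>t. t * poly p t) = ?H * hcalc X (\<lambda>t. poly p (g t))"
      using hcalc_mult[OF H continuous_on_id cp[of _ p]] by (simp only: hcalc_id[OF H] pCons.IH)
    also have "\<dots> = hcalc X (\<lambda>t. g t * poly p (g t))"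
      by (rule hcalc_mult[OF X g(1) cpg[of p], symmetric])
    also have "hcalc ?H (\<lambda>_. c) = hcalc X (\<lambda>_. c)"
      unfolding hcalc_const[OF X] hcalc_const[OF H] ..
    also have "hcalc X (\<lambda>_. c) + hcalc X (\<lambda>t. g t * poly p (g t)) = hcalc X (\<lambda>t. c + g t * poly p (g t))"
      by (rule hcalc_add[OF X, symmetric]) (intro continuous_intros g)+
    also have "\<dots> = hcalc X (\<lambda>t. poly (pCons c p) (g t))"
      by (simp only: poly_pCons)
    finally show ?case .
  qed
  obtain p where p: "\<And>M. uniform_limit {0..M} (\<lambda>k. poly (p k)) f sequentially"
    using real_poly_approx_halfline[OF f] by blast
  have pg: "uniform_limit {0..M} (\<lambda>k t. poly (p k) (g t)) (\<lambda>t. f (g t)) sequentially" for M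
  proof -
    have "compact (g ` {0..M})"
      by (intro compact_continuous_image continuous_on_subset[OF g(1)]) auto
    then have "bounded (g ` {0..M})"
      by (rule compact_imp_bounded)
    then obtain B where B0: "\<forall>y\<in>g ` {0..M}. norm y \<le> B"
      unfolding bounded_iff by blast
    have B: "g t \<le> B" if "t \<in> {0..M}" for t
      using bspec[OF B0 imageI[OF that]] by simp
    show ?thesis
    proof (rule uniform_limitI)
      fix e :: real
      assume "e > 0"
      from uniform_limitD[OF p[of B] this]
      show "\<forall>\<^sub>F k in sequentially. \<forall>t\<in>{0..M}. dist (poly (p k) (g t)) (f (g t)) < e"
        by (rule eventually_mono) (use B g(2) in auto)
    qed
  qed
  have "mat_tendsto n n (\<lambda>k. hcalc ?H (poly (p k))) (hcalc ?H f)"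
    by (rule hcalc_tendsto[OF H cp f p])
  moreover have "mat_tendsto n n (\<lambda>k. hcalc X (\<lambda>t. poly (p k) (g t))) (hcalc X (\<lambda>t. f (g t)))"
    by (rule hcalc_tendsto[OF X cpg cfg pg])
  ultimately show ?thesis
    unfolding poly using hcalc_carrier[OF H f] hcalc_carrier[OF X cfg] by (rule mat_tendsto_unique)
qed

section \<open>Powers with positive exponents\<close>

lemma continuous_on_powr_halfline: "0 < \<theta> \<Longrightarrow> continuous_on {0..} (\<lambda>t::real. t powr \<theta>)"
  by (intro continuous_on_powr' continuous_intros) auto

lemma mat_powr_carrier: "pos_mat n X \<Longrightarrow> 0 < \<theta> \<Longrightarrow> mat_powr X \<theta> \<in> carrier_mat n n"
  unfolding mat_powr_eq_hcalc by (intro hcalc_carrier continuous_on_powr_halfline)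

lemma mat_powr_star: "pos_mat n X \<Longrightarrow> 0 < \<theta> \<Longrightarrow> mat_star (mat_powr X \<theta>) = mat_powr X \<theta>"
  unfolding mat_powr_eq_hcalc by (intro hcalc_star continuous_on_powr_halfline)

lemma mat_powr_pos_mat: "pos_mat n X \<Longrightarrow> 0 < \<theta> \<Longrightarrow> pos_mat n (mat_powr X \<theta>)"
  unfolding mat_powr_eq_hcalc by (intro hcalc_pos_mat continuous_on_powr_halfline) auto

lemma mat_powr_add:
  assumes "pos_mat n X" "0 < \<alpha>" "0 < \<beta>"
  shows "mat_powr X (\<alpha> + \<beta>) = mat_powr X \<alpha> * mat_powr X \<beta>"
  using hcalc_mult[OF assms(1) continuous_on_powr_halfline[OF assms(2)] continuous_on_powr_halfline[OF assms(3)]]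
  by (simp add: mat_powr_eq_hcalc powr_add)

lemma mat_powr_powr:
  assumes "pos_mat n X" "0 < \<alpha>" "0 < \<beta>"
  shows "mat_powr (mat_powr X \<alpha>) \<beta> = mat_powr X (\<alpha> * \<beta>)"
  using hcalc_compose[OF assms(1) continuous_on_powr_halfline[OF assms(2)] _ continuous_on_powr_halfline[OF assms(3)]]
  by (simp add: mat_powr_eq_hcalc powr_powr)

lemma mat_powr_one:
  assumes "pos_mat n X"
  shows "mat_powr X 1 = X"
proof -
  have "mat_powr X 1 = hcalc X (\<lambda>t. t)"
    unfolding mat_powr_eq_hcalc
    by (rule hcalc_cong[OF assms continuous_on_powr_halfline continuous_on_id]) simp_all
  then show ?thesis
    by (simp add: hcalc_id[OF assms])
qed

lemma form_pos_zero: "form_pos n (0\<^sub>m n n)"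
  using form_pos_gram[of "0\<^sub>m n n" n n] by simp

lemma scaleC_minus_one [simp]: "scaleC (- 1) x = - (x :: 'a::cstar_algebra)"
  using scal_mult_left[of "- 1" x] by (simp add: scal_minus)

section \<open>Entry estimates and Douglas factorization\<close>

lemma hcalc_diag_norm_le:
  assumes X: "pos_mat n X" and h: "continuous_on {0..} h" and b: "\<And>t. 0 \<le> t \<Longrightarrow> 0 \<le> h t \<and> h t \<le> c"
    and j: "j < n"
  shows "norm (hcalc X h $$ (j, j)) \<le> c"
proof -
  have c: "0 \<le> c"
    using b[of 0] by simp
  have ch: "continuous_on {0..} (\<lambda>t. c + (-1) * h t)"
    by (intro continuous_intros h)
  have "form_pos n (hcalc X (\<lambda>t. c + (-1) * h t))"
    by (rule form_pos_hcalc[OF X ch]) (use b in auto)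
  also have "hcalc X (\<lambda>t. c + (-1) * h t) = mat_scaleC (of_real c) (1\<^sub>m n) + mat_scaleC (of_real (-1)) (hcalc X h)"
    using hcalc_add[OF X continuous_on_const continuous_on_mult[OF continuous_on_const h], of c "-1"]
    unfolding hcalc_const[OF X] hcalc_scale[OF X h] .
  finally have "cpos (scaleC (of_real c) 1 + scaleC (-1) (hcalc X h $$ (j, j)))"
    using form_pos_diag[of n _ j] j hcalc_carrier[OF X h] by fastforce
  then have "cpos (of_real c - hcalc X h $$ (j, j))"
    by (simp add: scaleC_of_real flip: of_real_def)
  moreover have "cpos (hcalc X h $$ (j, j))"
    using form_pos_diag[OF form_pos_hcalc[OF X h] j] b by auto
  ultimately have "norm (hcalc X h $$ (j, j)) \<le> norm (of_real c :: 'a)"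
    by (intro norm_mono_cpos)
  then show ?thesis
    using c by simp
qed

text \<open>Write \<open>Q\<close> for \<open>q\<close> at \<open>X\<close>. The Gram matrix of
  \<open>C * Q\<close> is \<open>Q * (mat_star C * C) * Q\<close>, which is at most
  \<open>Q * X * Q\<close>. The latter is the value of \<open>t * (q t)^2\<close> at
  \<open>X\<close>, so a scalar bound for this function bounds all entries of
  \<open>C * Q\<close>.\<close>

lemma dominated_entry_bound:
  assumes X: "pos_mat n X" and C: "C \<in> carrier_mat m n" "form_pos n (X - mat_star C * C)"
    and q: "continuous_on {0..} q" and b: "\<And>t. 0 \<le> t \<Longrightarrow> t * (q t)\<^sup>2 \<le> c\<^sup>2" and c: "0 \<le> c"
    and ij: "i < m" "j < n"
  shows "norm ((C * hcalc X q) $$ (i, j)) \<le> c"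
proof -
  let ?Q = "hcalc X q"
  let ?D = "C * ?Q"
  note Xc = form_pos_carrier[OF pos_mat_form_pos[OF X]]
  note Qc = hcalc_carrier[OF X q]
  have Dc: "?D \<in> carrier_mat m n"
    using C Qc by auto
  have cc: "mat_star C * C \<in> carrier_mat n n"
    using C by auto
  have tq: "continuous_on {0..} (\<lambda>t. t * q t)"
    by (intro continuous_intros q)
  have qtq: "continuous_on {0..} (\<lambda>t. q t * (t * q t))"
    by (intro continuous_intros q)
  have DD: "mat_star ?D * ?D = ?Q * (mat_star C * C * ?Q)"
  proof -
    have "mat_star ?D * ?D = (?Q * mat_star C) * (C * ?Q)"
      using mat_star_mult[OF C(1) Qc] hcalc_star[OF X q] by simp
    also have "\<dots> = ?Q * (mat_star C * (C * ?Q))"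
      by (rule assoc_mult_mat) (use C Qc in auto)
    also have "mat_star C * (C * ?Q) = mat_star C * C * ?Q"
      by (rule assoc_mult_mat[symmetric]) (use C Qc in auto)
    finally show ?thesis .
  qed
  have QXQ: "?Q * (X * ?Q) = hcalc X (\<lambda>t. q t * (t * q t))"
    using hcalc_mult[OF X q tq] hcalc_mult[OF X continuous_on_id q] hcalc_id[OF X] by simp
  have "form_pos n (mat_star ?Q * ((X - mat_star C * C) * ?Q))"
    by (rule form_pos_conj[OF C(2) Qc])
  also have "(X - mat_star C * C) * ?Q = X * ?Q - mat_star C * C * ?Q"
    by (rule minus_mult_distrib_mat[OF Xc cc Qc])
  also have "mat_star ?Q * (X * ?Q - mat_star C * C * ?Q) = ?Q * (X * ?Q) - ?Q * (mat_star C * C * ?Q)"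
    unfolding hcalc_star[OF X q] by (rule mult_minus_distrib_mat) (use Qc Xc cc in auto)
  finally have "cpos ((?Q * (X * ?Q) - mat_star ?D * ?D) $$ (j, j))"
    unfolding DD using form_pos_diag ij by blast
  then have 1: "cpos (hcalc X (\<lambda>t. q t * (t * q t)) $$ (j, j) - (mat_star ?D * ?D) $$ (j, j))"
    unfolding QXQ using Dc C(1) Qc ij hcalc_carrier[OF X qtq] by (simp del: index_mult_mat(1))
  have "(norm (?D $$ (i, j)))\<^sup>2 \<le> norm ((mat_star ?D * ?D) $$ (j, j))"
    by (rule entry_norm_gram[OF Dc ij])
  also have "\<dots> \<le> norm (hcalc X (\<lambda>t. q t * (t * q t)) $$ (j, j))"
    by (rule norm_mono_cpos[OF form_pos_diag[OF form_pos_gram[OF Dc] ij(2)] 1])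
  also have "\<dots> \<le> c\<^sup>2"
    by (rule hcalc_diag_norm_le[OF X qtq _ ij(2)]) (use b in \<open>auto simp: power2_eq_square mult_ac\<close>)
  finally show ?thesis
    using c by (rule power2_le_imp_le)
qed

text \<open>A continuous substitute for \<open>t powr (\<beta> - 1 / 2)\<close>, which is singular
  at 0 for \<open>\<beta> < 1 / 2\<close>.\<close>

definition reg :: "real \<Rightarrow> nat \<Rightarrow> real \<Rightarrow> real" where
  "reg \<beta> k t = t powr (\<beta> + 1 / 2) / (t + inverse (real (Suc k)))"

lemma continuous_on_reg: "0 < \<beta> \<Longrightarrow> continuous_on {0..} (reg \<beta> k)"
  unfolding reg_def
  by (intro continuous_intros continuous_on_powr_halfline) (auto simp: add_nonneg_eq_0_iff)

text \<open>The difference is \<open>t^\<beta> * \<delta> / (t + \<delta>)\<close>, and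
  \<open>t^\<beta> * \<delta>^(1 - \<beta>) \<le> t + \<delta>\<close> because both bases are at
  most \<open>t + \<delta>\<close>. For \<open>\<beta> = 0\<close> the functions
  \<open>t / (t + \<delta>)\<close> would not converge uniformly near 0; this is the origin of the
  loss \<open>\<beta>\<close>.\<close>

lemma reg_error:
  fixes t \<delta> \<beta> :: real
  assumes t: "0 \<le> t" and \<delta>: "0 < \<delta>" and \<beta>: "0 < \<beta>" "\<beta> < 1"
  shows "0 \<le> t powr \<beta> - t powr (1 + \<beta>) / (t + \<delta>)" "t powr \<beta> - t powr (1 + \<beta>) / (t + \<delta>) \<le> \<delta> powr \<beta>"
proof -
  have e: "t powr \<beta> - t powr (1 + \<beta>) / (t + \<delta>) = t powr \<beta> * (\<delta> / (t + \<delta>))"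
    using t \<delta> by (simp add: powr_add field_simps)
  show "0 \<le> t powr \<beta> - t powr (1 + \<beta>) / (t + \<delta>)"
    unfolding e using t \<delta> by simp
  have "t powr \<beta> * (\<delta> powr 1) \<le> \<delta> powr \<beta> * (t + \<delta>)"
  proof -
    have "t powr \<beta> * \<delta> powr (1 - \<beta>) \<le> (t + \<delta>) powr \<beta> * (t + \<delta>) powr (1 - \<beta>)"
      using t \<delta> \<beta> by (intro mult_mono powr_mono2) auto
    also have "\<dots> = t + \<delta>"
      using t \<delta> by (simp flip: powr_add)
    finally have "\<delta> powr \<beta> * (t powr \<beta> * \<delta> powr (1 - \<beta>)) \<le> \<delta> powr \<beta> * (t + \<delta>)"
      by (intro mult_left_mono) auto
    moreover have "\<delta> powr \<beta> * (t powr \<beta> * \<delta> powr (1 - \<beta>)) = t powr \<beta> * \<delta> powr 1"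
      using powr_add[of \<delta> \<beta> "1 - \<beta>"] by (simp add: mult_ac)
    ultimately show ?thesis
      by simp
  qed
  then show "t powr \<beta> - t powr (1 + \<beta>) / (t + \<delta>) \<le> \<delta> powr \<beta>"
    unfolding e using t \<delta> by (simp add: field_simps)
qed

lemma sqrt_mult_reg: "0 \<le> t \<Longrightarrow> sqrt t * reg \<beta> k t = t powr (1 + \<beta>) / (t + inverse (real (Suc k)))"
proof -
  assume t: "0 \<le> t"
  have "sqrt t * t powr (\<beta> + 1 / 2) = t powr (1 / 2 + (\<beta> + 1 / 2))"
    using t by (simp only: powr_half_sqrt[symmetric] powr_add)
  then show ?thesis
    by (simp add: reg_def add.commute)
qed

lemma inverse_Suc_powr_tendsto: "0 < \<beta> \<Longrightarrow> (\<lambda>k. inverse (real (Suc k)) powr \<beta>) \<longlonglongrightarrow> 0"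
  using tendsto_powr'[OF LIMSEQ_inverse_real_of_nat tendsto_const, of \<beta>] by simp

text \<open>A version of Douglas' factorization inside the algebra: \<open>C X\<^sup>\<beta>\<^sup>-\<^sup>1\<^sup>/\<^sup>2\<close> makes sense as the limit of
  \<open>C X\<^sup>\<beta>\<^sup>+\<^sup>1\<^sup>/\<^sup>2 (X + 1/k)\<^sup>-\<^sup>1\<close>.\<close>

lemma douglas_factorization:
  assumes X: "pos_mat n X" and C: "C \<in> carrier_mat m n" "form_pos n (X - mat_star C * C)"
    and \<beta>: "0 < \<beta>" "\<beta> < 1 / 2"
  obtains W where "W \<in> carrier_mat m n" "mat_tendsto m n (\<lambda>k. C * hcalc X (reg \<beta> k)) W"
    "C = W * mat_powr X (1 / 2 - \<beta>)"
proof -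
  note cr = continuous_on_reg[OF \<beta>(1)]
  define d where "d k = inverse (real (Suc k))" for k
  have d: "0 < d k" for k
    by (simp add: d_def)
  have err: "\<bar>sqrt t * reg \<beta> k t - t powr \<beta>\<bar> \<le> d k powr \<beta>" if "0 \<le> t" for t k
    using reg_error[OF that d[of k] \<beta>(1)] \<beta> sqrt_mult_reg[OF that, of \<beta> k] by (simp add: d_def)
  have dlim: "(\<lambda>k. d k powr \<beta>) \<longlonglongrightarrow> 0"
    using inverse_Suc_powr_tendsto[OF \<beta>(1)] by (simp add: d_def)
  \<comment> \<open>\<open>sqrt t * reg \<beta> k t\<close> and
    \<open>sqrt t * reg \<beta> l t\<close> both lie near \<open>t powr \<beta>\<close>. The factor
    \<open>sqrt t\<close> is exactly what \<open>dominated_entry_bound\<close> supplies.\<close>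
  have cd: "norm ((C * hcalc X (reg \<beta> k)) $$ (i, j) - (C * hcalc X (reg \<beta> l)) $$ (i, j)) \<le> d k powr \<beta> + d l powr \<beta>"
    if ij: "i < m" "j < n" for i j k l
  proof -
    let ?q = "\<lambda>t. reg \<beta> k t + (-1) * reg \<beta> l t"
    have cq: "continuous_on {0..} ?q"
      by (intro continuous_intros cr)
    have "t * (?q t)\<^sup>2 \<le> (d k powr \<beta> + d l powr \<beta>)\<^sup>2" if t: "0 \<le> t" for t
    proof -
      have "\<bar>sqrt t * ?q t\<bar> \<le> d k powr \<beta> + d l powr \<beta>"
        using err[OF t, of k] err[OF t, of l] by (simp add: right_diff_distrib)
      then have "(sqrt t * ?q t)\<^sup>2 \<le> (d k powr \<beta> + d l powr \<beta>)\<^sup>2"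
        by (rule power2_le_iff_abs_le[THEN iffD2, rotated]) simp
      then show ?thesis
        using t by (simp add: power_mult_distrib)
    qed
    then have "norm ((C * hcalc X ?q) $$ (i, j)) \<le> d k powr \<beta> + d l powr \<beta>"
      by (intro dominated_entry_bound[OF X C cq _ _ ij]) auto
    also have "hcalc X ?q = hcalc X (reg \<beta> k) - hcalc X (reg \<beta> l)"
      unfolding hcalc_add[OF X cr continuous_on_mult[OF continuous_on_const cr]] hcalc_scale[OF X cr]
      using hcalc_carrier[OF X cr, of k] hcalc_carrier[OF X cr, of l]
      by (intro eq_matI) (auto simp: scal_minus simp flip: scal_mult_left)
    also have "C * (hcalc X (reg \<beta> k) - hcalc X (reg \<beta> l)) = C * hcalc X (reg \<beta> k) - C * hcalc X (reg \<beta> l)"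
      by (rule mult_minus_distrib_mat[OF C(1) hcalc_carrier[OF X cr] hcalc_carrier[OF X cr]])
    finally show ?thesis
      using ij C(1) hcalc_carrier[OF X cr, of l] by (simp del: index_mult_mat(1))
  qed
  have conv: "convergent (\<lambda>k. (C * hcalc X (reg \<beta> k)) $$ (i, j))" if ij: "i < m" "j < n" for i j
    unfolding Cauchy_convergent_iff[symmetric]
  proof (rule metric_CauchyI)
    fix e :: real
    assume "e > 0"
    then have "\<forall>\<^sub>F k in sequentially. d k powr \<beta> < e / 2"
      by (intro order_tendstoD(2)[OF dlim]) simp
    then obtain N where N: "\<And>k. k \<ge> N \<Longrightarrow> d k powr \<beta> < e / 2"
      by (auto simp: eventually_sequentially)
    have "dist ((C * hcalc X (reg \<beta> k)) $$ (i, j)) ((C * hcalc X (reg \<beta> l)) $$ (i, j)) < e" if "k \<ge> N" "l \<ge> N" for k l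
      using cd[OF ij, of k l] N[OF that(1)] N[OF that(2)] unfolding dist_norm by linarith
    then show "\<exists>M. \<forall>k\<ge>M. \<forall>l\<ge>M. dist ((C * hcalc X (reg \<beta> k)) $$ (i, j)) ((C * hcalc X (reg \<beta> l)) $$ (i, j)) < e"
      by blast
  qed
  define W where "W = mat m n (\<lambda>(i, j). lim (\<lambda>k. (C * hcalc X (reg \<beta> k)) $$ (i, j)))"
  have W: "W \<in> carrier_mat m n"
    by (simp add: W_def)
  have lim: "mat_tendsto m n (\<lambda>k. C * hcalc X (reg \<beta> k)) W"
    using conv by (simp add: mat_tendsto_def W_def convergent_LIMSEQ_iff)
  let ?P = "mat_powr X (1 / 2 - \<beta>)"
  have p: "0 < 1 / 2 - \<beta>"
    using \<beta> by simp
  note cp = continuous_on_powr_halfline[OF p]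
  have Pc: "?P \<in> carrier_mat n n"
    by (rule mat_powr_carrier[OF X p])
  have "mat_tendsto m n (\<lambda>k. C * hcalc X (reg \<beta> k) * ?P) (W * ?P)"
    by (rule mat_tendsto_mult[OF lim mat_tendsto_const])
      (use W Pc C(1) hcalc_carrier[OF X cr] in auto)
  moreover have "mat_tendsto m n (\<lambda>k. C * hcalc X (reg \<beta> k) * ?P) C"
    unfolding mat_tendsto_def
  proof (intro allI impI)
    fix i j
    assume ij: "i < m" "j < n"
    \<comment> \<open>Here \<open>?q t = - d k / (t + d k)\<close>, and
      \<open>t * (?q t)^2 \<le> d k\<close>. So the approximants times the power of \<open>X\<close>
      return to \<open>C\<close> at rate \<open>sqrt (d k)\<close>.\<close>
    have b: "norm ((C * hcalc X (reg \<beta> k) * ?P) $$ (i, j) - C $$ (i, j)) \<le> sqrt (d k)" for k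
    proof -
      let ?r = "\<lambda>t. reg \<beta> k t * t powr (1 / 2 - \<beta>)"
      let ?q = "\<lambda>t. ?r t + (-1)"
      have ce: "continuous_on {0..} ?r" and cq: "continuous_on {0..} ?q"
        by (intro continuous_intros cr cp)+
      have "t * (?q t)\<^sup>2 \<le> (sqrt (d k))\<^sup>2" if t: "0 \<le> t" for t
      proof (cases "t = 0")
        case False
        then have t0: "0 < t"
          using t by simp
        have "t powr (\<beta> + 1 / 2) * t powr (1 / 2 - \<beta>) = t powr 1"
          unfolding powr_add[symmetric] by simp
        then have "?r t = t / (t + d k)"
          using t0 by (simp only: reg_def d_def times_divide_eq_left powr_one)
        then have q: "?q t = - (d k / (t + d k))"
          using t0 d[of k] by (simp only:) (simp add: field_simps)
        have "t * (d k)\<^sup>2 \<le> d k * (t + d k)\<^sup>2"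
        proof -
          have "d k * (t * d k) \<le> d k * (t + d k)\<^sup>2"
            using t0 d[of k] by (intro mult_left_mono) (auto simp: power2_eq_square algebra_simps)
          then show ?thesis
            by (simp add: power2_eq_square mult_ac)
        qed
        then show ?thesis
          unfolding q using t0 d[of k] by (simp add: power_divide field_simps)
      qed (use d[of k] in simp)
      then have "norm ((C * hcalc X ?q) $$ (i, j)) \<le> sqrt (d k)"
        using d[of k] by (intro dominated_entry_bound[OF X C cq _ _ ij]) auto
      also have "hcalc X ?q = hcalc X (reg \<beta> k) * ?P - 1\<^sub>m n"
        unfolding hcalc_add[OF X ce continuous_on_const] hcalc_const[OF X] hcalc_mult[OF X cr cp]
          mat_powr_eq_hcalc
        using hcalc_carrier[OF X cr, of k] hcalc_carrier[OF X cp]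
        by (intro eq_matI) (auto simp: scal_minus simp flip: scal_mult_left)
      also have "C * (hcalc X (reg \<beta> k) * ?P - 1\<^sub>m n) = C * (hcalc X (reg \<beta> k) * ?P) - C * 1\<^sub>m n"
        by (rule mult_minus_distrib_mat[OF C(1) mult_carrier_mat[OF hcalc_carrier[OF X cr] Pc] one_carrier_mat])
      also have "C * (hcalc X (reg \<beta> k) * ?P) = C * hcalc X (reg \<beta> k) * ?P"
        by (rule assoc_mult_mat[symmetric, OF C(1) hcalc_carrier[OF X cr] Pc])
      finally show ?thesis
        using ij C(1) Pc by (simp del: index_mult_mat(1))
    qed
    have "(\<lambda>k. sqrt (d k)) \<longlonglongrightarrow> sqrt 0"
      unfolding d_def by (intro tendsto_real_sqrt LIMSEQ_inverse_real_of_nat)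
    then have "(\<lambda>k. sqrt (d k)) \<longlonglongrightarrow> 0"
      by (simp only: real_sqrt_zero)
    then have "(\<lambda>k. (C * hcalc X (reg \<beta> k) * ?P) $$ (i, j) - C $$ (i, j)) \<longlonglongrightarrow> 0"
      by (rule Lim_null_comparison[OF always_eventually[OF allI[OF b]]])
    then show "(\<lambda>k. (C * hcalc X (reg \<beta> k) * ?P) $$ (i, j)) \<longlonglongrightarrow> C $$ (i, j)"
      by (simp only: LIM_zero_iff)
  qed
  ultimately have "W * ?P = C"
    by (rule mat_tendsto_unique) (use W Pc C(1) in auto)
  then show ?thesis
    using that W lim by blast
qed

section \<open>The Loewner--Heinz inequality with a loss\<close>

lemma hcalc_resolvent:
  assumes X: "pos_mat n X" and l: "0 < l"
  defines "r \<equiv> \<lambda>t. 1 / (t + l)"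
  shows "continuous_on {0..} r" "(X + mat_scaleC (of_real l) (1\<^sub>m n)) * hcalc X r = 1\<^sub>m n"
    "hcalc X r * (X + mat_scaleC (of_real l) (1\<^sub>m n)) = 1\<^sub>m n"
proof -
  show cr: "continuous_on {0..} r"
    unfolding r_def using l by (intro continuous_intros) (auto simp: add_nonneg_eq_0_iff)
  have cl: "continuous_on {0..} (\<lambda>t. t + l)"
    by (intro continuous_intros)
  have e: "X + mat_scaleC (of_real l) (1\<^sub>m n) = hcalc X (\<lambda>t. t + l)"
    unfolding hcalc_add[OF X continuous_on_id continuous_on_const] hcalc_id[OF X] hcalc_const[OF X] ..
  have one: "hcalc X (\<lambda>_. 1) = 1\<^sub>m n"
    using hcalc_const[OF X, of 1] by simp
  have "hcalc X (\<lambda>t. (t + l) * r t) = 1\<^sub>m n"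
    unfolding one[symmetric]
    by (rule hcalc_cong[OF X continuous_on_mult[OF cl cr] continuous_on_const]) (use l in \<open>simp add: r_def\<close>)
  moreover have "hcalc X (\<lambda>t. r t * (t + l)) = 1\<^sub>m n"
    unfolding one[symmetric]
    by (rule hcalc_cong[OF X continuous_on_mult[OF cr cl] continuous_on_const]) (use l in \<open>simp add: r_def\<close>)
  ultimately show "(X + mat_scaleC (of_real l) (1\<^sub>m n)) * hcalc X r = 1\<^sub>m n"
    "hcalc X r * (X + mat_scaleC (of_real l) (1\<^sub>m n)) = 1\<^sub>m n"
    unfolding e by (simp_all only: hcalc_mult[OF X cl cr] hcalc_mult[OF X cr cl])
qed

text \<open>With \<open>R = (B + l)\<^sup>-\<^sup>1\<close>, \<open>S = (A + l)\<^sup>-\<^sup>1\<close> and \<open>E = A - B\<close> one has \<open>R - S = S E R = R E S\<close>, hence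
  \<open>R - S = S E S + (E S)\<^sup>* R (E S)\<close>.\<close>

lemma resolvent_antimono:
  assumes A: "pos_mat n A" and B: "pos_mat n B" and AB: "form_pos n (A - B)" and l: "0 < l"
  shows "form_pos n (hcalc B (\<lambda>t. 1 / (t + l)) - hcalc A (\<lambda>t. 1 / (t + l)))"
proof -
  let ?r = "\<lambda>t. 1 / (t + l)"
  define R where "R = hcalc B ?r"
  define S where "S = hcalc A ?r"
  define E where "E = A - B"
  let ?A = "A + mat_scaleC (of_real l) (1\<^sub>m n)" and ?B = "B + mat_scaleC (of_real l) (1\<^sub>m n)"
  note cr = hcalc_resolvent(1)[OF A l]
  have car: "A \<in> carrier_mat n n" "B \<in> carrier_mat n n" "R \<in> carrier_mat n n" "S \<in> carrier_mat n n"
    "E \<in> carrier_mat n n" "?A \<in> carrier_mat n n" "?B \<in> carrier_mat n n"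
    using A B hcalc_carrier[OF A cr] hcalc_carrier[OF B cr] by (auto simp: pos_mat_def R_def S_def E_def)
  have SA: "S * ?A = 1\<^sub>m n" "?A * S = 1\<^sub>m n" and RB: "R * ?B = 1\<^sub>m n" "?B * R = 1\<^sub>m n"
    using hcalc_resolvent[OF A l] hcalc_resolvent[OF B l] by (simp_all add: R_def S_def)
  have E: "E = ?A - ?B"
    unfolding E_def using car by (intro eq_matI) auto
  have "E * R = ?A * R - ?B * R"
    unfolding E by (rule minus_mult_distrib_mat) (use car in auto)
  then have ER: "E * R = ?A * R - 1\<^sub>m n"
    unfolding RB(2) .
  have "E * S = ?A * S - ?B * S"
    unfolding E by (rule minus_mult_distrib_mat) (use car in auto)
  then have ES: "E * S = 1\<^sub>m n - ?B * S"
    unfolding SA(2) .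
  have "S * (E * R) = S * (?A * R) - S * 1\<^sub>m n"
    unfolding ER by (rule mult_minus_distrib_mat) (use car in auto)
  also have "S * (?A * R) = S * ?A * R"
    by (rule assoc_mult_mat[symmetric]) (use car in auto)
  finally have SER: "S * (E * R) = R - S"
    using car by (simp add: SA)
  have "R * (E * S) = R * 1\<^sub>m n - R * (?B * S)"
    unfolding ES by (rule mult_minus_distrib_mat) (use car in auto)
  also have "R * (?B * S) = R * ?B * S"
    by (rule assoc_mult_mat[symmetric]) (use car in auto)
  finally have RES: "R * (E * S) = R - S"
    using car by (simp add: RB)
  have star: "mat_star (E * S) = S * E"
    using mat_star_mult[OF car(5,4)] hcalc_star[OF A cr] form_pos_selfadjoint[OF AB]
    by (simp add: S_def E_def)
  have "mat_star (E * S) * (R * (E * S)) = S * E * (R * (E * S))"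
    unfolding star ..
  also have "\<dots> = S * (E * (R * (E * S)))"
    by (rule assoc_mult_mat) (use car in auto)
  also have "E * (R * (E * S)) = E * R * (E * S)"
    by (rule assoc_mult_mat[symmetric]) (use car in auto)
  also have "S * (E * R * (E * S)) = S * (E * R) * (E * S)"
    by (rule assoc_mult_mat[symmetric]) (use car in auto)
  also have "\<dots> = R * (E * S) - S * (E * S)"
    unfolding SER by (rule minus_mult_distrib_mat) (use car in auto)
  finally have 2: "mat_star (E * S) * (R * (E * S)) = R - S - S * (E * S)"
    unfolding RES .
  have "form_pos n R"
    unfolding R_def by (rule form_pos_hcalc[OF B cr]) (use l in auto)
  then have "form_pos n (mat_star (E * S) * (R * (E * S)))"
    by (rule form_pos_conj) (use car in auto)
  moreover have "form_pos n (mat_star S * (E * S))"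
    by (rule form_pos_conj) (use car AB in \<open>auto simp: E_def\<close>)
  then have "form_pos n (S * (E * S))"
    using hcalc_star[OF A cr] by (simp add: S_def)
  ultimately have "form_pos n (R - S - S * (E * S) + S * (E * S))"
    unfolding 2 by (rule form_pos_add)
  also have "R - S - S * (E * S) + S * (E * S) = R - S"
  proof -
    have "S * (E * S) \<in> carrier_mat n n"
      using car by auto
    then show ?thesis
      using car by (intro eq_matI) (auto simp del: index_mult_mat(1))
  qed
  finally show ?thesis
    by (simp add: R_def S_def)
qed

text \<open>\<open>t / (t + l) = 1 - l * (1 / (t + l))\<close>, so this is
  \<open>resolvent_antimono\<close> scaled by \<open>l\<close>.\<close>

lemma frac_mono:
  assumes A: "pos_mat n A" and B: "pos_mat n B" and AB: "form_pos n (A - B)" and l: "0 < l"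
  shows "form_pos n (hcalc A (\<lambda>t. t / (t + l)) - hcalc B (\<lambda>t. t / (t + l)))"
proof -
  let ?r = "\<lambda>t. 1 / (t + l)"
  note cr = hcalc_resolvent(1)[OF A l]
  have cf: "continuous_on {0..} (\<lambda>t. t / (t + l))"
    using l by (intro continuous_intros) (auto simp: add_nonneg_eq_0_iff)
  have f: "hcalc X (\<lambda>t. t / (t + l)) = 1\<^sub>m n + mat_scaleC (of_real (- l)) (hcalc X ?r)" if X: "pos_mat n X" for X :: "'a mat"
  proof -
    have "hcalc X (\<lambda>t. t / (t + l)) = hcalc X (\<lambda>t. 1 + (- l) * ?r t)"
      by (rule hcalc_cong[OF X cf continuous_on_add[OF continuous_on_const continuous_on_mult[OF continuous_on_const cr]]])
        (use l in \<open>simp add: field_simps\<close>)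
    then show ?thesis
      unfolding hcalc_add[OF X continuous_on_const continuous_on_mult[OF continuous_on_const cr]]
        hcalc_scale[OF X cr] hcalc_const[OF X] by simp
  qed
  have "hcalc A (\<lambda>t. t / (t + l)) - hcalc B (\<lambda>t. t / (t + l)) = mat_scaleC (of_real l) (hcalc B ?r - hcalc A ?r)"
    unfolding f[OF A] f[OF B] using hcalc_carrier[OF A cr] hcalc_carrier[OF B cr]
    by (intro eq_matI) (auto simp: scal_minus algebra_simps simp flip: scal_mult_left)
  then show ?thesis
    using form_pos_scale[OF resolvent_antimono[OF A B AB l], of l] l by simp
qed

text \<open>Since only ranks matter, the Loewner--Heinz inequality is needed only up to a constant and an
  arbitrarily small loss in the exponent, for which the integral representation of \<open>t\<^sup>s\<close> may be
  replaced by the finite sums \<open>\<Sum>\<^sub>k l\<^sub>k\<^sup>s t / (t + l\<^sub>k)\<close> with \<open>l\<^sub>k = M / 2\<^sup>k\<close>.\<close>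

definition heinz_sum :: "real \<Rightarrow> real \<Rightarrow> nat \<Rightarrow> real \<Rightarrow> real" where
  "heinz_sum M s K t = (\<Sum>k<K. (M / 2 ^ k) powr s * (t / (t + M / 2 ^ k)))"

lemma continuous_on_heinz_sum: "1 \<le> M \<Longrightarrow> continuous_on {0..} (heinz_sum M s K)"
  unfolding heinz_sum_def
  by (intro continuous_intros) (auto simp: add_nonneg_eq_0_iff)

lemma heinz_sum_nonneg: "1 \<le> M \<Longrightarrow> 0 \<le> t \<Longrightarrow> 0 \<le> heinz_sum M s K t"
  unfolding heinz_sum_def by (intro sum_nonneg) auto

text \<open>Going down the points \<open>M / 2 ^ k\<close>, either \<open>t\<close> still lies below
  the current point \<open>l\<close>, or some earlier point satisfied
  \<open>l / 2 < t \<le> l\<close>. The term of that point is at least \<open>t powr s / 3\<close>,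
  because \<open>l powr s \<ge> t powr s\<close> and \<open>l \<le> 2 * t\<close> gives
  \<open>t / (t + l) \<ge> 1 / 3\<close>. The additive term covers all \<open>t\<close> below the
  last point.\<close>

lemma heinz_sum_lower:
  assumes M: "1 \<le> M" and s: "0 < s" and t: "0 \<le> t" "t \<le> M"
  shows "t powr s / 3 \<le> heinz_sum M s K t + (M / 2 ^ K) powr s"
proof -
  have "t \<le> M / 2 ^ K \<or> t powr s / 3 \<le> heinz_sum M s K t"
  proof (induction K)
    case (Suc K)
    let ?l = "M / 2 ^ K"
    have l: "0 < ?l"
      using M by simp
    have S: "heinz_sum M s (Suc K) t = heinz_sum M s K t + ?l powr s * (t / (t + ?l))"
      by (simp add: heinz_sum_def)
    have nn: "0 \<le> ?l powr s * (t / (t + ?l))"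
      using t l by simp
    from Suc.IH show ?case
    proof
      assume tl: "t \<le> ?l"
      show ?thesis
      proof (cases "t \<le> M / 2 ^ Suc K")
        case False
        moreover have "0 < M / 2 ^ Suc K"
          using M by simp
        ultimately have t2: "?l \<le> 2 * t" "0 < t"
          by simp_all
        have "t powr s * (1 / 3) \<le> ?l powr s * (t / (t + ?l))"
          using tl t2 l s t by (intro mult_mono powr_mono2) (auto simp: field_simps)
        then show ?thesis
          unfolding S using heinz_sum_nonneg[OF M t(1), of s K] by simp
      qed simp
    next
      assume "t powr s / 3 \<le> heinz_sum M s K t"
      then have "t powr s / 3 \<le> heinz_sum M s (Suc K) t"
        unfolding S using nn by linarith
      then show ?thesis
        by blast
    qed
  qed (use t in simp)
  then show ?thesis
  proof
    assume "t \<le> M / 2 ^ K"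
    then have "t powr s \<le> (M / 2 ^ K) powr s"
      using t s by (intro powr_mono2) auto
    then show ?thesis
      using heinz_sum_nonneg[OF M t(1), of s K] powr_ge_zero[of t s] by linarith
  qed (use powr_ge_zero[of "M / 2 ^ K" s] in linarith)
qed

text \<open>A number in \<open>[0, 1]\<close> is at most its power \<open>s' \<le> 1\<close>, so
  \<open>l^s * t / (t + l) \<le> l^(s - s') * t^s'\<close>. Along \<open>l = M / 2 ^ k\<close> the
  weights \<open>l^(s - s')\<close> form a geometric series with ratio \<open>q < 1\<close>, which
  is why the exponent must drop strictly.\<close>

lemma heinz_sum_upper:
  assumes M: "1 \<le> M" and s: "0 < s'" "s' < s" "s \<le> 1"
  shows "\<exists>c>0. \<forall>K. \<forall>t\<ge>0. heinz_sum M s K t \<le> c * t powr s'"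
proof -
  define d where "d = s - s'"
  have d: "0 < d"
    using s by (simp add: d_def)
  define q where "q = (1 / 2 :: real) powr d"
  have q: "0 \<le> q" "q < 1"
    using d powr_less_mono2[of d "1 / 2" 1] by (simp_all add: q_def)
  have summand: "l powr s * (t / (t + l)) \<le> l powr d * t powr s'" if l: "0 < l" and t: "0 \<le> t" for l t :: real
  proof (cases "t = 0")
    case False
    then have t0: "0 < t"
      using t by simp
    have "t / (t + l) \<le> (t / (t + l)) powr s'"
      using powr_mono'[of s' 1 "t / (t + l)"] t0 l s by simp
    also have "\<dots> \<le> (t / l) powr s'"
      using t0 l s by (intro powr_mono2) (auto simp: field_simps)
    finally have "l powr s * (t / (t + l)) \<le> l powr s * (t / l) powr s'"
      by (intro mult_left_mono) auto
    also have "\<dots> = l powr d * t powr s'"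
      using t0 l by (simp add: powr_divide d_def powr_diff)
    finally show ?thesis .
  qed simp
  let ?c = "M powr d * (1 / (1 - q))"
  have "heinz_sum M s K t \<le> ?c * t powr s'" if t: "0 \<le> t" for K t
  proof -
    have "heinz_sum M s K t \<le> (\<Sum>k<K. (M / 2 ^ k) powr d * t powr s')"
      unfolding heinz_sum_def using M t by (intro sum_mono summand) auto
    also have "\<dots> = (\<Sum>k<K. M powr d * q ^ k * t powr s')"
    proof (rule sum.cong)
      fix k
      have "M / 2 ^ k = M * (1 / 2) ^ k"
        by (simp add: power_one_over)
      then have "(M / 2 ^ k) powr d = M powr d * ((1 / 2) ^ k) powr d"
        by (simp only: powr_mult)
      also have "((1 / 2 :: real) ^ k) powr d = q ^ k"
        unfolding q_def by (induction k) (simp_all only: power_0 power_Suc powr_one_eq_one powr_mult)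
      finally show "(M / 2 ^ k) powr d * t powr s' = M powr d * q ^ k * t powr s'"
        by simp
    qed simp
    also have "\<dots> = M powr d * (\<Sum>k<K. q ^ k) * t powr s'"
      by (simp add: sum_distrib_left sum_distrib_right)
    also have "(\<Sum>k<K. q ^ k) \<le> 1 / (1 - q)"
    proof -
      have "(\<Sum>k<K. q ^ k) = (1 - q ^ K) / (1 - q)"
        using q by (simp add: sum_gp_strict)
      also have "\<dots> \<le> 1 / (1 - q)"
        using q by (intro divide_right_mono) auto
      finally show ?thesis .
    qed
    finally show ?thesis
      by (simp add: mult_left_mono mult_right_mono)
  qed
  moreover have "0 < ?c"
    using M q by simp
  ultimately show ?thesis
    by blast
qed

lemma heinz_sum_mono:
  assumes A: "pos_mat n A" and B: "pos_mat n B" and AB: "form_pos n (A - B)" and M: "1 \<le> M"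
  shows "form_pos n (hcalc A (heinz_sum M s K) - hcalc B (heinz_sum M s K))"
proof (induction K)
  case 0
  have "heinz_sum M s 0 = (\<lambda>_. 0)"
    by (simp add: heinz_sum_def fun_eq_iff)
  then have "hcalc A (heinz_sum M s 0) - hcalc B (heinz_sum M s 0) = 0\<^sub>m n n"
    by (simp add: hcalc_const[OF A] hcalc_const[OF B])
  then show ?case
    by (simp add: form_pos_zero)
next
  case (Suc K)
  let ?l = "M / 2 ^ K"
  let ?w = "?l powr s"
  let ?f = "\<lambda>t. t / (t + ?l)"
  have l: "0 < ?l"
    using M by simp
  note ch = continuous_on_heinz_sum[OF M, of s K]
  have cf: "continuous_on {0..} ?f"
    using l by (intro continuous_intros) (auto simp: add_nonneg_eq_0_iff)
  have S: "heinz_sum M s (Suc K) = (\<lambda>t. heinz_sum M s K t + ?w * ?f t)"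
    by (simp add: heinz_sum_def fun_eq_iff)
  have e: "hcalc X (heinz_sum M s (Suc K)) = hcalc X (heinz_sum M s K) + mat_scaleC (of_real ?w) (hcalc X ?f)"
    if X: "pos_mat n X" for X :: "'a mat"
    unfolding S hcalc_add[OF X ch continuous_on_mult[OF continuous_on_const cf]] hcalc_scale[OF X cf] ..
  have "hcalc A (heinz_sum M s (Suc K)) - hcalc B (heinz_sum M s (Suc K))
      = (hcalc A (heinz_sum M s K) - hcalc B (heinz_sum M s K)) + mat_scaleC (of_real ?w) (hcalc A ?f - hcalc B ?f)"
    unfolding e[OF A] e[OF B]
    using hcalc_carrier[OF A ch] hcalc_carrier[OF B ch] hcalc_carrier[OF A cf] hcalc_carrier[OF B cf]
    by (intro eq_matI) (auto simp: right_diff_distrib simp flip: scal_mult_left)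
  then show ?case
    using form_pos_add[OF Suc.IH form_pos_scale[OF frac_mono[OF A B AB l], of ?w]] by simp
qed

text \<open>With \<open>h = heinz_sum M s K\<close>, where \<open>M\<close> bounds the spectrum of
  \<open>B\<close>, one has
  \<open>B^s / 3 \<le> h(B) + e K \<le> h(A) + e K \<le> c A^s' + e K\<close>. Here \<open>c\<close>
  does not depend on \<open>K\<close> and \<open>e K\<close> tends to 0. The constant of the
  conclusion is \<open>1 / (3 * c)\<close>.\<close>

lemma loewner_heinz_lossy:
  assumes A: "pos_mat n A" and B: "pos_mat n B" and AB: "form_pos n (A - B)"
    and s: "0 < s'" "s' < s" "s \<le> 1"
  shows "\<exists>c>0. form_pos n (mat_powr A s' - mat_scaleC (of_real c) (mat_powr B s))"
proof -
  obtain M where M: "1 \<le> M" and Mb: "\<And>z. z \<in> mat_spectrum B \<Longrightarrow> Re z \<le> M"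
    using spectrum_bounded[OF B] by blast
  obtain c where c: "0 < c" and up: "\<And>K t. 0 \<le> t \<Longrightarrow> heinz_sum M s K t \<le> c * t powr s'"
    using heinz_sum_upper[OF M s] by blast
  have s0: "0 < s"
    using s by simp
  note cs = continuous_on_powr_halfline[OF s0] and cs' = continuous_on_powr_halfline[OF s(1)]
  define e where "e K = (M / 2 ^ K) powr s" for K
  let ?PA = "mat_powr A s'" and ?PB = "mat_powr B s"
  have car: "?PA \<in> carrier_mat n n" "?PB \<in> carrier_mat n n"
    by (rule mat_powr_carrier[OF A s(1)] mat_powr_carrier[OF B s0])+
  have main: "form_pos n (mat_scaleC (of_real c) ?PA - mat_scaleC (of_real (1 / 3)) ?PB + mat_scaleC (of_real (e K)) (1\<^sub>m n))" for K
  proof -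
    let ?g = "heinz_sum M s K"
    note cg = continuous_on_heinz_sum[OF M, of s K]
    note gc = hcalc_carrier[OF A cg] hcalc_carrier[OF B cg]
    have cA: "continuous_on {0..} (\<lambda>t. c * t powr s' + (-1) * ?g t)"
      by (intro continuous_intros cg cs')
    have "form_pos n (hcalc A (\<lambda>t. c * t powr s' + (-1) * ?g t))"
      by (rule form_pos_hcalc[OF A cA]) (use up in simp)
    also have "hcalc A (\<lambda>t. c * t powr s' + (-1) * ?g t)
        = mat_scaleC (of_real c) ?PA + mat_scaleC (of_real (-1)) (hcalc A ?g)"
      unfolding hcalc_add[OF A continuous_on_mult[OF continuous_on_const cs'] continuous_on_mult[OF continuous_on_const cg]]
        hcalc_scale[OF A cs'] hcalc_scale[OF A cg] mat_powr_eq_hcalc ..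
    finally have 1: "form_pos n (mat_scaleC (of_real c) ?PA + mat_scaleC (of_real (-1)) (hcalc A ?g))" .
    have cB1: "continuous_on {0..} (\<lambda>t. ?g t + e K)" and cB: "continuous_on {0..} (\<lambda>t. (?g t + e K) + (- (1 / 3)) * t powr s)"
      by (intro continuous_intros cg cs)+
    have "form_pos n (hcalc B (\<lambda>t. (?g t + e K) + (- (1 / 3)) * t powr s))"
    proof (rule form_pos_hcalc[OF B cB])
      fix t :: real
      assume "0 \<le> t" "complex_of_real t \<in> mat_spectrum B"
      then show "0 \<le> (?g t + e K) + (- (1 / 3)) * t powr s"
        using heinz_sum_lower[OF M s0, of t K] Mb[of "of_real t"] by (simp add: e_def)
    qed
    also have "hcalc B (\<lambda>t. (?g t + e K) + (- (1 / 3)) * t powr s)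
        = (hcalc B ?g + mat_scaleC (of_real (e K)) (1\<^sub>m n)) + mat_scaleC (of_real (- (1 / 3))) ?PB"
      unfolding hcalc_add[OF B cB1 continuous_on_mult[OF continuous_on_const cs]]
        hcalc_add[OF B cg continuous_on_const] hcalc_scale[OF B cs] hcalc_const[OF B] mat_powr_eq_hcalc ..
    finally have 2: "form_pos n ((hcalc B ?g + mat_scaleC (of_real (e K)) (1\<^sub>m n)) + mat_scaleC (of_real (- (1 / 3))) ?PB)" .
    have "form_pos n ((mat_scaleC (of_real c) ?PA + mat_scaleC (of_real (-1)) (hcalc A ?g))
       + ((hcalc A ?g - hcalc B ?g)
       + ((hcalc B ?g + mat_scaleC (of_real (e K)) (1\<^sub>m n)) + mat_scaleC (of_real (- (1 / 3))) ?PB)))"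
      by (intro form_pos_add 1 2 heinz_sum_mono[OF A B AB M])
    also have "\<dots> = mat_scaleC (of_real c) ?PA - mat_scaleC (of_real (1 / 3)) ?PB + mat_scaleC (of_real (e K)) (1\<^sub>m n)"
      using car gc by (intro eq_matI) (auto simp: scal_minus algebra_simps simp flip: scal_mult_left)
    finally show ?thesis .
  qed
  have "(\<lambda>K. M * (1 / 2) ^ K) \<longlonglongrightarrow> M * 0"
    by (intro tendsto_mult tendsto_const LIMSEQ_power_zero) simp
  moreover have "(\<lambda>K. M * (1 / 2) ^ K) = (\<lambda>K. M / 2 ^ K)"
    by (simp add: power_one_over fun_eq_iff)
  ultimately have "(\<lambda>K. M / 2 ^ K) \<longlonglongrightarrow> 0"
    by simp
  then have e0: "e \<longlonglongrightarrow> 0"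
    unfolding e_def using tendsto_powr'[of "\<lambda>K. M / 2 ^ K" 0 sequentially "\<lambda>_. s" s] s0 M by simp
  have "mat_tendsto n n (\<lambda>K. mat_scaleC (of_real c) ?PA - mat_scaleC (of_real (1 / 3)) ?PB + mat_scaleC (of_real (e K)) (1\<^sub>m n))
      (mat_scaleC (of_real c) ?PA - mat_scaleC (of_real (1 / 3)) ?PB)"
    unfolding mat_tendsto_def
  proof (intro allI impI)
    fix i j
    assume ij: "i < n" "j < n"
    let ?x = "(mat_scaleC (of_real c) ?PA - mat_scaleC (of_real (1 / 3)) ?PB) $$ (i, j)"
    have "(\<lambda>K. ?x + e K *\<^sub>R (1\<^sub>m n $$ (i, j))) \<longlonglongrightarrow> ?x + 0 *\<^sub>R (1\<^sub>m n $$ (i, j))"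
      by (intro tendsto_intros e0)
    then show "(\<lambda>K. (mat_scaleC (of_real c) ?PA - mat_scaleC (of_real (1 / 3)) ?PB + mat_scaleC (of_real (e K)) (1\<^sub>m n)) $$ (i, j)) \<longlonglongrightarrow> ?x"
      using ij car by (simp add: scaleC_of_real)
  qed
  then have "form_pos n (mat_scaleC (of_real c) ?PA - mat_scaleC (of_real (1 / 3)) ?PB)"
    by (rule form_pos_tendsto[OF _ main]) (use car in auto)
  then have "form_pos n (mat_scaleC (of_real (1 / c)) (mat_scaleC (of_real c) ?PA - mat_scaleC (of_real (1 / 3)) ?PB))"
    by (rule form_pos_scale) (use c in simp)
  also have "\<dots> = ?PA - mat_scaleC (of_real (1 / (3 * c))) ?PB"
    using car c by (intro eq_matI)
      (auto simp: right_diff_distrib mult.commute simp flip: scal_mult_left scal_mult mult.assoc)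
  finally show ?thesis
    using c by (intro exI[of _ "1 / (3 * c)"]) auto
qed

section \<open>Rank functions\<close>

context sylvester_rank_function
begin

lemma rk_mult_le:
  assumes "A \<in> carrier_mat n m" "B \<in> carrier_mat m k" "0 < n" "0 < m" "0 < k"
  shows "rk (A * B) \<le> rk A" "rk (A * B) \<le> rk B"
  using rk_mult[of A B] assms by (auto simp: rect_mats_def)

lemma rk_le_one:
  assumes "A \<in> carrier_mat n n" "0 < n"
  shows "rk A \<le> rk (1\<^sub>m n)"
  using rk_mult_le(2)[of A n n "1\<^sub>m n" n] assms by simp

text \<open>Block elimination: \<open>[1, 0; A, 1] * diag(B, A B C) * [C, 1; -1, 0] =
  [B C, B; 0, A B]\<close>. The rank of the triangular right side is bounded below by
  \<open>rk_upper\<close>, that of the left side above by the rank of its middle factor.\<close>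

lemma frobenius:
  assumes A: "A \<in> carrier_mat n n" and B: "B \<in> carrier_mat n n" and C: "C \<in> carrier_mat n n" and n: "0 < n"
  shows "rk (A * B) + rk (B * C) \<le> rk (A * B * C) + rk B"
proof -
  let ?I = "1\<^sub>m n" and ?O = "0\<^sub>m n n"
  let ?L = "four_block_mat ?I ?O A ?I"
  let ?D = "four_block_mat B ?O ?O (A * B * C)"
  let ?R = "four_block_mat C ?I (- ?I) ?O"
  have car: "A * B \<in> carrier_mat n n" "B * C \<in> carrier_mat n n" "A * B * C \<in> carrier_mat n n"
    "- ?I \<in> carrier_mat n n"
    using A B C by auto
  have neg: "A * B * C * (- ?I) = - (A * B * C)"
    using uminus_mult_right_mat[of "A * B * C" ?I] right_mult_one_mat[OF car(3)] car by auto
  have "M + - M = ?O" if "M \<in> carrier_mat n n" for M :: "'a mat"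
    using that by (intro eq_matI) auto
  note canc = this[OF car(3)]
  have neg0: "- ?O = (?O :: 'a mat)"
    by (rule eq_matI) auto
  have LD: "?L * ?D = four_block_mat B ?O (A * B) (A * B * C)"
    using A B C car
    by (subst mult_four_block_mat[of _ n n _ n _ n _ _ n _ n]) (simp_all del: assoc_mult_mat)
  have LDR: "?L * ?D * ?R = four_block_mat (B * C) B ?O (A * B)"
    unfolding LD using A B C car
    by (subst mult_four_block_mat[of _ n n _ n _ n _ _ n _ n]) 
      (simp_all add: neg neg0 canc del: assoc_mult_mat)
  have c2: "?L \<in> carrier_mat (n + n) (n + n)" "?D \<in> carrier_mat (n + n) (n + n)" "?R \<in> carrier_mat (n + n) (n + n)"
    by (rule four_block_carrier_mat[OF one_carrier_mat one_carrier_mat]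
        four_block_carrier_mat[OF B car(3)] four_block_carrier_mat[OF C zero_carrier_mat])+
  have rect: "M \<in> rect_mats" if "M \<in> carrier_mat n n" for M :: "'a mat"
    using that n by (auto simp: rect_mats_def)
  have dims: "dim_row M = n" "dim_col M = n" if "M \<in> carrier_mat n n" for M :: "'a mat"
    using that by auto
  have "rk (B * C) + rk (A * B) \<le> rk (?L * ?D * ?R)"
    using rk_upper[OF rect[OF car(2)] rect[OF car(1)], of B] B
    by (simp only: LDR dims[OF car(1)] dims[OF car(2)])
  also have "\<dots> \<le> rk (?L * ?D)"
    by (rule rk_mult_le(1)[OF mult_carrier_mat[OF c2(1,2)] c2(3)]) (use n in auto)
  also have "\<dots> \<le> rk ?D"
    by (rule rk_mult_le(2)[OF c2(1,2)]) (use n in auto)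
  also have "\<dots> = rk B + rk (A * B * C)"
    using rk_diag[OF rect[OF B] rect[OF car(3)]] by (simp only: dims[OF B] dims[OF car(3)])
  finally show ?thesis
    by simp
qed

end

text \<open>\<open>S\<close> is the limit of \<open>f\<close> at 0. By \<open>diff\<close> the drop
  of \<open>f\<close> over an interval of length \<open>s\<close> can only grow when the interval is
  moved towards 0, and inside \<open>(0, d]\<close> it is at most
  \<open>S - f d < e\<close>.\<close>

lemma uniformly_continuous_on_halfline:
  fixes f :: "real \<Rightarrow> real"
  assumes bdd: "\<And>x. 0 < x \<Longrightarrow> f x \<le> K" and anti: "\<And>x y. 0 < x \<Longrightarrow> x \<le> y \<Longrightarrow> f y \<le> f x"
    and diff: "\<And>x y s. 0 < x \<Longrightarrow> x \<le> y \<Longrightarrow> 0 < s \<Longrightarrow> f y - f (y + s) \<le> f x - f (x + s)"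
  shows "uniformly_continuous_on {0<..} f"
  unfolding uniformly_continuous_on_def
proof (intro allI impI)
  fix e :: real
  assume e: "e > 0"
  define S where "S = Sup (f ` {0<..})"
  have bd: "bdd_above (f ` {0<..})"
    using bdd by (intro bdd_aboveI[of _ K]) auto
  have fS: "f x \<le> S" if "0 < x" for x
    unfolding S_def using bd that by (intro cSup_upper) auto
  have "\<exists>y\<in>f ` {0<..}. S - e < y"
    using e less_cSup_iff[OF _ bd, of "S - e"] by (auto simp: S_def)
  then obtain d where d: "0 < d" "S - e < f d"
    by auto
  have main: "\<bar>f x - f y\<bar> < e" if x: "0 < x" "x < y" "y - x < d" for x y
  proof -
    define s where "s = y - x"
    \<comment> \<open>The interval \<open>[x, x + s]\<close> is moved left just far enough to end at
      or before \<open>d\<close>; since \<open>s < d\<close>, it still starts to the right of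
      0.\<close>
    define t where "t = min x (d - s)"
    have s: "0 < s" and t: "0 < t" "t \<le> x" "t + s \<le> d"
      using x by (auto simp: s_def t_def)
    have "f x - f (x + s) \<le> f t - f (t + s)"
      by (rule diff[OF t(1,2) s])
    also have "\<dots> \<le> S - f d"
      using fS[OF t(1)] anti[of "t + s" d] t s by (intro diff_mono) auto
    finally show ?thesis
      using d anti[of x y] x by (simp add: s_def)
  qed
  have "dist (f y) (f x) < e" if "0 < x" "0 < y" "dist y x < d" for x y
    using main[of x y] main[of y x] that e by (cases x y rule: linorder_cases) (auto simp: dist_real_def)
  then show "\<exists>d>0. \<forall>x\<in>{0<..}. \<forall>x'\<in>{0<..}. dist x' x < d \<longrightarrow> dist (f x') (f x) < e"
    using d by auto
qed

lemma bounded_image_halfline: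
  fixes f :: "real \<Rightarrow> real"
  assumes "continuous_on {0..} f"
  shows "bounded (f ` {0..M})"
  by (intro compact_imp_bounded compact_continuous_image continuous_on_subset[OF assms]) auto

lemma uniform_limit_reg:
  assumes \<beta>: "0 < \<beta>" "\<beta> < 1"
  shows "uniform_limit {0..M} (\<lambda>k t. sqrt t * reg \<beta> k t) (\<lambda>t. t powr \<beta>) sequentially"
proof (rule uniform_limitI)
  fix e :: real
  assume "e > 0"
  then have "\<forall>\<^sub>F k in sequentially. inverse (real (Suc k)) powr \<beta> < e"
    by (rule order_tendstoD(2)[OF inverse_Suc_powr_tendsto[OF \<beta>(1)]])
  then show "\<forall>\<^sub>F k in sequentially. \<forall>t\<in>{0..M}. dist (sqrt t * reg \<beta> k t) (t powr \<beta>) < e"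
  proof eventually_elim
    case (elim k)
    have "0 < inverse (real (Suc k))"
      by simp
    note err = reg_error[OF _ this \<beta>]
    show ?case
    proof
      fix t
      assume t: "t \<in> {0..M}"
      then show "dist (sqrt t * reg \<beta> k t) (t powr \<beta>) < e"
        using err[of t] elim by (simp add: sqrt_mult_reg dist_real_def abs_minus_commute)
    qed
  qed
qed

locale cstar_rank = sylvester_rank_function rk for rk :: "'a::cstar_algebra mat \<Rightarrow> real"
begin

lemma rk_powr_uniformly_continuous:
  assumes X: "pos_mat n X"
  shows "uniformly_continuous_on {0<..} (\<lambda>\<theta>. rk (mat_powr X \<theta>))"
proof (rule uniformly_continuous_on_halfline)
  have n: "0 < n"
    by (rule pos_mat_dim(3)[OF X])
  note car = mat_powr_carrier[OF X]
  show "rk (mat_powr X x) \<le> rk (1\<^sub>m n)" if "0 < x" for x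
    using car[OF that] n by (rule rk_le_one)
  show "rk (mat_powr X y) \<le> rk (mat_powr X x)" if "0 < x" "x \<le> y" for x y
  proof (cases "x = y")
    case False
    then have "mat_powr X y = mat_powr X x * mat_powr X (y - x)"
      using mat_powr_add[OF X, of x "y - x"] that by simp
    then show ?thesis
      using rk_mult_le(1)[OF car car n n n, of x "y - x"] that False by simp
  qed simp
  show "rk (mat_powr X y) - rk (mat_powr X (y + s)) \<le> rk (mat_powr X x) - rk (mat_powr X (x + s))"
    if "0 < x" "x \<le> y" "0 < s" for x y s
  proof (cases "x = y")
    case False
    define d where "d = y - x"
    have d: "0 < d" "y = d + x"
      using that False by (auto simp: d_def)
    have "rk (mat_powr X d * mat_powr X x) + rk (mat_powr X x * mat_powr X s)
        \<le> rk (mat_powr X d * mat_powr X x * mat_powr X s) + rk (mat_powr X x)"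
      by (rule frobenius[OF car[OF d(1)] car[OF that(1)] car[OF that(3)] n])
    then show ?thesis
      using that d mat_powr_add[OF X, of d x] mat_powr_add[OF X, of x s] mat_powr_add[OF X, of "d + x" s]
      by simp
  qed simp
qed

text \<open>The slope \<open>c\<close> may have either sign, so the same lemma removes losses on
  both sides of the exponent.\<close>

lemma rk_powr_tendsto:
  assumes X: "pos_mat n X" and \<theta>: "0 < \<theta>"
  shows "((\<lambda>\<beta>. rk (mat_powr X (\<theta> + c * \<beta>))) \<longlongrightarrow> rk (mat_powr X \<theta>)) (at_right 0)"
proof -
  have "isCont (\<lambda>\<theta>. rk (mat_powr X \<theta>)) \<theta>"
    using uniformly_continuous_imp_continuous[OF rk_powr_uniformly_continuous[OF X]] \<theta>
    by (simp add: continuous_on_eq_continuous_at)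
  moreover have "((\<lambda>\<beta>. \<theta> + c * \<beta>) \<longlongrightarrow> \<theta>) (at_right 0)"
    by (auto intro!: tendsto_eq_intros)
  ultimately show ?thesis
    by (rule isCont_tendsto_compose)
qed

lemma rk_powr_lower_limit:
  assumes "pos_mat n X" "0 < \<theta>" "0 < b" "\<And>\<beta>. 0 < \<beta> \<Longrightarrow> \<beta> < b \<Longrightarrow> r \<le> rk (mat_powr X (\<theta> + c * \<beta>))"
  shows "r \<le> rk (mat_powr X \<theta>)"
  by (rule tendsto_lowerbound[OF rk_powr_tendsto[OF assms(1,2), of c]])
    (use assms(3,4) in \<open>auto simp: eventually_at_right_field\<close>)

lemma rk_powr_upper_limit:
  assumes "pos_mat n X" "0 < \<theta>" "0 < b" "\<And>\<beta>. 0 < \<beta> \<Longrightarrow> \<beta> < b \<Longrightarrow> rk (mat_powr X (\<theta> + c * \<beta>)) \<le> r"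
  shows "rk (mat_powr X \<theta>) \<le> r"
  by (rule tendsto_upperbound[OF rk_powr_tendsto[OF assms(1,2), of c]])
    (use assms(3,4) in \<open>auto simp: eventually_at_right_field\<close>)

lemma gram_pos_mat:
  assumes "A \<in> carrier_mat m n" "0 < n"
  shows "pos_mat n (mat_star A * A)"
  using form_pos_imp_pos_mat[OF form_pos_gram[OF assms(1)] assms(2)] .

lemma cogram_pos_mat:
  assumes "A \<in> carrier_mat m n" "0 < m"
  shows "pos_mat m (A * mat_star A)"
  using gram_pos_mat[of "mat_star A" n m] assms by simp

text \<open>Given a polar decomposition \<open>A = U |A|\<close> in the algebra, \<open>W\<close>
  would be \<open>U |A|^(2 \<beta>)\<close> and the three identities would be immediate. Here
  \<open>W\<close> comes from \<open>douglas_factorization\<close> with \<open>C = A\<close>, where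
  the domination is an equality, and the last two identities are limits of identities for the
  approximants \<open>A * hcalc (mat_star A * A) (reg \<beta> k)\<close>.\<close>

lemma almost_polar:
  assumes A: "A \<in> carrier_mat m n" and n: "0 < n" and m: "0 < m" and \<beta>: "0 < \<beta>" "\<beta> < 1 / 2"
  obtains W where "W \<in> carrier_mat m n" "A = W * mat_powr (mat_star A * A) (1 / 2 - \<beta>)"
    "mat_star W * A = mat_powr (mat_star A * A) (1 / 2 + \<beta>)"
    "\<And>s. 0 < s \<Longrightarrow> W * mat_powr (mat_star A * A) s * mat_star W = mat_powr (A * mat_star A) (s + 2 * \<beta>)"
proof -
  let ?X = "mat_star A * A" and ?Y = "A * mat_star A"
  have X: "pos_mat n ?X" and Y: "pos_mat m ?Y"
    using gram_pos_mat[OF A n] cogram_pos_mat[OF A m] .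
  have Xc: "?X \<in> carrier_mat n n" and Yc: "?Y \<in> carrier_mat m m" and Ac: "mat_star A \<in> carrier_mat n m"
    using A by auto
  have "form_pos n (?X - ?X)"
    using form_pos_zero[of n] Xc by (simp add: minus_r_inv_mat[of _ n n])
  from douglas_factorization[OF X A this \<beta>] obtain W where W: "W \<in> carrier_mat m n"
    and lim: "mat_tendsto m n (\<lambda>k. A * hcalc ?X (reg \<beta> k)) W"
    and fac: "A = W * mat_powr ?X (1 / 2 - \<beta>)"
    by blast
  note cr = continuous_on_reg[OF \<beta>(1)]
  let ?G = "\<lambda>k. hcalc ?X (reg \<beta> k)"
  have Gc: "?G k \<in> carrier_mat n n" and Gs: "mat_star (?G k) = ?G k" for k
    by (rule hcalc_carrier[OF X cr], rule hcalc_star[OF X cr])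
  have AG: "A * ?G k \<in> carrier_mat m n" and AGs: "mat_star (A * ?G k) = ?G k * mat_star A" for k
    using A Gc[of k] mat_star_mult[OF A Gc] Gs by auto
  have Wlim: "mat_tendsto n m (\<lambda>k. ?G k * mat_star A) (mat_star W)"
    using mat_tendsto_star[OF lim AG W] unfolding AGs .
  have \<beta>1: "\<beta> < 1"
    using \<beta> by simp
  note cs = continuous_on_real_sqrt[OF continuous_on_id, of "{0..}"]
  note cb = continuous_on_powr_halfline[OF \<beta>(1)]
  have p: "0 < 1 / 2 + \<beta>"
    using \<beta> by simp
  have "mat_star W * A = mat_powr ?X (1 / 2 + \<beta>)"
  proof (rule mat_tendsto_unique)
    show "mat_tendsto n n (\<lambda>k. ?G k * mat_star A * A) (mat_star W * A)"
      by (rule mat_tendsto_mult[OF Wlim mat_tendsto_const mult_carrier_mat[OF Gc Ac] A mat_star_carrier[OF W] A])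
    have e: "?G k * mat_star A * A = hcalc ?X (\<lambda>t. reg \<beta> k t * t)" for k
      using assoc_mult_mat[OF Gc Ac A, of k] hcalc_mult[OF X cr continuous_on_id, of k]
      by (simp add: hcalc_id[OF X])
    \<comment> \<open>\<open>reg\<close> by itself does not converge uniformly near 0. Here, and in
      the second identity below, each occurrence is paired with a factor \<open>sqrt t\<close> split
      off from \<open>t\<close>.\<close>
    have u: "uniform_limit {0..M} (\<lambda>k t. reg \<beta> k t * t) (\<lambda>t. t powr (1 / 2 + \<beta>)) sequentially" for M
    proof -
      have "uniform_limit {0..M} (\<lambda>k t. sqrt t * (sqrt t * reg \<beta> k t)) (\<lambda>t. sqrt t * t powr \<beta>) sequentially"
        by (rule uniform_lim_mult[OF uniform_limit_const uniform_limit_reg[OF \<beta>(1) \<beta>1]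
              bounded_image_halfline[OF cs] bounded_image_halfline[OF cb]])
      then show ?thesis
      proof (rule uniform_limit_cong'[THEN iffD1, rotated -1])
        fix t k
        assume t: "t \<in> {0..M}"
        have "sqrt t * (sqrt t * reg \<beta> k t) = reg \<beta> k t * (sqrt t * sqrt t)"
          by (simp only: mult_ac)
        then show "sqrt t * (sqrt t * reg \<beta> k t) = reg \<beta> k t * t"
          using t by simp
        show "sqrt t * t powr \<beta> = t powr (1 / 2 + \<beta>)"
          using t by (simp add: powr_add powr_half_sqrt)
      qed
    qed
    show "mat_tendsto n n (\<lambda>k. ?G k * mat_star A * A) (mat_powr ?X (1 / 2 + \<beta>))"
      unfolding e mat_powr_eq_hcalc
      by (rule hcalc_tendsto[OF X continuous_on_mult[OF cr continuous_on_id] continuous_on_powr_halfline[OF p] u])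
  qed (use A W mat_powr_carrier[OF X p] in auto)
  moreover have "W * mat_powr ?X s * mat_star W = mat_powr ?Y (s + 2 * \<beta>)" if s: "0 < s" for s
  proof (rule mat_tendsto_unique)
    let ?P = "mat_powr ?X s"
    have Pc: "?P \<in> carrier_mat n n"
      by (rule mat_powr_carrier[OF X s])
    note cp = continuous_on_powr_halfline[OF s]
    have s2: "0 < s + 2 * \<beta>"
      using s \<beta> by simp
    have "mat_tendsto m n (\<lambda>k. A * ?G k * ?P) (W * ?P)"
      by (rule mat_tendsto_mult[OF lim mat_tendsto_const AG Pc W Pc])
    then show "mat_tendsto m m (\<lambda>k. A * ?G k * ?P * (?G k * mat_star A)) (W * ?P * mat_star W)"
      by (rule mat_tendsto_mult[OF _ Wlim mult_carrier_mat[OF AG Pc] mult_carrier_mat[OF Gc Ac]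
            mult_carrier_mat[OF W Pc] mat_star_carrier[OF W]])
    let ?h = "\<lambda>k t. reg \<beta> k t * t powr s * reg \<beta> k t"
    have c1: "continuous_on {0..} (\<lambda>t. reg \<beta> k t * t powr s)" and ch: "continuous_on {0..} (?h k)"
      and cht: "continuous_on {0..} (\<lambda>t. ?h k t * t)" for k
      by (intro continuous_on_mult continuous_on_id cr cp)+
    have e: "A * ?G k * ?P * (?G k * mat_star A) = hcalc ?Y (\<lambda>t. ?h k t * t)" for k
    proof -
      have "A * ?G k * ?P * (?G k * mat_star A) = A * (?G k * ?P) * (?G k * mat_star A)"
        by (simp only: assoc_mult_mat[OF A Gc Pc])
      also have "\<dots> = A * (?G k * ?P) * ?G k * mat_star A"
        by (rule assoc_mult_mat[symmetric]) (use A Gc Pc Ac in \<open>auto intro!: mult_carrier_mat\<close>)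
      also have "A * (?G k * ?P) * ?G k = A * (?G k * ?P * ?G k)"
        by (rule assoc_mult_mat) (use A Gc Pc Ac in \<open>auto intro!: mult_carrier_mat\<close>)
      also have "?G k * ?P * ?G k = hcalc ?X (?h k)"
        unfolding mat_powr_eq_hcalc hcalc_mult[OF X c1 cr] hcalc_mult[OF X cr cp] ..
      \<comment> \<open>Moving \<open>A\<close> to the right makes it meet
        \<open>mat_star A\<close>, which supplies the missing factor \<open>t\<close> as
        \<open>?Y\<close>.\<close>
      also have "A * hcalc ?X (?h k) = hcalc ?Y (?h k) * A"
        by (rule hcalc_intertwine[OF X Y A _ ch]) (rule assoc_mult_mat[symmetric, OF A Ac A])
      also have "hcalc ?Y (?h k) * A * mat_star A = hcalc ?Y (?h k) * ?Y"
        by (rule assoc_mult_mat[OF hcalc_carrier[OF Y ch] A Ac])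
      also have "\<dots> = hcalc ?Y (\<lambda>t. ?h k t * t)"
        using hcalc_mult[OF Y ch continuous_on_id, of k] by (simp add: hcalc_id[OF Y])
      finally show ?thesis .
    qed
    have u: "uniform_limit {0..M} (\<lambda>k t. ?h k t * t) (\<lambda>t. t powr (s + 2 * \<beta>)) sequentially" for M
    proof -
      note ur = uniform_limit_reg[OF \<beta>(1) \<beta>1, of M]
      have "uniform_limit {0..M} (\<lambda>k t. (sqrt t * reg \<beta> k t) * (sqrt t * reg \<beta> k t)) (\<lambda>t. t powr \<beta> * t powr \<beta>) sequentially"
        by (rule uniform_lim_mult[OF ur ur bounded_image_halfline[OF cb] bounded_image_halfline[OF cb]])
      from uniform_lim_mult[OF uniform_limit_const this bounded_image_halfline[OF cp]
          bounded_image_halfline[OF continuous_on_mult[OF cb cb]]]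
      have "uniform_limit {0..M} (\<lambda>k t. t powr s * ((sqrt t * reg \<beta> k t) * (sqrt t * reg \<beta> k t)))
          (\<lambda>t. t powr s * (t powr \<beta> * t powr \<beta>)) sequentially" .
      then show ?thesis
      proof (rule uniform_limit_cong'[THEN iffD1, rotated -1])
        fix t k
        assume t: "t \<in> {0..M}"
        have "t powr s * ((sqrt t * reg \<beta> k t) * (sqrt t * reg \<beta> k t)) = ?h k t * (sqrt t * sqrt t)"
          by (simp only: mult_ac)
        then show "t powr s * ((sqrt t * reg \<beta> k t) * (sqrt t * reg \<beta> k t)) = ?h k t * t"
          using t by simp
      qed (simp only: mult_2 powr_add)
    qed
    show "mat_tendsto m m (\<lambda>k. A * ?G k * ?P * (?G k * mat_star A)) (mat_powr ?Y (s + 2 * \<beta>))"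
      unfolding e unfolding mat_powr_eq_hcalc
      by (rule hcalc_tendsto[OF Y cht continuous_on_powr_halfline[OF s2] u])
  qed (use W mat_powr_carrier[OF X s] mat_powr_carrier[OF Y, of "s + 2 * \<beta>"] s \<beta> in \<open>auto intro!: mult_carrier_mat\<close>)
  ultimately show ?thesis
    using that W fac by blast
qed

text \<open>With \<open>X = mat_star A * A\<close>, the identities
  \<open>A = W * X^(1/2 - \<beta>)\<close> and \<open>mat_star W * A = X^(1/2 + \<beta>)\<close>
  bound \<open>rk A\<close> from above and below by ranks of powers of \<open>X\<close>; both
  exponents tend to 1/2.\<close>

lemma rk_gram_sqrt:
  assumes A: "A \<in> carrier_mat m n" and n: "0 < n" and m: "0 < m"
  shows "rk A = rk (mat_powr (mat_star A * A) (1 / 2))"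
proof (rule antisym)
  let ?X = "mat_star A * A"
  have X: "pos_mat n ?X"
    by (rule gram_pos_mat[OF A n])
  show "rk A \<le> rk (mat_powr ?X (1 / 2))"
  proof (rule rk_powr_lower_limit[OF X, of _ "1 / 2" _ "-1"])
    fix \<beta> :: real
    assume \<beta>: "0 < \<beta>" "\<beta> < 1 / 2"
    obtain W where W: "W \<in> carrier_mat m n" "A = W * mat_powr ?X (1 / 2 - \<beta>)"
      using almost_polar[OF A n m \<beta>] by blast
    have "rk (W * mat_powr ?X (1 / 2 - \<beta>)) \<le> rk (mat_powr ?X (1 / 2 - \<beta>))"
      using \<beta> by (intro rk_mult_le(2)[OF W(1) _ m n n] mat_powr_carrier[OF X]) simp
    then show "rk A \<le> rk (mat_powr ?X (1 / 2 + -1 * \<beta>))"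
      using W(2) by simp
  qed auto
  show "rk (mat_powr ?X (1 / 2)) \<le> rk A"
  proof (rule rk_powr_upper_limit[OF X, of _ "1 / 2" 1])
    fix \<beta> :: real
    assume \<beta>: "0 < \<beta>" "\<beta> < 1 / 2"
    obtain W where W: "W \<in> carrier_mat m n" "mat_star W * A = mat_powr ?X (1 / 2 + \<beta>)"
      using almost_polar[OF A n m \<beta>] by blast
    have "rk (mat_star W * A) \<le> rk A"
      by (rule rk_mult_le(2)[OF mat_star_carrier[OF W(1)] A n m n])
    then show "rk (mat_powr ?X (1 / 2 + 1 * \<beta>)) \<le> rk A"
      unfolding W(2) by simp
  qed auto
qed

lemma rk_conj_le:
  assumes "W \<in> carrier_mat m n" "Z \<in> carrier_mat n n" "0 < n" "0 < m"
  shows "rk (W * Z * mat_star W) \<le> rk Z"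
proof -
  have "rk (W * Z * mat_star W) \<le> rk (W * Z)"
    using assms by (intro rk_mult_le(1)[of _ m n _ m]) auto
  also have "\<dots> \<le> rk Z"
    using assms by (intro rk_mult_le(2)[of _ m n _ n]) auto
  finally show ?thesis .
qed

text \<open>\<open>almost_polar\<close> writes the power \<open>s + 2 * \<beta>\<close> of
  \<open>A * mat_star A\<close> as a conjugate by \<open>W\<close> of the power \<open>s\<close> of
  \<open>mat_star A * A\<close>; then \<open>\<beta>\<close> tends to 0. The reverse inequality is
  the same statement for \<open>mat_star A\<close>.\<close>

lemma rk_cogram_powr_le:
  assumes A: "A \<in> carrier_mat m n" and n: "0 < n" and m: "0 < m" and s: "0 < s"
  shows "rk (mat_powr (A * mat_star A) s) \<le> rk (mat_powr (mat_star A * A) s)"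
proof (rule rk_powr_upper_limit[OF cogram_pos_mat[OF A m] s, of "1 / 2" 2])
  fix \<beta> :: real
  assume \<beta>: "0 < \<beta>" "\<beta> < 1 / 2"
  obtain W where W: "W \<in> carrier_mat m n"
    "W * mat_powr (mat_star A * A) s * mat_star W = mat_powr (A * mat_star A) (s + 2 * \<beta>)"
    using almost_polar[OF A n m \<beta>] s by blast
  show "rk (mat_powr (A * mat_star A) (s + 2 * \<beta>)) \<le> rk (mat_powr (mat_star A * A) s)"
    unfolding W(2)[symmetric] by (rule rk_conj_le[OF W(1) mat_powr_carrier[OF gram_pos_mat[OF A n] s] n m])
qed simp

lemma rk_gram_powr:
  assumes A: "A \<in> carrier_mat m n" and n: "0 < n" and m: "0 < m" and s: "0 < s"
  shows "rk (mat_powr (mat_star A * A) s) = rk (mat_powr (A * mat_star A) s)"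
  using rk_cogram_powr_le[OF A n m s] rk_cogram_powr_le[OF mat_star_carrier[OF A] m n s] by simp

section \<open>Monotonicity of the rank of powers\<close>

lemma rk_powr_le_lossy:
  assumes A: "pos_mat n A" and B: "pos_mat n B" and AB: "form_pos n (A - B)"
    and s: "0 < s'" "s' < s" "s \<le> 1" and \<beta>: "0 < \<beta>" "\<beta> < 1 / 2"
  shows "rk (mat_powr B (2 * s)) \<le> rk (mat_powr A (s' * (2 - 4 * \<beta>)))"
proof -
  have n: "0 < n"
    by (rule pos_mat_dim(3)[OF A])
  have s0: "0 < s" "0 < s / 2"
    using s by auto
  obtain c where c: "0 < c" and dom: "form_pos n (mat_powr A s' - mat_scaleC (of_real c) (mat_powr B s))"
    using loewner_heinz_lossy[OF A B AB s] by blast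
  let ?Q = "mat_powr A s'"
  have Q: "pos_mat n ?Q"
    by (rule mat_powr_pos_mat[OF A s(1)])
  define C where "C = hcalc B (\<lambda>t. sqrt c * t powr (s / 2))"
  have cC: "continuous_on {0..} (\<lambda>t. sqrt c * t powr (s / 2))"
    by (intro continuous_on_mult continuous_on_const continuous_on_powr_halfline[OF s0(2)])
  have Cc: "C \<in> carrier_mat n n" and Cs: "mat_star C = C"
    unfolding C_def by (rule hcalc_carrier[OF B cC], rule hcalc_star[OF B cC])
  have CC: "C * C = mat_scaleC (of_real c) (mat_powr B s)"
  proof -
    have "(\<lambda>t. (sqrt c * t powr (s / 2)) * (sqrt c * t powr (s / 2))) = (\<lambda>t. c * t powr s)"
    proof
      fix t :: real
      have "(sqrt c * t powr (s / 2)) * (sqrt c * t powr (s / 2)) = (sqrt c * sqrt c) * t powr (s / 2 + s / 2)"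
        by (simp only: powr_add mult_ac)
      then show "(sqrt c * t powr (s / 2)) * (sqrt c * t powr (s / 2)) = c * t powr s"
        using c by simp
    qed
    then show ?thesis
      unfolding C_def hcalc_mult[OF B cC cC, symmetric]
      using hcalc_scale[OF B continuous_on_powr_halfline[OF s0(1)], of c] by (simp add: mat_powr_eq_hcalc)
  qed
  have "form_pos n (?Q - mat_star C * C)"
    using dom unfolding Cs CC .
  from douglas_factorization[OF Q Cc this \<beta>] obtain W where W: "W \<in> carrier_mat n n"
    and fac: "C = W * mat_powr ?Q (1 / 2 - \<beta>)"
    by blast
  have p: "0 < 1 / 2 - \<beta>" "0 < 1 - 2 * \<beta>" "0 < 2 - 4 * \<beta>"
    using \<beta> by auto
  let ?D = "mat_powr ?Q (1 / 2 - \<beta>)" and ?D2 = "mat_powr ?Q (1 - 2 * \<beta>)" and ?D4 = "mat_powr ?Q (2 - 4 * \<beta>)"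
  have D: "?D \<in> carrier_mat n n" "?D2 \<in> carrier_mat n n" "?D4 \<in> carrier_mat n n"
    using mat_powr_carrier[OF Q] p by blast+
  have DD: "?D * ?D = ?D2" "?D2 * ?D2 = ?D4"
    using mat_powr_add[OF Q p(1) p(1)] mat_powr_add[OF Q p(2) p(2)] by simp_all
  have Ws: "mat_star W \<in> carrier_mat n n"
    using W by simp
  define G where "G = W * ?D2"
  have G: "G \<in> carrier_mat n n"
    using W D by (simp add: G_def)
  have Gs: "mat_star G = ?D2 * mat_star W"
    unfolding G_def mat_star_mult[OF W D(2)] mat_powr_star[OF Q p(2)] ..
  have C2: "C * C = W * ?D2 * mat_star W"
  proof -
    have "C * C = C * mat_star C"
      unfolding Cs ..
    also have "\<dots> = W * ?D * (?D * mat_star W)"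
      unfolding fac mat_star_mult[OF W D(1)] mat_powr_star[OF Q p(1)] ..
    also have "\<dots> = W * ?D * ?D * mat_star W"
      by (rule assoc_mult_mat[symmetric]) (use W D Ws in \<open>auto intro!: mult_carrier_mat\<close>)
    also have "W * ?D * ?D = W * ?D2"
      unfolding DD(1)[symmetric] by (rule assoc_mult_mat[OF W D(1) D(1)])
    finally show ?thesis .
  qed
  have CCc: "C * C \<in> carrier_mat n n"
    using Cc by auto
  have c4: "(C * C) * (C * C) = mat_scaleC (of_real (c * c)) (mat_powr B (2 * s))"
  proof -
    have cs: "continuous_on {0..} (\<lambda>t. c * t powr s)"
      by (intro continuous_on_mult continuous_on_const continuous_on_powr_halfline[OF s0(1)])
    have s2: "0 < 2 * s"
      using s0 by simp
    have "C * C = hcalc B (\<lambda>t. c * t powr s)"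
      unfolding CC hcalc_scale[OF B continuous_on_powr_halfline[OF s0(1)]] mat_powr_eq_hcalc ..
    then have "(C * C) * (C * C) = hcalc B (\<lambda>t. (c * t powr s) * (c * t powr s))"
      unfolding hcalc_mult[OF B cs cs] by simp
    also have "(\<lambda>t. (c * t powr s) * (c * t powr s)) = (\<lambda>t. (c * c) * t powr (2 * s))"
    proof
      fix t :: real
      have "(c * t powr s) * (c * t powr s) = (c * c) * (t powr s * t powr s)"
        by (simp only: mult_ac)
      then show "(c * t powr s) * (c * t powr s) = (c * c) * t powr (2 * s)"
        by (simp only: mult_2 powr_add)
    qed
    finally show ?thesis
      unfolding hcalc_scale[OF B continuous_on_powr_halfline[OF s2]] mat_powr_eq_hcalc .
  qed
  have B2: "mat_powr B (2 * s) \<in> carrier_mat n n"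
    using s0 by (intro mat_powr_carrier[OF B]) simp
  \<comment> \<open>The axioms of a rank function say nothing about scaling, so the constant is
    removed as multiplication by a scalar matrix.\<close>
  have "mat_powr B (2 * s) = mat_scaleC (of_real (1 / (c * c))) (1\<^sub>m n) * ((C * C) * (C * C))"
    unfolding c4 mat_scaleC_one_mult_left[OF mat_scaleC_carrier[OF B2]]
    using c B2 by (intro eq_matI) (auto simp: scaleC_scaleC)
  then have "rk (mat_powr B (2 * s)) \<le> rk ((C * C) * (C * C))"
    using rk_mult_le(2)[of "mat_scaleC (of_real (1 / (c * c))) (1\<^sub>m n)" n n "(C * C) * (C * C)" n] CCc n by auto
  also have "(C * C) * (C * C) = W * (mat_star G * G) * mat_star W"
  proof -
    have "(C * C) * (C * C) = W * (?D2 * mat_star W) * (G * mat_star W)"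
      unfolding C2 G_def by (simp only: assoc_mult_mat[OF W D(2) Ws])
    also have "\<dots> = W * (mat_star G * (G * mat_star W))"
      unfolding Gs by (rule assoc_mult_mat) (use W D Ws G in \<open>auto intro!: mult_carrier_mat\<close>)
    also have "mat_star G * (G * mat_star W) = mat_star G * G * mat_star W"
      by (rule assoc_mult_mat[symmetric]) (use W D Ws G in \<open>auto intro!: mult_carrier_mat\<close>)
    also have "W * (mat_star G * G * mat_star W) = W * (mat_star G * G) * mat_star W"
      by (rule assoc_mult_mat[symmetric]) (use W D Ws G in \<open>auto intro!: mult_carrier_mat\<close>)
    finally show ?thesis .
  qed
  also have "rk (W * (mat_star G * G) * mat_star W) \<le> rk (mat_star G * G)"
    by (rule rk_conj_le[OF W _ n n]) (use G in auto)
  also have "\<dots> = rk (G * mat_star G)"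
    using rk_gram_powr[OF G n n, of 1] mat_powr_one[OF gram_pos_mat[OF G n]] mat_powr_one[OF cogram_pos_mat[OF G n]]
    by simp
  also have "G * mat_star G = W * ?D4 * mat_star W"
  proof -
    have "G * mat_star G = W * ?D2 * ?D2 * mat_star W"
      unfolding Gs unfolding G_def
      by (rule assoc_mult_mat[symmetric]) (use W D Ws in \<open>auto intro!: mult_carrier_mat\<close>)
    then show ?thesis
      unfolding DD(2)[symmetric] assoc_mult_mat[OF W D(2) D(2)] .
  qed
  also have "rk (W * ?D4 * mat_star W) \<le> rk ?D4"
    by (rule rk_conj_le[OF W D(3) n n])
  also have "?D4 = mat_powr A (s' * (2 - 4 * \<beta>))"
    by (rule mat_powr_powr[OF A s(1) p(3)])
  finally show ?thesis .
qed

text \<open>The two losses are removed one after the other: \<open>\<beta>\<close> tends to 0 for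
  fixed \<open>s'\<close>, then \<open>\<gamma>\<close> tends to 0, that is \<open>s'\<close> to
  \<open>\<theta> / 2\<close>. The part of \<open>s\<close> is played by
  \<open>\<theta> / 2\<close>, and \<open>s \<le> 1\<close> becomes
  \<open>\<theta> \<le> 2\<close>.\<close>

lemma rk_powr_mono:
  assumes A: "pos_mat n A" and B: "pos_mat n B" and AB: "form_pos n (A - B)"
    and \<theta>: "0 < \<theta>" "\<theta> \<le> 2"
  shows "rk (mat_powr B \<theta>) \<le> rk (mat_powr A \<theta>)"
proof (rule rk_powr_lower_limit[OF A \<theta>(1), of "\<theta> / 2" _ "-2"])
  fix \<gamma> :: real
  assume \<gamma>: "0 < \<gamma>" "\<gamma> < \<theta> / 2"
  define s' where "s' = \<theta> / 2 - \<gamma>"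
  have s': "0 < s'" "s' < \<theta> / 2" "\<theta> / 2 \<le> 1"
    using \<gamma> \<theta> by (auto simp: s'_def)
  have "rk (mat_powr B \<theta>) \<le> rk (mat_powr A (2 * s'))"
  proof (rule rk_powr_lower_limit[OF A, of _ "1 / 2" _ "- 4 * s'"])
    fix \<beta> :: real
    assume \<beta>: "0 < \<beta>" "\<beta> < 1 / 2"
    have "2 * s' + - 4 * s' * \<beta> = s' * (2 - 4 * \<beta>)"
      by (simp add: right_diff_distrib)
    then show "rk (mat_powr B \<theta>) \<le> rk (mat_powr A (2 * s' + - 4 * s' * \<beta>))"
      using rk_powr_le_lossy[OF A B AB s' \<beta>] by simp
  qed (use s' in auto)
  then show "rk (mat_powr B \<theta>) \<le> rk (mat_powr A (\<theta> + - 2 * \<gamma>))"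
    by (simp add: s'_def right_diff_distrib)
qed (use \<theta> in auto)

end

theorem proposition5p7:
  fixes rk :: "'a::cstar_algebra mat \<Rightarrow> real"
  assumes "sylvester_rank_function rk"
  shows "(\<forall>A. positive_mat A \<longrightarrow>
            uniformly_continuous_on {0<..} (\<lambda>\<theta>. rk (mat_powr A \<theta>))) \<and>
         (\<forall>A\<in>rect_mats. rk A = rk (mat_abs A) \<and> rk (mat_abs A) = rk (mat_star A) \<and>
            (\<forall>\<theta>>0. rk (mat_powr (mat_abs A) \<theta>) = rk (mat_powr (mat_abs (mat_star A)) \<theta>))) \<and>
         (\<forall>A B. \<forall>\<theta>. 0 < \<theta> \<and> \<theta> \<le> 2 \<and> positive_mat B \<and> mat_le B A \<longrightarrow>
            rk (mat_powr B \<theta>) \<le> rk (mat_powr A \<theta>))"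
proof (intro conjI allI ballI impI)
  interpret cstar_rank rk
    using assms by (simp add: cstar_rank_def)
  have pos: "pos_mat (dim_row A) A" if "positive_mat A" for A :: "'a mat"
    using that by (auto simp: pos_mat_def positive_mat_def)
  have cancel: "M - N + N = M" if "M \<in> carrier_mat k k" "N \<in> carrier_mat k k" for M N :: "'a mat" and k
    using that by (intro eq_matI) auto
  show "uniformly_continuous_on {0<..} (\<lambda>\<theta>. rk (mat_powr A \<theta>))" if "positive_mat A" for A
    by (rule rk_powr_uniformly_continuous[OF pos[OF that]])
  fix A :: "'a mat"
  {
    assume "A \<in> rect_mats"
    then obtain m n where A: "A \<in> carrier_mat m n" and m: "0 < m" and n: "0 < n"
      by (auto simp: rect_mats_def)
    have half: "0 < (1 / 2 :: real)"
      by simp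
    note X = gram_pos_mat[OF A n] and Y = cogram_pos_mat[OF A m]
    show "rk A = rk (mat_abs A)"
      using rk_gram_sqrt[OF A n m] by (simp add: mat_abs_def)
    show "rk (mat_abs A) = rk (mat_star A)"
      using rk_gram_sqrt[OF mat_star_carrier[OF A] m n] rk_gram_powr[OF A n m half] by (simp add: mat_abs_def)
    fix \<theta> :: real
    assume \<theta>: "0 < \<theta>"
    \<comment> \<open>The power \<open>\<theta>\<close> of \<open>mat_abs A\<close> is the power
      \<open>\<theta> / 2\<close> of \<open>mat_star A * A\<close>, so the ranks are compared at
      this exponent.\<close>
    then have "0 < 1 / 2 * \<theta>"
      by simp
    from rk_gram_powr[OF A n m this]
    show "rk (mat_powr (mat_abs A) \<theta>) = rk (mat_powr (mat_abs (mat_star A)) \<theta>)"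
      unfolding mat_abs_def mat_star_star mat_powr_powr[OF X half \<theta>] mat_powr_powr[OF Y half \<theta>] .
  }
  fix B and \<theta> :: real
  assume *: "0 < \<theta> \<and> \<theta> \<le> 2 \<and> positive_mat B \<and> mat_le B A"
  let ?n = "dim_row B"
  have B: "pos_mat ?n B"
    using * pos by blast
  note n = pos_mat_dim(3)[OF B]
  have car: "A \<in> carrier_mat ?n ?n" "B \<in> carrier_mat ?n ?n"
    using * B unfolding mat_le_def pos_mat_def carrier_mat_def by (metis (lifting) mem_Collect_eq)+
  have "pos_mat ?n (A - B)"
    using * minus_carrier_mat[OF car(2), of A] unfolding mat_le_def pos_mat_def by blast
  then have AB: "form_pos ?n (A - B)"
    by (rule pos_mat_form_pos)
  \<comment> \<open>Positivity of \<open>A\<close> has to be derived from that of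
    \<open>A - B\<close> and \<open>B\<close>. For forms it is a plain sum, and
    \<open>form_pos_imp_pos_mat\<close> leads back to the spectrum.\<close>
  have "form_pos ?n (A - B + B)"
    by (rule form_pos_add[OF AB pos_mat_form_pos[OF B]])
  also have "A - B + B = A"
    by (rule cancel[OF car])
  finally have A: "pos_mat ?n A"
    using n by (rule form_pos_imp_pos_mat)
  show "rk (mat_powr B \<theta>) \<le> rk (mat_powr A \<theta>)"
    using * by (intro rk_powr_mono[OF A B AB]) auto
qed

end
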